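(* Let $k$ be an algebraically closed field of characteristic zero. For any Poisson $\mathcal{H}$-prime $I_\omega$ in $\mathcal{O}(SL_3)$, the quotient $\mathcal{O}(SL_3)/I_{\omega}$ is a commutative UFD.
   Context: $\mathcal{O}(M_3)=k[x_{ij}:1\le i,j\le3]$ is a Poisson algebra with, for $i<l$, $j<m$: $\{x_{ij},x_{im}\}=x_{ij}x_{im}$, $\{x_{ij},x_{lj}\}=x_{ij}x_{lj}$, $\{x_{im},x_{lj}\}=0$, $\{x_{ij},x_{lm}\}=2x_{im}x_{lj}$. The determinant $Det$ is Poisson central and $\mathcal{O}(SL_3)=\mathcal{O}(M_3)/\langle Det-1\rangle$ has the induced bracket. The torus acting on $\mathcal{O}(SL_3)$ is $$\{h=(\alpha_1,\alpha_2,\alpha_3,\beta_1,\beta_2,\beta_3)\in(k^\times)^6:\alpha_1\alpha_2\alpha_3\beta_1\beta_2\beta_3=1\},\qquad h.x_{ij}=\alpha_i\beta_jx_{ij}.$$ A Poisson ideal of a commutative Poisson algebra $R$ is an ideal $I$ with $\{I,R\}\subseteq I$. A Poisson $\mathcal{H}$-prime is a proper Poisson ideal $I$ that is stable under the torus and such that, for torus-stable Poisson ideals $J,K$ with $JK\subseteq I$, $J\subseteq I$ or $K\subseteq I$; here this is the same as a torus-stable Poisson ideal that is prime in the usual commutative sense. (There are 36 of them, indexed by $\omega\in S_3\times S_3$.) *)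

theory Defs
  imports
    "HOL-Algebra.Algebra"
    "HOL-Decision_Procs.Algebra_Aux"
    "HOL-Analysis.Analysis"
    "HOL-Library.Poly_Mapping"
begin

section \<open>Poisson ideals and Poisson \<open>H\<close>-primes\<close>

text \<open>
  The Poisson bracket \<open>br\<close> is a separate argument, and a group \<open>H\<close> acts through
  \<open>act :: 'h \<Rightarrow> 'a \<Rightarrow> 'a\<close>.
\<close>

definition poisson_ideal :: "('a, 'b) ring_scheme \<Rightarrow> ('a \<Rightarrow> 'a \<Rightarrow> 'a) \<Rightarrow> 'a set \<Rightarrow> bool" where
  "poisson_ideal R br I \<longleftrightarrow> ideal I R \<and> (\<forall>a\<in>I. \<forall>b\<in>carrier R. br a b \<in> I)"

definition stable_under :: "'h set \<Rightarrow> ('h \<Rightarrow> 'a \<Rightarrow> 'a) \<Rightarrow> 'a set \<Rightarrow> bool" where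
  "stable_under H act I \<longleftrightarrow> (\<forall>h\<in>H. \<forall>a\<in>I. act h a \<in> I)"

definition poisson_H_prime ::
  "('a, 'b) ring_scheme \<Rightarrow> ('a \<Rightarrow> 'a \<Rightarrow> 'a) \<Rightarrow> 'h set \<Rightarrow> ('h \<Rightarrow> 'a \<Rightarrow> 'a) \<Rightarrow> 'a set \<Rightarrow> bool" where
  "poisson_H_prime R br H act I \<longleftrightarrow>
     poisson_ideal R br I \<and> stable_under H act I \<and> I \<noteq> carrier R \<and>
     (\<forall>J K. poisson_ideal R br J \<and> stable_under H act J \<and>
            poisson_ideal R br K \<and> stable_under H act K \<and>
            J \<cdot>\<^bsub>R\<^esub> K \<subseteq> I \<longrightarrow> J \<subseteq> I \<or> K \<subseteq> I)"


section \<open>The Poisson algebra of 3 by 3 matrices\<close>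

text \<open>
  Polynomials in the nine variables \<open>mvar i j\<close> are finitely supported maps from exponent
  vectors to coefficients, with the convolution product.  The index type \<^typ>\<open>3\<close> has the
  elements \<open>0 < 1 < 2\<close> (the numeral \<open>3\<close> of this type equals \<open>0\<close>); they stand, in this
  order, for the usual row and column indices 1, 2, 3.
\<close>

type_synonym 'k mat3_poly = "((3 \<times> 3) \<Rightarrow>\<^sub>0 nat) \<Rightarrow>\<^sub>0 'k"

definition const_poly :: "'k :: comm_ring_1 \<Rightarrow> 'k mat3_poly" where
  "const_poly c = Poly_Mapping.single 0 c"

definition mvar :: "3 \<Rightarrow> 3 \<Rightarrow> 'k :: comm_ring_1 mat3_poly" where
  "mvar i j = Poly_Mapping.single (Poly_Mapping.single (i, j) 1) 1"

definition pderivative :: "3 \<times> 3 \<Rightarrow> 'k :: comm_ring_1 mat3_poly \<Rightarrow> 'k mat3_poly" where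
  "pderivative v f = (\<Sum>m\<in>Poly_Mapping.keys f.
     Poly_Mapping.single (m - Poly_Mapping.single v 1)
       (of_nat (Poly_Mapping.lookup m v) * Poly_Mapping.lookup f m))"

definition order_sign :: "3 \<Rightarrow> 3 \<Rightarrow> 'a :: comm_ring_1" where
  "order_sign a b = (if a < b then 1 else if b < a then - 1 else 0)"

text \<open>
  The formula combines all the defining relations; see \<open>M3_bracket_row\<close>, \<open>M3_bracket_column\<close>,
  \<open>M3_bracket_antidiagonal\<close> and \<open>M3_bracket_diagonal\<close> below.
\<close>

definition generator_bracket :: "3 \<times> 3 \<Rightarrow> 3 \<times> 3 \<Rightarrow> 'k :: comm_ring_1 mat3_poly" where
  "generator_bracket v w = (case (v, w) of ((i, j), (l, m)) \<Rightarrow>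
     (order_sign i l + order_sign j m) * mvar i m * mvar l j)"

text \<open>The biderivation extending the bracket of the generators.\<close>

definition M3_bracket :: "'k :: comm_ring_1 mat3_poly \<Rightarrow> 'k mat3_poly \<Rightarrow> 'k mat3_poly" where
  "M3_bracket f g = (\<Sum>v\<in>UNIV. \<Sum>w\<in>UNIV. generator_bracket v w * pderivative v f * pderivative w g)"

definition Det :: "'k :: comm_ring_1 mat3_poly" where
  "Det = det (\<chi> i j. mvar i j)"

definition O_M3 :: "'k :: comm_ring_1 mat3_poly ring" where
  "O_M3 = cring_class_ops"


subsection \<open>It is a Poisson algebra and \<open>Det\<close> is central\<close>

lemma update_single: "a \<notin> Poly_Mapping.keys f \<Longrightarrow> Poly_Mapping.update a b f = f + Poly_Mapping.single a b"
  by (rule poly_mapping_eqI) (auto simp: lookup_update lookup_add lookup_single when_def in_keys_iff)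

lemma poly_mapping_monomial_induct:
  assumes "P 0" "\<And>f a b. P f \<Longrightarrow> P (f + Poly_Mapping.single a b)"
  shows "P f"
  using assms by (induct f rule: update_induct) (auto simp: update_single)

lemma pderivative_single: "pderivative v (Poly_Mapping.single m c) =
   Poly_Mapping.single (m - Poly_Mapping.single v 1) (of_nat (Poly_Mapping.lookup m v) * c)"
  by (cases "c = 0") (auto simp: pderivative_def)

lemma pderivative_0 [simp]: "pderivative v 0 = 0"
  by (simp add: pderivative_def)

lemma pderivative_add: "pderivative v (f + g) = pderivative v f + pderivative v g"
  unfolding pderivative_def
  by (rule setsum_keys_plus_distrib) (auto simp: single_add distrib_left)

lemma pderivative_uminus: "pderivative v (- f) = - pderivative v f"
  by (metis add.right_inverse add_eq_0_iff pderivative_0 pderivative_add)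

lemma pderivative_mult:
  "pderivative v (f * g) = pderivative v f * g + f * pderivative v g"
proof (induct f rule: poly_mapping_monomial_induct)
  case (2 f a b)
  have "pderivative v (Poly_Mapping.single a b * g) =
     pderivative v (Poly_Mapping.single a b) * g + Poly_Mapping.single a b * pderivative v g"
  proof (induct g rule: poly_mapping_monomial_induct)
    case (2 g c d)
    have s1: "Poly_Mapping.single (a + c - Poly_Mapping.single v 1) (of_nat (Poly_Mapping.lookup a v) * b * d)
        = Poly_Mapping.single (a - Poly_Mapping.single v 1 + c) (of_nat (Poly_Mapping.lookup a v) * b * d)"
    proof (cases "Poly_Mapping.lookup a v = 0")
      case False
      then have "a + c - Poly_Mapping.single v 1 = a - Poly_Mapping.single v 1 + c"
        by (intro poly_mapping_eqI) (auto simp: lookup_add lookup_minus lookup_single when_def)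
      then show ?thesis by simp
    qed simp
    have s2: "Poly_Mapping.single (a + c - Poly_Mapping.single v 1) (of_nat (Poly_Mapping.lookup c v) * b * d)
        = Poly_Mapping.single (a + (c - Poly_Mapping.single v 1)) (of_nat (Poly_Mapping.lookup c v) * b * d)"
    proof (cases "Poly_Mapping.lookup c v = 0")
      case False
      then have "a + c - Poly_Mapping.single v 1 = a + (c - Poly_Mapping.single v 1)"
        by (intro poly_mapping_eqI) (auto simp: lookup_add lookup_minus lookup_single when_def)
      then show ?thesis by simp
    qed simp
    have "pderivative v (Poly_Mapping.single a b * Poly_Mapping.single c d) =
      Poly_Mapping.single (a + c - Poly_Mapping.single v 1) (of_nat (Poly_Mapping.lookup a v) * b * d) +
      Poly_Mapping.single (a + c - Poly_Mapping.single v 1) (of_nat (Poly_Mapping.lookup c v) * b * d)"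
      by (simp add: mult_single pderivative_single lookup_add single_add [symmetric] algebra_simps)
    then show ?case using 2 unfolding s1 s2
      by (simp add: distrib_left distrib_right pderivative_add pderivative_single mult_single ac_simps)
  qed simp
  with 2 show ?case by (simp add: pderivative_add algebra_simps)
qed simp

lemma pderivative_mvar: "pderivative v (mvar i j) = (if v = (i, j) then 1 else 0)"
  by (simp add: mvar_def pderivative_single lookup_single when_def)

lemma pderivative_const [simp]: "pderivative v (const_poly c) = 0"
  by (simp add: const_poly_def pderivative_single)

lemma M3_bracket_mvar:
  "M3_bracket (mvar i j) (mvar l m) = (order_sign i l + order_sign j m) * mvar i m * mvar l j"
proof -
  have "M3_bracket (mvar i j) (mvar l m) = generator_bracket (i, j) (l, m)"
    by (simp add: M3_bracket_def pderivative_mvar if_distrib [of "\<lambda>z. _ * z"] if_distrib [of "\<lambda>z. z * _"] cong: if_cong)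
  then show ?thesis by (simp add: generator_bracket_def)
qed

lemma M3_bracket_row: "j < m \<Longrightarrow> M3_bracket (mvar i j) (mvar i m) = mvar i j * mvar i m"
  by (simp add: M3_bracket_mvar order_sign_def)

lemma M3_bracket_column: "i < l \<Longrightarrow> M3_bracket (mvar i j) (mvar l j) = mvar i j * mvar l j"
  by (simp add: M3_bracket_mvar order_sign_def)

lemma
  assumes "i < l" "j < m"
  shows M3_bracket_antidiagonal: "M3_bracket (mvar i m) (mvar l j) = 0"
    and M3_bracket_diagonal: "M3_bracket (mvar i j) (mvar l m) = 2 * mvar i m * mvar l j"
  using assms by (simp_all add: M3_bracket_mvar order_sign_def)

lemma M3_bracket_add_left: "M3_bracket (f + g) h = M3_bracket f h + M3_bracket g h"
  by (simp add: M3_bracket_def pderivative_add algebra_simps sum.distrib)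

lemma M3_bracket_const_left: "M3_bracket (const_poly c) h = 0"
  by (simp add: M3_bracket_def)

lemma M3_bracket_mult_left:
  "M3_bracket (f * g) h = f * M3_bracket g h + M3_bracket f h * g"
  by (simp add: M3_bracket_def pderivative_mult algebra_simps sum.distrib sum_distrib_left)

lemma generator_bracket_swap: "generator_bracket w v = - generator_bracket v w"
  by (auto simp: generator_bracket_def order_sign_def ac_simps split: prod.split)

lemma M3_bracket_antisym: "M3_bracket g f = - M3_bracket f g"
proof -
  have "M3_bracket g f = (\<Sum>w\<in>UNIV. \<Sum>v\<in>UNIV. generator_bracket v w * pderivative v g * pderivative w f)"
    unfolding M3_bracket_def by (rule sum.swap)
  also have "\<dots> = (\<Sum>w\<in>UNIV. \<Sum>v\<in>UNIV. - (generator_bracket w v * pderivative w f * pderivative v g))"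
    by (intro sum.cong refl, subst generator_bracket_swap) (simp add: ac_simps)
  finally show ?thesis by (simp add: M3_bracket_def sum_negf)
qed

lemma M3_bracket_add_right: "M3_bracket f (g + h) = M3_bracket f g + M3_bracket f h"
  by (simp add: M3_bracket_def pderivative_add algebra_simps sum.distrib)

lemma M3_bracket_const_right: "M3_bracket f (const_poly c) = 0"
  by (simp add: M3_bracket_def)

lemma M3_bracket_mult_right:
  "M3_bracket f (g * h) = g * M3_bracket f h + M3_bracket f g * h"
  by (simp add: M3_bracket_def pderivative_mult algebra_simps sum.distrib sum_distrib_left)


lemma mat3_poly_induct [case_names const var add mult]:
  fixes f :: "'k :: comm_ring_1 mat3_poly"
  assumes c: "\<And>c. P (const_poly c)" and v: "\<And>i j. P (mvar i j)"
    and a: "\<And>f g. P f \<Longrightarrow> P g \<Longrightarrow> P (f + g)" and m: "\<And>f g. P f \<Longrightarrow> P g \<Longrightarrow> P (f * g)"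
  shows "P f"
proof (induct f rule: poly_mapping_monomial_induct)
  case 1
  show ?case using c [of 0] by (simp add: const_poly_def)
next
  case (2 f e b)
  have "P (Poly_Mapping.single (Poly_Mapping.single w n) 1)" for w n
  proof (induct n)
    case 0
    show ?case using c [of 1] by (simp add: const_poly_def)
  next
    case (Suc n)
    then show ?case using m [OF v [of "fst w" "snd w"] Suc]
      by (simp add: mvar_def mult_single single_add [symmetric])
  qed
  then have "P (Poly_Mapping.single e b)"
  proof (induct e rule: poly_mapping_monomial_induct)
    case 1
    show ?case using c [of b] by (simp add: const_poly_def)
  next
    case (2 e w n)
    then show ?case using m [OF 2(1) 2(2) [of w n]] by (simp add: mult_single)
  qed
  with 2 show ?case by (rule a)
qed

lemma num3_cases: "i = 0 \<or> i = 1 \<or> i = (2::3)"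
  using exhaust_3 [of i] by auto

lemma num3_less: "(0::3) < 1" "(0::3) < 2" "(1::3) < 2"
  by (simp_all add: less_bit1_def bit1.Rep_0 bit1.Rep_1 bit1.Rep_numeral)

lemma order_sign_num3:
  "order_sign a a = 0" "order_sign 0 1 = 1" "order_sign 0 2 = 1" "order_sign 1 2 = 1"
  "order_sign 1 0 = - 1" "order_sign 2 0 = - 1" "order_sign 2 1 = - 1"
  using num3_less by (auto simp: order_sign_def dest: less_asym)

lemma Det_expand: "(Det :: 'k :: comm_ring_1 mat3_poly) =
   mvar 0 0 * mvar 1 1 * mvar 2 2 + mvar 0 1 * mvar 1 2 * mvar 2 0 + mvar 0 2 * mvar 1 0 * mvar 2 1
   - mvar 0 0 * mvar 1 2 * mvar 2 1 - mvar 0 1 * mvar 1 0 * mvar 2 2 - mvar 0 2 * mvar 1 1 * mvar 2 0"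
proof -
  have 3: "(3::3) = 0" by simp
  show ?thesis
    unfolding Det_def det_3 3 by (simp add: algebra_simps)
qed

lemma M3_bracket_0 [simp]: "M3_bracket 0 f = 0" "M3_bracket f 0 = 0"
  by (simp_all add: M3_bracket_def)

lemma M3_bracket_uminus: "M3_bracket (- f) g = - M3_bracket f g" "M3_bracket f (- g) = - M3_bracket f g"
  by (simp_all add: M3_bracket_def pderivative_uminus sum_negf)

lemma M3_bracket_diff: "M3_bracket (f - f') g = M3_bracket f g - M3_bracket f' g" "M3_bracket f (g - g') = M3_bracket f g - M3_bracket f g'"
  using M3_bracket_add_left [of f "- f'" g] M3_bracket_add_right [of f g "- g'"] by (simp_all add: M3_bracket_uminus)

lemma M3_bracket_order_sign: "M3_bracket f (order_sign a b * g) = order_sign a b * M3_bracket f g"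
  by (simp add: order_sign_def M3_bracket_uminus)

lemma M3_bracket_Det: "M3_bracket f Det = 0"
proof (induct f rule: mat3_poly_induct)
  case (var i j)
  show ?case
    using num3_cases [of i] num3_cases [of j]
    by (elim disjE; hypsubst; simp add: Det_expand M3_bracket_diff M3_bracket_add_right M3_bracket_mult_right M3_bracket_mvar
        order_sign_num3 algebra_simps)
qed (simp_all add: M3_bracket_add_left M3_bracket_const_left M3_bracket_mult_left)

lemma order_sign_swap: "order_sign b a = - order_sign a b"
  by (auto simp: order_sign_def)

lemma order_sign_cocycle:
  "order_sign a b * order_sign b c - order_sign a b * order_sign a c - order_sign a c * order_sign b c =
    (if a = b \<and> b = c then 0 else - 1)"
  using num3_cases [of a] num3_cases [of b] num3_cases [of c]
  by (elim disjE; hypsubst; simp add: order_sign_num3)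

lemma M3_bracket_mvar_mvar:
  "M3_bracket (mvar i j) (M3_bracket (mvar l m) (mvar p q)) =
    (order_sign l p + order_sign m q) *
      ((order_sign i l + order_sign j q) * (mvar i q * mvar l j * mvar p m) +
       (order_sign i p + order_sign j m) * (mvar i m * mvar l q * mvar p j))"
proof -
  have "M3_bracket f ((order_sign a b + order_sign c d) * g) = (order_sign a b + order_sign c d) * M3_bracket f g"
    for a b c d and f g :: "'a mat3_poly"
    by (simp only: distrib_right M3_bracket_add_right M3_bracket_order_sign)
  then have "M3_bracket (mvar i j) (M3_bracket (mvar l m) (mvar p q)) =
    (order_sign l p + order_sign m q) * M3_bracket (mvar i j) (mvar l q * mvar p m :: 'a mat3_poly)"
    by (simp only: M3_bracket_mvar mult.assoc)
  then show ?thesis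
    by (simp only: M3_bracket_mult_right M3_bracket_mvar) (simp add: algebra_simps)
qed

lemma M3_bracket_Jacobi_mvar:
  "M3_bracket (mvar i j) (M3_bracket (mvar l m) (mvar p q)) +
   M3_bracket (mvar l m) (M3_bracket (mvar p q) (mvar i j)) +
   M3_bracket (mvar p q) (M3_bracket (mvar i j) (mvar l m)) = 0"
  (is "?J = 0")
proof -
  have "?J =
    ((order_sign i l * order_sign l p - order_sign i l * order_sign i p - order_sign i p * order_sign l p) -
     (order_sign j m * order_sign m q - order_sign j m * order_sign j q - order_sign j q * order_sign m q)) *
    (mvar i q * mvar l j * mvar p m - mvar i m * mvar l q * mvar p j)"
    unfolding M3_bracket_mvar_mvar
      order_sign_swap [of p i] order_sign_swap [of q j] order_sign_swap [of p l]
      order_sign_swap [of q m] order_sign_swap [of l i] order_sign_swap [of m j]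
    by (simp add: algebra_simps)
  then show ?thesis unfolding order_sign_cocycle by auto
qed

lemma M3_bracket_Jacobi: "M3_bracket f (M3_bracket g h) + M3_bracket g (M3_bracket h f) + M3_bracket h (M3_bracket f g) = 0"
proof -
  define J where "J f g h = M3_bracket f (M3_bracket g h) + M3_bracket g (M3_bracket h f) + M3_bracket h (M3_bracket f g)"
    for f g h :: "'a mat3_poly"
  have cyc: "J f g h = J g h f" for f g h by (simp add: J_def algebra_simps)
  have c: "J f g (const_poly c) = 0" for f g c
    by (simp add: J_def M3_bracket_const_left M3_bracket_const_right)
  have a: "J f g (h + h') = J f g h + J f g h'" for f g h h'
    by (simp add: J_def M3_bracket_add_left M3_bracket_add_right algebra_simps)
  have m: "J f g (h * h') = h * J f g h' + J f g h * h'" for f g h h'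
    unfolding J_def M3_bracket_mult_left M3_bracket_mult_right M3_bracket_add_right
      M3_bracket_antisym [of f h] M3_bracket_antisym [of f h']
      M3_bracket_antisym [of h g] M3_bracket_antisym [of h' g] M3_bracket_uminus
    by (simp add: algebra_simps)
  have step: "J f g h = 0" if "\<And>i j. J f g (mvar i j) = 0" for f g h
    by (induct h rule: mat3_poly_induct) (simp_all add: that c a m)
  have "J f g h = 0"
    by (rule step, subst cyc, rule step, subst cyc, rule step) (simp add: J_def M3_bracket_Jacobi_mvar)
  then show ?thesis by (simp add: J_def)
qed


section \<open>The torus\<close>

definition torus :: "((3 \<Rightarrow> 'k :: field) \<times> (3 \<Rightarrow> 'k)) set" where
  "torus = {(\<alpha>, \<beta>). (\<forall>i. \<alpha> i \<noteq> 0) \<and> (\<forall>j. \<beta> j \<noteq> 0) \<and> (\<Prod>i\<in>UNIV. \<alpha> i) * (\<Prod>j\<in>UNIV. \<beta> j) = 1}"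

text \<open>
  The algebra endomorphism with \<open>mvar i j \<mapsto> \<alpha> i * \<beta> j * mvar i j\<close>: it rescales each monomial.
\<close>

definition torus_act :: "(3 \<Rightarrow> 'k :: field) \<times> (3 \<Rightarrow> 'k) \<Rightarrow> 'k mat3_poly \<Rightarrow> 'k mat3_poly" where
  "torus_act h = Poly_Mapping.mapp
     (\<lambda>m c. (\<Prod>(i, j)\<in>UNIV. (fst h i * snd h j) ^ Poly_Mapping.lookup m (i, j)) * c)"

lemma torus_act_add: "torus_act h (f + g) = torus_act h f + torus_act h g"
  by (rule poly_mapping_eqI)
    (auto simp: torus_act_def lookup_mapp lookup_add when_def in_keys_iff distrib_left [symmetric])

lemma torus_act_0 [simp]: "torus_act h 0 = 0"
  by (rule poly_mapping_eqI) (simp add: torus_act_def lookup_mapp)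

lemma torus_act_uminus: "torus_act h (- f) = - torus_act h f"
  by (metis add.right_inverse add_eq_0_iff torus_act_0 torus_act_add)

lemma torus_act_diff: "torus_act h (f - g) = torus_act h f - torus_act h g"
  using torus_act_add [of h f "- g"] by (simp add: torus_act_uminus)

lemma torus_act_single: "torus_act h (Poly_Mapping.single m c) = Poly_Mapping.single m
    ((\<Prod>(i, j)\<in>UNIV. (fst h i * snd h j) ^ Poly_Mapping.lookup m (i, j)) * c)"
  by (rule poly_mapping_eqI) (auto simp: torus_act_def lookup_mapp lookup_single when_def in_keys_iff)

lemma torus_act_mult: "torus_act h (f * g) = torus_act h f * torus_act h g"
proof (induct f rule: poly_mapping_monomial_induct)
  case (2 f a b)
  have "torus_act h (Poly_Mapping.single a b * g) = torus_act h (Poly_Mapping.single a b) * torus_act h g"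
    by (induct g rule: poly_mapping_monomial_induct)
      (simp_all add: distrib_left torus_act_add torus_act_single mult_single lookup_add power_add
        prod.distrib case_prod_unfold ac_simps)
  with 2 show ?case by (simp add: distrib_right torus_act_add)
qed simp

lemma torus_act_const: "torus_act h (const_poly c) = const_poly c"
  by (simp add: const_poly_def torus_act_single)

lemma torus_act_mvar: "torus_act h (mvar i j) = const_poly (fst h i * snd h j) * mvar i j"
proof -
  have "(\<Prod>(i', j')\<in>UNIV. (fst h i' * snd h j') ^ Poly_Mapping.lookup (Poly_Mapping.single (i, j) 1) (i', j'))
     = (\<Prod>v\<in>UNIV. if v = (i, j) then fst h i * snd h j else 1)"
    by (rule prod.cong) (auto simp: lookup_single when_def split: if_splits prod.splits)
  then show ?thesis
    by (simp add: mvar_def const_poly_def torus_act_single mult_single)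
qed

lemma torus_act_Det:
  assumes "h \<in> torus"
  shows "torus_act h Det = Det"
proof -
  obtain \<alpha> \<beta> where h: "h = (\<alpha>, \<beta>)" by (cases h)
  have 3: "(3::3) = 0" by simp
  have 1: "\<alpha> 0 * \<alpha> 1 * \<alpha> 2 * (\<beta> 0 * \<beta> 1 * \<beta> 2) = 1"
    using assms unfolding h torus_def UNIV_3 3 by (simp add: ac_simps)
  have c: "const_poly a * const_poly b = const_poly (a * b)" for a b :: 'a
    by (simp add: const_poly_def mult_single)
  define d where "d = const_poly (\<alpha> 0) * const_poly (\<alpha> 1) * const_poly (\<alpha> 2) *
    (const_poly (\<beta> 0) * const_poly (\<beta> 1) * const_poly (\<beta> 2))"
  have "d = 1" unfolding d_def c 1 by (simp add: const_poly_def)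
  moreover have "torus_act h Det = d * Det"
    unfolding Det_expand d_def
    by (simp add: torus_act_add torus_act_diff torus_act_mult torus_act_mvar h c [symmetric] algebra_simps)
  ultimately show ?thesis by simp
qed


section \<open>The quotient by \<open>Det - 1\<close>\<close>

definition Det_ideal :: "'k :: comm_ring_1 mat3_poly set" where
  "Det_ideal = Idl\<^bsub>O_M3\<^esub> {Det - 1}"

definition O_SL3 :: "'k :: comm_ring_1 mat3_poly set ring" where
  "O_SL3 = O_M3 Quot Det_ideal"

text \<open>
  The induced operations on cosets, defined as \<^const>\<open>rcoset_mult\<close> defines the product.
\<close>

definition SL3_bracket ::
  "'k :: comm_ring_1 mat3_poly set \<Rightarrow> 'k mat3_poly set \<Rightarrow> 'k mat3_poly set" where
  "SL3_bracket A B = (\<Union>f\<in>A. \<Union>g\<in>B. Det_ideal +>\<^bsub>O_M3\<^esub> M3_bracket f g)"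

definition SL3_torus_act ::
  "(3 \<Rightarrow> 'k :: field) \<times> (3 \<Rightarrow> 'k) \<Rightarrow> 'k mat3_poly set \<Rightarrow> 'k mat3_poly set" where
  "SL3_torus_act h A = (\<Union>f\<in>A. Det_ideal +>\<^bsub>O_M3\<^esub> torus_act h f)"

subsection \<open>The operations are well defined\<close>

lemma torus_act_one: "torus_act h 1 = 1"
  using torus_act_const [of h 1] by (simp add: const_poly_def)

lemma Det_ideal_eq: "Det_ideal = range (\<lambda>r. r * (Det - 1))"
proof -
  have "Det_ideal = PIdl\<^bsub>O_M3\<^esub> (Det - 1)"
    unfolding Det_ideal_def O_M3_def
    by (rule cring.cgenideal_eq_genideal [OF cring_class, symmetric]) (simp add: carrier_class)
  then show ?thesis
    by (auto simp: cgenideal_def O_M3_def cring_class_ops_def)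
qed

lemma Det_coset_eq: "Det_ideal +>\<^bsub>O_M3\<^esub> f = range (\<lambda>r. r * (Det - 1) + f)"
  by (auto simp: a_r_coset_def' O_M3_def cring_class_ops_def Det_ideal_eq)

lemma Det_coset_eqI:
  assumes "g = f + r * (Det - 1)"
  shows "Det_ideal +>\<^bsub>O_M3\<^esub> g = Det_ideal +>\<^bsub>O_M3\<^esub> f"
proof -
  have "s * (Det - 1) + g = (s + r) * (Det - 1) + f" "s * (Det - 1) + f = (s - r) * (Det - 1) + g" for s
    by (simp_all add: assms algebra_simps)
  then show ?thesis unfolding Det_coset_eq by (metis (no_types, lifting) rangeI image_subset_iff subset_antisym)
qed

lemma SL3_torus_act_coset:
  assumes "h \<in> torus"
  shows "SL3_torus_act h (Det_ideal +>\<^bsub>O_M3\<^esub> f) = Det_ideal +>\<^bsub>O_M3\<^esub> torus_act h f"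
proof -
  have "Det_ideal +>\<^bsub>O_M3\<^esub> torus_act h g = Det_ideal +>\<^bsub>O_M3\<^esub> torus_act h f"
    if "g \<in> Det_ideal +>\<^bsub>O_M3\<^esub> f" for g
  proof -
    from that obtain r where "g = r * (Det - 1) + f" by (auto simp: Det_coset_eq)
    then have "torus_act h g = torus_act h f + torus_act h r * (Det - 1)"
      using assms by (simp add: torus_act_add torus_act_mult torus_act_diff torus_act_Det torus_act_one)
    then show ?thesis by (rule Det_coset_eqI)
  qed
  moreover have "f \<in> Det_ideal +>\<^bsub>O_M3\<^esub> f" unfolding Det_coset_eq by (rule range_eqI [of _ _ 0]) simp
  ultimately show ?thesis unfolding SL3_torus_act_def by blast
qed

lemma SL3_bracket_coset:
  "SL3_bracket (Det_ideal +>\<^bsub>O_M3\<^esub> f) (Det_ideal +>\<^bsub>O_M3\<^esub> g) = Det_ideal +>\<^bsub>O_M3\<^esub> M3_bracket f g"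
proof -
  have D: "M3_bracket u (Det - 1) = 0" "M3_bracket (Det - 1) u = 0" for u :: "'a mat3_poly"
    using M3_bracket_antisym [of "Det - 1" u] M3_bracket_const_right [of u 1]
    by (simp_all add: M3_bracket_diff M3_bracket_Det const_poly_def)
  have "Det_ideal +>\<^bsub>O_M3\<^esub> M3_bracket f' g' = Det_ideal +>\<^bsub>O_M3\<^esub> M3_bracket f g"
    if "f' \<in> Det_ideal +>\<^bsub>O_M3\<^esub> f" "g' \<in> Det_ideal +>\<^bsub>O_M3\<^esub> g" for f' g'
  proof -
    from that obtain r s where "f' = r * (Det - 1) + f" "g' = s * (Det - 1) + g" by (auto simp: Det_coset_eq)
    then have "M3_bracket f' g' = M3_bracket f g + (M3_bracket r g' + M3_bracket f s) * (Det - 1)"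
      by (simp add: M3_bracket_add_left M3_bracket_add_right M3_bracket_mult_left M3_bracket_mult_right D distrib_right)
    then show ?thesis by (rule Det_coset_eqI)
  qed
  moreover have "u \<in> Det_ideal +>\<^bsub>O_M3\<^esub> u" for u :: "'a mat3_poly"
    unfolding Det_coset_eq by (rule range_eqI [of _ _ 0]) simp
  ultimately show ?thesis unfolding SL3_bracket_def by blast
qed

end

theory Submission
  imports Defs "HOL-Computational_Algebra.Polynomial_Factorial"
begin

text \<open>
  Let \<open>R\<close> be the polynomial ring in the nine entries \<open>x i j\<close> of a matrix, with indices \<open>0, 1, 2\<close>, and
  write \<open>[i l|j m]\<close> for the minor with rows \<open>i, l\<close> and columns \<open>j, m\<close>. Pulled back to \<open>R\<close>, a Poisson
  \<open>H\<close>-prime of the coordinate ring of \<open>SL\<^sub>3\<close> is an ideal \<open>I\<close> that contains \<open>Det - 1\<close>, is stable under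
  brackets and torus, and is prime among such ideals. The theorem says that \<open>R / I\<close> is a factorial
  domain. Three ideas carry the proof.

  \<^bold>\<open>Regularity.\<close> \<open>R\<close> is Noetherian, and therefore a torus weight vector outside \<open>I\<close> is not a zero
  divisor modulo \<open>I\<close> (\<open>hprime_regular\<close>): the elements killed by its powers form a stable ideal, and a
  single power kills all of them. For entries and minors this acts as a substitute for primality.
  With the brackets it yields, for instance, that \<open>x 0 0\<close> and \<open>[0 1|0 1]\<close> never lie in \<open>I\<close>.

  \<^bold>\<open>Charts.\<close> Eight entries and minors have such simple brackets that torus weights, together with
  the brackets with some of them, separate their monomials. Hence those outside \<open>I\<close> are
  algebraically independent modulo \<open>I\<close> (\<open>independent_mod_hprime\<close>). As they generate \<open>R\<close> up to
  denominators, \<open>I\<close> is determined up to denominators by which entries and minors at the lower left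
  and upper right corners it contains (\<open>hprime_corner_ideal\<close>). Consequently a matrix of rational
  functions of determinant \<open>1\<close> at which these few elements vanish, but the denominator does not,
  defines a homomorphism on \<open>R / I\<close>, and if the matrix has suitable coordinates, this homomorphism
  embeds \<open>R / I\<close> into the field of rational functions and turns \<open>(R / I)[1 / e]\<close>, for a weight vector
  \<open>e\<close>, into a localised polynomial ring (locale \<open>chart\<close>).

  \<^bold>\<open>Nagata's theorem.\<close> The factorisation of a matrix into lower triangular, diagonal and upper
  triangular part gives a chart with \<open>e = x 0 0 * [0 1|0 1]\<close>. Polynomial rings are factorial by
  Gauss's lemma, and so by Nagata's theorem it is enough that \<open>x 0 0\<close> and \<open>[0 1|0 1]\<close> are prime or
  invertible modulo \<open>I\<close>. The cofactor matrix gives a Poisson involution that exchanges the two. For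
  \<open>x 0 0\<close> there are further charts, with \<open>e = x 1 0\<close> and \<open>e = x 2 0\<close>, in which \<open>x 0 0\<close> is a coordinate;
  expanding \<open>Det = 1\<close> along the first column shows that \<open>x 1 0\<close> and \<open>x 2 0\<close> generate the unit ideal
  modulo \<open>x 0 0\<close>, so that divisibility by \<open>x 0 0\<close> can be tested on these charts
  (\<open>corner_prime_or_unit\<close>).
\<close>


section \<open>Polynomials and substitution\<close>

definition var_poly :: "'v \<Rightarrow> ('v \<Rightarrow>\<^sub>0 nat) \<Rightarrow>\<^sub>0 'k :: comm_ring_1" where
  "var_poly v = Poly_Mapping.single (Poly_Mapping.single v 1) 1"

abbreviation coeff_poly :: "'k :: comm_ring_1 \<Rightarrow> ('v \<Rightarrow>\<^sub>0 nat) \<Rightarrow>\<^sub>0 'k" where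
  "coeff_poly \<equiv> Poly_Mapping.single 0"

lemma coeff_poly_add: "coeff_poly (a + b) = coeff_poly a + coeff_poly b"
  and coeff_poly_mult: "coeff_poly (a * b) = coeff_poly a * coeff_poly b"
  by (simp_all add: single_add mult_single)

lemma mvar_var_poly: "mvar i j = var_poly (i, j)"
  by (simp add: mvar_def var_poly_def)

lemma poly_induct_gens [case_names const var add mult]:
  fixes f :: "('v \<Rightarrow>\<^sub>0 nat) \<Rightarrow>\<^sub>0 'k :: comm_ring_1"
  assumes "\<And>c. P (coeff_poly c)" "\<And>v. P (var_poly v)"
    "\<And>f g. P f \<Longrightarrow> P g \<Longrightarrow> P (f + g)" "\<And>f g. P f \<Longrightarrow> P g \<Longrightarrow> P (f * g)"
  shows "P f"
proof (induct f rule: poly_mapping_monomial_induct)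
  case 1
  show ?case using assms(1) [of 0] by simp
next
  case (2 f e b)
  have "P (Poly_Mapping.single (Poly_Mapping.single w n) 1)" for w n
  proof (induct n)
    case 0
    show ?case using assms(1) [of 1] by simp
  next
    case (Suc n)
    then show ?case using assms(4) [OF assms(2) [of w] Suc]
      by (simp add: var_poly_def mult_single single_add [symmetric])
  qed
  then have "P (Poly_Mapping.single e b)"
  proof (induct e rule: poly_mapping_monomial_induct)
    case 1
    show ?case using assms(1) [of b] by simp
  next
    case (2 e w n)
    then show ?case using assms(4) [OF 2(1) 2(2) [of w n]] by (simp add: mult_single)
  qed
  with 2 show ?case by (rule assms(3))
qed

definition monomial_value :: "('v \<Rightarrow> 'b) \<Rightarrow> ('v \<Rightarrow>\<^sub>0 nat) \<Rightarrow> 'b :: comm_ring_1" where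
  "monomial_value y m = (\<Prod>v\<in>Poly_Mapping.keys m. y v ^ Poly_Mapping.lookup m v)"

lemma monomial_value_superset:
  assumes "finite V" "Poly_Mapping.keys m \<subseteq> V"
  shows "monomial_value y m = (\<Prod>v\<in>V. y v ^ Poly_Mapping.lookup m v)"
  unfolding monomial_value_def using assms
  by (intro prod.mono_neutral_left) (auto simp: in_keys_iff)

lemma monomial_value_0 [simp]: "monomial_value y 0 = 1"
  by (simp add: monomial_value_def)

lemma monomial_value_add: "monomial_value y (m + n) = monomial_value y m * monomial_value y n"
proof -
  let ?V = "Poly_Mapping.keys m \<union> Poly_Mapping.keys n"
  have "Poly_Mapping.keys (m + n) \<subseteq> ?V" by (rule keys_add)
  then show ?thesis
    by (simp add: monomial_value_superset [of ?V] lookup_add power_add prod.distrib)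
qed

lemma monomial_value_single: "monomial_value y (Poly_Mapping.single v n) = y v ^ n"
  by (subst monomial_value_superset [of "{v}"]) auto

definition psubst :: "('k :: comm_ring_1 \<Rightarrow> 'b :: comm_ring_1) \<Rightarrow> ('v \<Rightarrow> 'b) \<Rightarrow> (('v \<Rightarrow>\<^sub>0 nat) \<Rightarrow>\<^sub>0 'k) \<Rightarrow> 'b" where
  "psubst c y f = (\<Sum>m\<in>Poly_Mapping.keys f. c (Poly_Mapping.lookup f m) * monomial_value y m)"

locale coefficient_hom =
  fixes c :: "'k :: comm_ring_1 \<Rightarrow> 'b :: comm_ring_1"
  assumes c_0 [simp]: "c 0 = 0" and c_1 [simp]: "c 1 = 1"
    and c_add: "c (a + b) = c a + c b" and c_mult: "c (a * b) = c a * c b"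
begin

lemma psubst_single: "psubst c y (Poly_Mapping.single m a) = c a * monomial_value y m"
  by (cases "a = 0") (auto simp: psubst_def)

lemma psubst_coeff [simp]: "psubst c y (coeff_poly a) = c a"
  by (simp add: psubst_single)

lemma psubst_var [simp]: "psubst c y (var_poly v) = y v"
  by (simp add: psubst_single var_poly_def monomial_value_single)

lemma psubst_0 [simp]: "psubst c y 0 = 0"
  by (simp add: psubst_def)

lemma psubst_1 [simp]: "psubst c y 1 = 1"
  using psubst_coeff [of y 1] by simp

lemma psubst_add: "psubst c y (f + g) = psubst c y f + psubst c y g"
  unfolding psubst_def by (rule setsum_keys_plus_distrib) (auto simp: c_add distrib_right)

lemma psubst_mult: "psubst c y (f * g) = psubst c y f * psubst c y g"
proof (induct f rule: poly_mapping_monomial_induct)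
  case (2 f a b)
  have "psubst c y (Poly_Mapping.single a b * g) = psubst c y (Poly_Mapping.single a b) * psubst c y g"
    by (induct g rule: poly_mapping_monomial_induct)
      (simp_all add: distrib_left psubst_add psubst_single mult_single monomial_value_add c_mult ac_simps)
  with 2 show ?case by (simp add: distrib_right psubst_add)
qed simp

lemma psubst_uminus: "psubst c y (- f) = - psubst c y f"
  by (metis add.right_inverse add_eq_0_iff psubst_0 psubst_add)

lemma psubst_diff: "psubst c y (f - g) = psubst c y f - psubst c y g"
  using psubst_add [of y f "- g"] by (simp add: psubst_uminus)

lemma psubst_power: "psubst c y (f ^ n) = psubst c y f ^ n"
  by (induct n) (simp_all add: psubst_mult)

lemma psubst_mvar: "psubst c z (mvar i j) = z (i, j)"
  by (simp add: mvar_var_poly)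

lemma psubst_const_poly: "psubst c z (const_poly a) = c a"
  by (simp add: const_poly_def)

lemmas psubst_hom = psubst_add psubst_mult psubst_uminus psubst_diff psubst_power psubst_mvar psubst_const_poly

end

lemma coefficient_hom_coeff_poly: "coefficient_hom (coeff_poly :: 'k :: comm_ring_1 \<Rightarrow> ('v \<Rightarrow>\<^sub>0 nat) \<Rightarrow>\<^sub>0 'k)"
  by standard (simp_all add: coeff_poly_add coeff_poly_mult)

definition polys_in :: "'v set \<Rightarrow> (('v \<Rightarrow>\<^sub>0 nat) \<Rightarrow>\<^sub>0 'k :: comm_ring_1) set" where
  "polys_in V = {f. \<forall>m\<in>Poly_Mapping.keys f. Poly_Mapping.keys m \<subseteq> V}"

text \<open>
  Subrings and ideals are kept as plain sets in a commutative ring type: the rings in question are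
  compared inside one field of rational functions, and ideals are compared inside \<open>R\<close>.
\<close>

definition subring_set :: "'a :: comm_ring_1 set \<Rightarrow> bool" where
  "subring_set A \<longleftrightarrow> 1 \<in> A \<and> (\<forall>a\<in>A. \<forall>b\<in>A. a - b \<in> A \<and> a * b \<in> A)"

lemma subring_setD:
  assumes "subring_set A"
  shows "1 \<in> A" "0 \<in> A" "a \<in> A \<Longrightarrow> b \<in> A \<Longrightarrow> a - b \<in> A" "a \<in> A \<Longrightarrow> b \<in> A \<Longrightarrow> a * b \<in> A"
    "a \<in> A \<Longrightarrow> - a \<in> A" "a \<in> A \<Longrightarrow> b \<in> A \<Longrightarrow> a + b \<in> A"
proof -
  show 1: "1 \<in> A" and m: "\<And>a b. a \<in> A \<Longrightarrow> b \<in> A \<Longrightarrow> a - b \<in> A"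
    and "a \<in> A \<Longrightarrow> b \<in> A \<Longrightarrow> a * b \<in> A"
    using assms by (auto simp: subring_set_def)
  show 0: "0 \<in> A" using m [OF 1 1] by simp
  show u: "- a \<in> A" if "a \<in> A" for a using m [OF 0 that] by simp
  show "a \<in> A \<Longrightarrow> b \<in> A \<Longrightarrow> a + b \<in> A" using m [of a "- b"] u [of b] by simp
qed

lemma subring_set_power: "subring_set A \<Longrightarrow> a \<in> A \<Longrightarrow> a ^ n \<in> A"
  by (induct n) (auto intro: subring_setD)

lemma subring_set_sum: "subring_set A \<Longrightarrow> (\<And>i. i \<in> S \<Longrightarrow> f i \<in> A) \<Longrightarrow> sum f S \<in> A"
  by (induct S rule: infinite_finite_induct) (auto intro: subring_setD)

lemma subring_set_prod_list: "subring_set A \<Longrightarrow> set xs \<subseteq> A \<Longrightarrow> prod_list xs \<in> A"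
  by (induct xs) (auto intro: subring_setD)

lemma polys_in_subring: "subring_set (polys_in V)"
  unfolding subring_set_def
proof (intro conjI ballI)
  fix f g :: "('a \<Rightarrow>\<^sub>0 nat) \<Rightarrow>\<^sub>0 'b" assume f: "f \<in> polys_in V" and g: "g \<in> polys_in V"
  have "Poly_Mapping.keys (f - g) \<subseteq> Poly_Mapping.keys f \<union> Poly_Mapping.keys g"
    by (auto simp: in_keys_iff lookup_minus)
  with f g show "f - g \<in> polys_in V" by (auto simp: polys_in_def)
  show "f * g \<in> polys_in V"
    unfolding polys_in_def
  proof (intro CollectI ballI)
    fix m assume "m \<in> Poly_Mapping.keys (f * g)"
    then obtain a b where "m = a + b" "a \<in> Poly_Mapping.keys f" "b \<in> Poly_Mapping.keys g"
      using keys_mult [of f g] by auto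
    then show "Poly_Mapping.keys m \<subseteq> V"
      using f g keys_add [of a b] by (fastforce simp: polys_in_def)
  qed
qed (auto simp: polys_in_def)

lemma coeff_in_polys_in [simp]: "coeff_poly a \<in> polys_in V"
  by (auto simp: polys_in_def)

lemma var_in_polys_in [simp]: "v \<in> V \<Longrightarrow> var_poly v \<in> polys_in V"
  by (auto simp: polys_in_def var_poly_def)


section \<open>Ideals\<close>

definition ideal_set :: "'a :: comm_ring_1 set \<Rightarrow> bool" where
  "ideal_set I \<longleftrightarrow> 0 \<in> I \<and> (\<forall>a\<in>I. \<forall>b\<in>I. a + b \<in> I) \<and> (\<forall>a\<in>I. \<forall>r. r * a \<in> I)"

lemma ideal_setD:
  assumes "ideal_set I"
  shows "0 \<in> I" "a \<in> I \<Longrightarrow> b \<in> I \<Longrightarrow> a + b \<in> I" "a \<in> I \<Longrightarrow> r * a \<in> I" "a \<in> I \<Longrightarrow> a * r \<in> I"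
    "a \<in> I \<Longrightarrow> - a \<in> I" "a \<in> I \<Longrightarrow> b \<in> I \<Longrightarrow> a - b \<in> I"
proof -
  show 0: "0 \<in> I" and a: "\<And>a b. a \<in> I \<Longrightarrow> b \<in> I \<Longrightarrow> a + b \<in> I" and m: "\<And>a r. a \<in> I \<Longrightarrow> r * a \<in> I"
    using assms by (auto simp: ideal_set_def)
  show "a \<in> I \<Longrightarrow> a * r \<in> I" using m [of a r] by (simp add: mult.commute)
  show u: "- a \<in> I" if "a \<in> I" for a using m [OF that, of "- 1"] by simp
  show "a \<in> I \<Longrightarrow> b \<in> I \<Longrightarrow> a - b \<in> I" using a [of a "- b"] u [of b] by simp
qed

lemma ideal_set_sum: "ideal_set I \<Longrightarrow> (\<And>i. i \<in> S \<Longrightarrow> f i \<in> I) \<Longrightarrow> sum f S \<in> I"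
  by (induct S rule: infinite_finite_induct) (auto intro: ideal_setD)

lemma ideal_set_cong: "ideal_set I \<Longrightarrow> a - b \<in> I \<Longrightarrow> a \<in> I \<longleftrightarrow> b \<in> I"
  using ideal_setD(6) [of I a "a - b"] ideal_setD(2) [of I "a - b" b] by auto

inductive_set ideal_gen :: "'a :: comm_ring_1 set \<Rightarrow> 'a set" for B where
  zero: "0 \<in> ideal_gen B"
| step: "a \<in> ideal_gen B \<Longrightarrow> b \<in> B \<Longrightarrow> a + r * b \<in> ideal_gen B"

lemma ideal_gen_add: "b \<in> ideal_gen B \<Longrightarrow> a \<in> ideal_gen B \<Longrightarrow> a + b \<in> ideal_gen B"
  by (induct rule: ideal_gen.induct) (auto simp: add.assoc [symmetric] intro: ideal_gen.intros)

lemma ideal_gen_ideal: "ideal_set (ideal_gen B)"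
proof -
  have "r * a \<in> ideal_gen B" if "a \<in> ideal_gen B" for r a
    using that
  proof induct
    case (step a b s)
    then have "r * a + (r * s) * b \<in> ideal_gen B" by (intro ideal_gen.step)
    then show ?case by (simp add: algebra_simps)
  qed (auto intro: ideal_gen.zero)
  then show ?thesis by (auto simp: ideal_set_def intro: ideal_gen.zero ideal_gen_add)
qed

lemma ideal_gen_base: "b \<in> B \<Longrightarrow> b \<in> ideal_gen B"
  using ideal_gen.step [OF ideal_gen.zero, of b B 1] by simp

lemma ideal_gen_least: "ideal_set I \<Longrightarrow> B \<subseteq> I \<Longrightarrow> ideal_gen B \<subseteq> I"
proof
  fix x assume "ideal_set I" "B \<subseteq> I" "x \<in> ideal_gen B"
  from this(3) show "x \<in> I"
    by induct (use \<open>ideal_set I\<close> \<open>B \<subseteq> I\<close> in \<open>auto intro: ideal_setD\<close>)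
qed

lemma ideal_set_radical_add:
  assumes "ideal_set I" "a ^ m \<in> I" "b ^ n \<in> I"
  shows "(a + b) ^ (m + n) \<in> I"
proof -
  have "of_nat (m + n choose k) * a ^ k * b ^ (m + n - k) \<in> I" for k
  proof (cases "m \<le> k")
    case True
    then have "a ^ k = a ^ (k - m) * a ^ m" by (simp add: power_add [symmetric])
    with assms show ?thesis by (metis ideal_setD(3) ideal_setD(4))
  next
    case False
    then have "m + n - k = (m - k) + n" by simp
    then have "b ^ (m + n - k) = b ^ (m - k) * b ^ n" by (simp only: power_add)
    with assms show ?thesis by (metis ideal_setD(3))
  qed
  then show ?thesis unfolding binomial_ring using assms(1) by (auto intro: ideal_set_sum)
qed

lemma ideal_set_radical:
  assumes "ideal_set I"
  shows "ideal_set {a. \<exists>n. a ^ n \<in> I}"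
  unfolding ideal_set_def
proof (intro conjI ballI allI)
  show "0 \<in> {a. \<exists>n. a ^ n \<in> I}" using ideal_setD(1) [OF assms] by (auto intro: exI [of _ 1])
  show "a + b \<in> {a. \<exists>n. a ^ n \<in> I}" if "a \<in> {a. \<exists>n. a ^ n \<in> I}" "b \<in> {a. \<exists>n. a ^ n \<in> I}" for a b
    using that ideal_set_radical_add [OF assms] by blast
  show "r * a \<in> {a. \<exists>n. a ^ n \<in> I}" if "a \<in> {a. \<exists>n. a ^ n \<in> I}" for a r
    using that assms by (auto simp: power_mult_distrib intro: ideal_setD)
qed

lemma ideal_set_quotient: "ideal_set I \<Longrightarrow> ideal_set {a. \<forall>s\<in>S. a * s \<in> I}"
  by (auto simp: ideal_set_def distrib_right mult.assoc)

lemma ideal_set_saturation: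
  assumes "ideal_set I"
  shows "ideal_set {r. \<exists>n. g ^ n * r \<in> I}"
  unfolding ideal_set_def
proof (intro conjI ballI allI)
  show "0 \<in> {r. \<exists>n. g ^ n * r \<in> I}" using assms by (auto intro: ideal_setD)
  show "a + b \<in> {r. \<exists>n. g ^ n * r \<in> I}"
    if ab: "a \<in> {r. \<exists>n. g ^ n * r \<in> I}" "b \<in> {r. \<exists>n. g ^ n * r \<in> I}" for a b
  proof -
    from ab obtain m n where "g ^ m * a \<in> I" "g ^ n * b \<in> I" by blast
    then have "g ^ n * (g ^ m * a) + g ^ m * (g ^ n * b) \<in> I" using assms by (blast intro: ideal_setD(2,3))
    then have "g ^ (m + n) * (a + b) \<in> I" by (simp add: algebra_simps power_add)
    then show ?thesis by blast
  qed
  show "r * a \<in> {r. \<exists>n. g ^ n * r \<in> I}" if "a \<in> {r. \<exists>n. g ^ n * r \<in> I}" for a r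
    using that assms by (auto simp: mult.left_commute [of _ r] intro: ideal_setD)
qed


section \<open>Polynomial ideals are finitely generated\<close>

lemma nat_sequence_mono_subsequence:
  fixes s :: "nat \<Rightarrow> nat"
  obtains r :: "nat \<Rightarrow> nat" where "strict_mono r" "mono (\<lambda>i. s (r i))"
proof -
  obtain f :: "nat \<Rightarrow> nat" where f: "strict_mono f" "monoseq (\<lambda>n. s (f n))"
    using seq_monosub [of s] by blast
  show thesis
  proof (cases "mono (\<lambda>n. s (f n))")
    case True
    with f that show thesis by blast
  next
    case False
    with f(2) have dec: "antimono (\<lambda>n. s (f n))" by (auto simp: monoseq_iff)
    obtain N where N: "\<And>n. s (f N) \<le> s (f n)"
      using ex_has_least_nat [of "\<lambda>_. True" 0 "\<lambda>n. s (f n)"] by auto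
    have "s (f (n + N)) = s (f N)" for n
      using N [of "n + N"] antimonoD [OF dec, of N "n + N"] by simp
    moreover have "strict_mono (\<lambda>n. f (n + N))" using f(1) by (simp add: strict_mono_def)
    ultimately show thesis using that [of "\<lambda>n. f (n + N)"] by (simp add: mono_def)
  qed
qed

lemma sequence_mono_subsequence:
  fixes s :: "nat \<Rightarrow> 'v \<Rightarrow> nat"
  assumes "finite W"
  shows "\<exists>r :: nat \<Rightarrow> nat. strict_mono r \<and> (\<forall>v\<in>W. mono (\<lambda>i. s (r i) v))"
  using assms
proof (induct W)
  case empty
  show ?case by (intro exI [of _ id]) (simp add: strict_mono_def)
next
  case (insert w W)
  then obtain r :: "nat \<Rightarrow> nat" where r: "strict_mono r" "\<And>v. v \<in> W \<Longrightarrow> mono (\<lambda>i. s (r i) v)" by blast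
  obtain q :: "nat \<Rightarrow> nat" where q: "strict_mono q" "mono (\<lambda>i. s (r (q i)) w)"
    by (rule nat_sequence_mono_subsequence [of "\<lambda>i. s (r i) w"])
  have "mono (\<lambda>i. s (r (q i)) v)" if "v \<in> W" for v
    using r(2) [OF that] strict_mono_mono [OF q(1)] by (auto simp: mono_def)
  moreover have "strict_mono (\<lambda>i. r (q i))" using r(1) q(1) by (simp add: strict_mono_def)
  ultimately show ?case using q(2) by (intro exI [of _ "\<lambda>i. r (q i)"]) auto
qed

definition monomial_dvd :: "('v \<Rightarrow>\<^sub>0 nat) \<Rightarrow> ('v \<Rightarrow>\<^sub>0 nat) \<Rightarrow> bool" where
  "monomial_dvd a b \<longleftrightarrow> (\<forall>v. Poly_Mapping.lookup a v \<le> Poly_Mapping.lookup b v)"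

definition minimal_monomials :: "('v \<Rightarrow>\<^sub>0 nat) set \<Rightarrow> ('v \<Rightarrow>\<^sub>0 nat) set" where
  "minimal_monomials L = {m\<in>L. \<forall>a\<in>L. monomial_dvd a m \<longrightarrow> a = m}"

text \<open>
  Dickson's lemma. Infinitely many minimal monomials would contain a sequence along which every
  exponent is weakly increasing, so that an earlier one divides a later one.
\<close>

lemma finite_minimal_monomials: "finite (minimal_monomials L)"
  for L :: "('v :: finite \<Rightarrow>\<^sub>0 nat) set"
proof (rule ccontr)
  assume "infinite (minimal_monomials L)"
  then obtain s :: "nat \<Rightarrow> 'v \<Rightarrow>\<^sub>0 nat" where s: "inj s" "range s \<subseteq> minimal_monomials L"
    using infinite_countable_subset by blast
  have "\<exists>r :: nat \<Rightarrow> nat. strict_mono r \<and> (\<forall>v\<in>UNIV. mono (\<lambda>i. Poly_Mapping.lookup (s (r i)) v))"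
    by (rule sequence_mono_subsequence) simp
  then obtain r :: "nat \<Rightarrow> nat"
    where r: "strict_mono r" and "\<forall>v\<in>UNIV. mono (\<lambda>i. Poly_Mapping.lookup (s (r i)) v)"
    by (elim exE conjE)
  then have r2: "mono (\<lambda>i. Poly_Mapping.lookup (s (r i)) v)" for v by (elim ballE) simp_all
  have "monomial_dvd (s (r 0)) (s (r 1))"
    unfolding monomial_dvd_def using monoD [OF r2, of 0 1] by simp
  moreover have "s (r 0) \<in> minimal_monomials L" "s (r 1) \<in> minimal_monomials L" using s(2) by auto
  ultimately have "s (r 0) = s (r 1)" unfolding minimal_monomials_def by blast
  then have "r 0 = r 1" using s(1) by (simp add: inj_eq)
  moreover have "r 0 < r 1" using r by (simp add: strict_mono_def)
  ultimately show False by simp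
qed

lemma minimal_monomial_dvd:
  fixes L :: "('v :: finite \<Rightarrow>\<^sub>0 nat) set"
  assumes "m \<in> L"
  obtains a where "a \<in> minimal_monomials L" "monomial_dvd a m"
proof -
  let ?d = "\<lambda>a::'v \<Rightarrow>\<^sub>0 nat. \<Sum>v\<in>UNIV. Poly_Mapping.lookup a v"
  obtain a where a: "a \<in> L" "monomial_dvd a m" "\<And>b. b \<in> L \<and> monomial_dvd b m \<Longrightarrow> ?d a \<le> ?d b"
    using ex_has_least_nat [of "\<lambda>a. a \<in> L \<and> monomial_dvd a m" m ?d] assms by (auto simp: monomial_dvd_def)
  have "b = a" if b: "b \<in> L" "monomial_dvd b a" for b
  proof (rule ccontr)
    assume "b \<noteq> a"
    then obtain w where "Poly_Mapping.lookup b w \<noteq> Poly_Mapping.lookup a w" by (meson poly_mapping_eqI)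
    with b(2) have "Poly_Mapping.lookup b w < Poly_Mapping.lookup a w"
      by (meson monomial_dvd_def le_neq_implies_less)
    then have "?d b < ?d a"
      using b(2) by (intro sum_strict_mono_ex1) (auto simp: monomial_dvd_def)
    moreover have "monomial_dvd b m" using b(2) a(2) by (meson monomial_dvd_def order_trans)
    ultimately show False using a(3) b(1) by fastforce
  qed
  with a that show thesis by (auto simp: minimal_monomials_def)
qed

text \<open>
  Numbering the variables arbitrarily turns monomials into finitely supported functions on the
  natural numbers, whose lexicographic order is compatible with addition. It serves as the
  monomial order.
\<close>

definition monomial_code :: "('v :: finite \<Rightarrow>\<^sub>0 nat) \<Rightarrow> (nat \<Rightarrow>\<^sub>0 nat)" where
  "monomial_code m = (\<Sum>v\<in>UNIV. Poly_Mapping.single ((SOME f. inj f) v) (Poly_Mapping.lookup m v))"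

lemma monomial_code_add: "monomial_code (a + b) = monomial_code a + monomial_code b"
  by (simp add: monomial_code_def lookup_add single_add sum.distrib)

lemma monomial_code_inj: "inj (monomial_code :: ('v :: finite \<Rightarrow>\<^sub>0 nat) \<Rightarrow> _)"
proof (rule injI)
  fix a b :: "'v \<Rightarrow>\<^sub>0 nat" assume eq: "monomial_code a = monomial_code b"
  have "\<exists>f :: 'v \<Rightarrow> nat. inj f"
    using finite_imp_inj_to_nat_seg [of "UNIV :: 'v set"] by auto
  then have inj: "inj (SOME f :: 'v \<Rightarrow> nat. inj f)" by (rule someI_ex)
  have "Poly_Mapping.lookup (monomial_code m) ((SOME f. inj f) v) = Poly_Mapping.lookup m v"
    for m :: "'v \<Rightarrow>\<^sub>0 nat" and v
    unfolding monomial_code_def lookup_sum lookup_single when_def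
    by (simp add: inj_eq [OF inj])
  with eq show "a = b" by (metis poly_mapping_eqI)
qed

lemma monomial_code_dvd:
  assumes "monomial_dvd a b"
  shows "monomial_code a \<le> monomial_code b"
proof -
  have pos: "0 \<le> m" for m :: "nat \<Rightarrow>\<^sub>0 nat"
  proof -
    have "\<not> m < 0" by (simp add: less_poly_mapping.rep_eq less_fun_def)
    then show ?thesis by simp
  qed
  have "b = a + (b - a)"
    using assms by (intro poly_mapping_eqI) (simp add: lookup_add lookup_minus monomial_dvd_def)
  then have "monomial_code b = monomial_code a + monomial_code (b - a)"
    using monomial_code_add [of a "b - a"] by (rule ssubst)
  then show ?thesis using add_left_mono [OF pos, of "monomial_code a" "monomial_code (b - a)"] by simp
qed

text \<open>
  The monomial order is a well-order by Dickson's lemma: a least element is found among the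
  finitely many minimal monomials.
\<close>

lemma least_monomial_exists:
  fixes L :: "('v :: finite \<Rightarrow>\<^sub>0 nat) set"
  assumes "L \<noteq> {}"
  obtains m where "m \<in> L" "\<And>a. a \<in> L \<Longrightarrow> monomial_code m \<le> monomial_code a"
proof -
  let ?C = "monomial_code ` minimal_monomials L"
  have "finite ?C" by (simp add: finite_minimal_monomials)
  moreover from assms obtain a where "a \<in> L" by blast
  then obtain b where "b \<in> minimal_monomials L" by (rule minimal_monomial_dvd)
  then have "?C \<noteq> {}" by blast
  ultimately have "Min ?C \<in> ?C" and le: "\<And>c. c \<in> ?C \<Longrightarrow> Min ?C \<le> c" by simp_all
  then obtain m where m: "m \<in> minimal_monomials L" "Min ?C = monomial_code m" by auto
  have "monomial_code m \<le> monomial_code a" if a: "a \<in> L" for a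
  proof -
    obtain b where "b \<in> minimal_monomials L" "monomial_dvd b a"
      using minimal_monomial_dvd [OF a] by blast
    with le [of "monomial_code b"] m(2) monomial_code_dvd [of b a] show ?thesis by simp
  qed
  with m(1) that show thesis by (auto simp: minimal_monomials_def)
qed

definition leading_monomial :: "(('v :: finite \<Rightarrow>\<^sub>0 nat) \<Rightarrow>\<^sub>0 'k :: zero) \<Rightarrow> ('v \<Rightarrow>\<^sub>0 nat) \<Rightarrow> bool" where
  "leading_monomial f m \<longleftrightarrow> m \<in> Poly_Mapping.keys f \<and>
     (\<forall>a\<in>Poly_Mapping.keys f. monomial_code a \<le> monomial_code m)"

lemma leading_monomial_exists:
  assumes "f \<noteq> 0"
  obtains m where "leading_monomial f m"
proof -
  let ?C = "monomial_code ` Poly_Mapping.keys f"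
  have "?C \<noteq> {}" using assms by (auto simp: poly_mapping_eq_iff in_keys_iff fun_eq_iff)
  then have "Max ?C \<in> ?C" by (intro Max_in) auto
  then obtain m where "m \<in> Poly_Mapping.keys f" "Max ?C = monomial_code m" by auto
  moreover have "monomial_code a \<le> Max ?C" if "a \<in> Poly_Mapping.keys f" for a using that by simp
  ultimately show thesis using that by (auto simp: leading_monomial_def)
qed

lemma lookup_single_mult:
  "Poly_Mapping.lookup (Poly_Mapping.single d c * f) (d + m) = c * Poly_Mapping.lookup f m"
  for f :: "('v \<Rightarrow>\<^sub>0 nat) \<Rightarrow>\<^sub>0 'k :: comm_ring_1"
  by (induct f rule: poly_mapping_monomial_induct)
    (simp_all add: distrib_left lookup_add mult_single lookup_single when_def)

lemma keys_single_mult: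
  "Poly_Mapping.keys (Poly_Mapping.single d c * f) \<subseteq> (+) d ` Poly_Mapping.keys f"
  for f :: "('v \<Rightarrow>\<^sub>0 nat) \<Rightarrow>\<^sub>0 'k :: comm_ring_1"
  using keys_mult [of "Poly_Mapping.single d c" f] by (auto split: if_splits)

text \<open>
  Hilbert's basis theorem by Groebner bases. Take one element of the ideal for each minimal
  leading monomial. An element outside the ideal generated by them, with least leading monomial,
  could still be reduced.
\<close>

theorem polynomial_ideal_finitely_generated:
  fixes T :: "(('v :: finite \<Rightarrow>\<^sub>0 nat) \<Rightarrow>\<^sub>0 'k :: field) set"
  assumes T: "ideal_set T"
  obtains B where "finite B" "B \<subseteq> T" "T = ideal_gen B"
proof -
  define L where "L = {m. \<exists>f\<in>T. leading_monomial f m}"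
  have "\<exists>f\<in>T. leading_monomial f m" if "m \<in> minimal_monomials L" for m
    using that by (auto simp: minimal_monomials_def L_def)
  then obtain lift where lift: "\<And>m. m \<in> minimal_monomials L \<Longrightarrow> lift m \<in> T \<and> leading_monomial (lift m) m"
    by metis
  define B where "B = lift ` minimal_monomials L"
  have fin: "finite B" by (simp add: B_def finite_minimal_monomials)
  have sub: "B \<subseteq> T" using lift by (auto simp: B_def)
  have "T \<subseteq> ideal_gen B"
  proof (rule ccontr)
    define N where "N = {m. \<exists>f\<in>T - ideal_gen B. leading_monomial f m}"
    assume "\<not> T \<subseteq> ideal_gen B"
    then obtain f where f: "f \<in> T - ideal_gen B" by blast
    then have "f \<noteq> 0" using ideal_gen.zero by auto
    then obtain m where "leading_monomial f m" by (rule leading_monomial_exists)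
    with f have "N \<noteq> {}" by (auto simp: N_def)
    then obtain m where "m \<in> N" and least: "\<And>a. a \<in> N \<Longrightarrow> monomial_code m \<le> monomial_code a"
      using least_monomial_exists by blast
    then obtain f where f: "f \<in> T" "f \<notin> ideal_gen B" "leading_monomial f m" by (auto simp: N_def)
    then have "m \<in> L" by (auto simp: L_def)
    then obtain b where b: "b \<in> minimal_monomials L" "monomial_dvd b m" by (rule minimal_monomial_dvd)
    define g where "g = lift b"
    have g: "g \<in> B" "g \<in> T" "leading_monomial g b" using b(1) lift by (auto simp: g_def B_def)
    define d where "d = m - b"
    have m: "m = d + b"
      using b(2) by (intro poly_mapping_eqI) (simp add: d_def lookup_add lookup_minus monomial_dvd_def)
    have gb: "Poly_Mapping.lookup g b \<noteq> 0" using g(3) by (auto simp: leading_monomial_def in_keys_iff)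
    define h where "h = f - Poly_Mapping.single d (Poly_Mapping.lookup f m / Poly_Mapping.lookup g b) * g"
    have hm: "Poly_Mapping.lookup h m = 0"
      using gb by (simp add: h_def lookup_minus lookup_single_mult m)
    have "Poly_Mapping.single d (Poly_Mapping.lookup f m / Poly_Mapping.lookup g b) * g \<in> ideal_gen B"
      using ideal_gen_ideal ideal_gen_base [OF g(1)] by (rule ideal_setD(3))
    then have hB: "h \<notin> ideal_gen B"
      using f(2) ideal_setD(2) [OF ideal_gen_ideal, of h B] by (fastforce simp: h_def)
    moreover have hT: "h \<in> T" unfolding h_def using T f(1) g(2) by (intro ideal_setD)
    ultimately have "h \<noteq> 0" using ideal_gen.zero by auto
    then obtain a where a: "leading_monomial h a" by (rule leading_monomial_exists)
    then have "a \<in> N" using hB hT by (auto simp: N_def)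
    then have "monomial_code m \<le> monomial_code a" by (rule least)
    moreover have "monomial_code a \<le> monomial_code m"
    proof -
      let ?s = "Poly_Mapping.single d (Poly_Mapping.lookup f m / Poly_Mapping.lookup g b) * g"
      have "Poly_Mapping.lookup f a - Poly_Mapping.lookup ?s a \<noteq> 0"
        using a by (simp add: leading_monomial_def in_keys_iff h_def lookup_minus)
      then have "a \<in> Poly_Mapping.keys f \<or> a \<in> Poly_Mapping.keys ?s"
        unfolding in_keys_iff by (cases "Poly_Mapping.lookup f a = 0") simp_all
      then have "a \<in> Poly_Mapping.keys f \<or> a \<in> (+) d ` Poly_Mapping.keys g"
        using keys_single_mult [of d _ g] by (meson subsetD)
      then show ?thesis
      proof
        assume "a \<in> Poly_Mapping.keys f"
        with f(3) show ?thesis by (simp add: leading_monomial_def)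
      next
        assume "a \<in> (+) d ` Poly_Mapping.keys g"
        with g(3) show ?thesis
          by (auto simp: leading_monomial_def m monomial_code_add intro: add_left_mono)
      qed
    qed
    ultimately have "monomial_code a = monomial_code m" by simp
    then have "a = m" by (rule injD [OF monomial_code_inj])
    with a hm show False by (simp add: leading_monomial_def in_keys_iff)
  qed
  moreover have "ideal_gen B \<subseteq> T" using T sub by (rule ideal_gen_least)
  ultimately show thesis using that fin sub by blast
qed


section \<open>Poisson \<open>H\<close>-primes as ideals of the polynomial ring\<close>

text \<open>
  \<open>poisson_stable\<close> describes the preimages in \<open>R\<close> of the torus stable Poisson ideals of the quotient
  by \<open>Det - 1\<close>, and \<open>hprime\<close> those of the Poisson \<open>H\<close>-primes.
\<close>

definition poisson_stable :: "'k :: field mat3_poly set \<Rightarrow> bool" where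
  "poisson_stable J \<longleftrightarrow> ideal_set J \<and> Det - 1 \<in> J \<and> (\<forall>a\<in>J. \<forall>b. M3_bracket a b \<in> J) \<and>
     (\<forall>h\<in>torus. \<forall>a\<in>J. torus_act h a \<in> J)"

definition hprime :: "'k :: field mat3_poly set \<Rightarrow> bool" where
  "hprime I \<longleftrightarrow> poisson_stable I \<and> 1 \<notin> I \<and>
     (\<forall>J K. poisson_stable J \<longrightarrow> poisson_stable K \<longrightarrow> (\<forall>a\<in>J. \<forall>b\<in>K. a * b \<in> I) \<longrightarrow> J \<subseteq> I \<or> K \<subseteq> I)"

lemma poisson_stableD:
  assumes "poisson_stable J"
  shows "ideal_set J" "Det - 1 \<in> J" "a \<in> J \<Longrightarrow> M3_bracket a b \<in> J" "a \<in> J \<Longrightarrow> M3_bracket b a \<in> J"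
    "h \<in> torus \<Longrightarrow> a \<in> J \<Longrightarrow> torus_act h a \<in> J"
proof -
  show i: "ideal_set J" and "Det - 1 \<in> J" and b: "\<And>a b. a \<in> J \<Longrightarrow> M3_bracket a b \<in> J"
    and "h \<in> torus \<Longrightarrow> a \<in> J \<Longrightarrow> torus_act h a \<in> J"
    using assms by (auto simp: poisson_stable_def)
  show "a \<in> J \<Longrightarrow> M3_bracket b a \<in> J"
    using b [of a b] ideal_setD(5) [OF i] M3_bracket_antisym [of b a] by simp
qed

lemma hprimeD:
  assumes "hprime I"
  shows "poisson_stable I" "ideal_set I" "1 \<notin> I"
    "poisson_stable J \<Longrightarrow> poisson_stable K \<Longrightarrow> (\<And>a b. a \<in> J \<Longrightarrow> b \<in> K \<Longrightarrow> a * b \<in> I) \<Longrightarrow> J \<subseteq> I \<or> K \<subseteq> I"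
  using assms by (auto simp: hprime_def poisson_stable_def)

lemma const_poly_mult: "const_poly (a * b) = const_poly a * const_poly b"
  by (simp add: const_poly_def mult_single)

lemma const_poly_1 [simp]: "const_poly 1 = 1"
  by (simp add: const_poly_def)

lemma const_poly_cancel:
  fixes I :: "'k :: field mat3_poly set"
  assumes "ideal_set I" "c \<noteq> 0" "const_poly c * a \<in> I"
  shows "a \<in> I"
proof -
  have "const_poly (1 / c) * (const_poly c * a) \<in> I" using assms(1,3) by (rule ideal_setD(3))
  then show ?thesis using assms(2) by (simp add: mult.assoc [symmetric] const_poly_mult [symmetric])
qed

lemma of_nat_cancel:
  fixes I :: "'k :: field_char_0 mat3_poly set"
  assumes "ideal_set I" "n \<noteq> 0" "of_nat n * a \<in> I"
  shows "a \<in> I"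
  using const_poly_cancel [OF assms(1), of "of_nat n" a] assms(2,3) by (simp add: const_poly_def)

lemma torus_inverse:
  assumes "h \<in> torus"
  obtains h' where "h' \<in> torus" "\<And>f. torus_act h (torus_act h' f) = f"
proof -
  define h' where "h' = ((\<lambda>i. 1 / fst h i), (\<lambda>j. 1 / snd h j))"
  have nz: "fst h i \<noteq> 0" "snd h i \<noteq> 0" for i using assms by (auto simp: torus_def)
  have "(\<Prod>i\<in>UNIV. fst h i) * (\<Prod>j\<in>UNIV. snd h j) = 1" using assms by (auto simp: torus_def)
  moreover have "(\<Prod>i\<in>UNIV. 1 / fst h i) * (\<Prod>j\<in>UNIV. 1 / snd h j) =
      1 / ((\<Prod>i\<in>UNIV. fst h i) * (\<Prod>j\<in>UNIV. snd h j))"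
    by (simp add: prod_dividef)
  ultimately have "h' \<in> torus" using nz by (simp add: torus_def h'_def)
  moreover have "torus_act h (torus_act h' f) = f" for f
  proof (induct f rule: mat3_poly_induct)
    case (var i j)
    have "const_poly (fst h' i * snd h' j) * const_poly (fst h i * snd h j) = const_poly 1"
      unfolding const_poly_mult [symmetric] using nz by (simp add: h'_def)
    then show ?case
      by (simp add: torus_act_mvar torus_act_mult torus_act_const mult.assoc [symmetric])
  qed (simp_all add: torus_act_const torus_act_add torus_act_mult)
  ultimately show thesis using that by blast
qed

lemma torus_act_power: "torus_act h (f ^ n) = torus_act h f ^ n"
  by (induct n) (simp_all add: torus_act_mult torus_act_one)

lemma M3_bracket_power: "M3_bracket (r ^ n) x = of_nat n * r ^ (n - 1) * M3_bracket r x"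
proof (induct n)
  case 0
  show ?case using M3_bracket_const_left [of 1] by simp
next
  case (Suc n)
  then show ?case by (cases n) (simp_all add: M3_bracket_mult_left algebra_simps)
qed

lemma poisson_stable_annihilator:
  assumes I: "poisson_stable I" and T: "poisson_stable T"
  shows "poisson_stable {s. \<forall>t\<in>T. s * t \<in> I}"
  unfolding poisson_stable_def
proof (intro conjI ballI allI)
  note I' = poisson_stableD [OF I] and T' = poisson_stableD [OF T]
  show "ideal_set {s. \<forall>t\<in>T. s * t \<in> I}" by (rule ideal_set_quotient [OF I'(1)])
  show "Det - 1 \<in> {s. \<forall>t\<in>T. s * t \<in> I}" using I'(1,2) by (auto intro: ideal_setD)
  fix s assume s: "s \<in> {s. \<forall>t\<in>T. s * t \<in> I}"
  show "M3_bracket s x \<in> {s. \<forall>t\<in>T. s * t \<in> I}" for x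
  proof (intro CollectI ballI)
    fix t assume t: "t \<in> T"
    have "M3_bracket (s * t) x - s * M3_bracket t x \<in> I"
      using s t T'(3) I'(3) by (intro ideal_setD(6) [OF I'(1)]) auto
    then show "M3_bracket s x * t \<in> I" by (simp add: M3_bracket_mult_left)
  qed
  show "torus_act h s \<in> {s. \<forall>t\<in>T. s * t \<in> I}" if h: "h \<in> torus" for h
  proof (intro CollectI ballI)
    fix t assume t: "t \<in> T"
    obtain h' where h': "h' \<in> torus" "\<And>f. torus_act h (torus_act h' f) = f" using torus_inverse [OF h] by blast
    have "s * torus_act h' t \<in> I" using s T'(5) [OF h'(1) t] by blast
    then have "torus_act h (s * torus_act h' t) \<in> I" using I'(5) h by blast
    then show "torus_act h s * t \<in> I" by (simp add: torus_act_mult h'(2))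
  qed
qed

text \<open>
  Bracketing \<open>r ^ Suc j * d ^ m\<close>, where \<open>d\<close> is the bracket of \<open>r\<close> with \<open>x\<close>, trades one factor \<open>r\<close> for
  factors \<open>d\<close> at the price of an integer coefficient, which is invertible in characteristic zero.
\<close>

lemma nilpotent_bracket:
  fixes I :: "'k :: field_char_0 mat3_poly set"
  assumes I: "poisson_stable I" and r: "r ^ n \<in> I"
  shows "\<exists>m. M3_bracket r x ^ m \<in> I"
proof -
  note I' = poisson_stableD [OF I]
  define d where "d = M3_bracket r x"
  have "\<exists>m. r ^ (n - k) * d ^ m \<in> I" if "k \<le> n" for k
    using that
  proof (induct k)
    case 0
    show ?case using r by (auto intro: exI [of _ 0])
  next
    case (Suc k)
    then obtain m where m: "r ^ (n - k) * d ^ m \<in> I" by auto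
    define j where "j = n - Suc k"
    have j: "n - k = Suc j" using Suc.prems by (simp add: j_def)
    have 1: "M3_bracket (r ^ Suc j * d ^ m) x * d \<in> I" using m I' unfolding j by (intro ideal_setD(4)) auto
    have 2: "r ^ Suc j * M3_bracket (d ^ m) x * d \<in> I"
    proof (cases m)
      case 0
      then show ?thesis using I'(1) M3_bracket_const_left [of 1 x] by (simp add: ideal_setD(1))
    next
      case (Suc l)
      have "(r ^ Suc j * d ^ m) * (of_nat m * M3_bracket d x) \<in> I" by (rule ideal_setD(4) [OF I'(1) m [unfolded j]])
      moreover have "(r ^ Suc j * d ^ m) * (of_nat m * M3_bracket d x) = r ^ Suc j * M3_bracket (d ^ m) x * d"
        unfolding M3_bracket_power Suc by (simp add: algebra_simps)
      ultimately show ?thesis by simp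
    qed
    have "M3_bracket (r ^ Suc j * d ^ m) x * d - r ^ Suc j * M3_bracket (d ^ m) x * d
      = of_nat (Suc j) * (r ^ j * d ^ (m + 2))"
      unfolding M3_bracket_mult_left M3_bracket_power [of r] d_def [symmetric]
      by (simp add: algebra_simps power2_eq_square)
    then have "of_nat (Suc j) * (r ^ j * d ^ (m + 2)) \<in> I" using ideal_setD(6) [OF I'(1) 1 2] by simp
    then have "r ^ j * d ^ (m + 2) \<in> I" by (rule of_nat_cancel [OF I'(1), rotated]) simp
    then show ?case unfolding j_def by blast
  qed
  from this [of n] show ?thesis by (simp add: d_def)
qed

text \<open>
  The radical \<open>T\<close> of \<open>I\<close> is stable, and so is its annihilator modulo \<open>I\<close>; one of the two must lie in \<open>I\<close>.
  As \<open>T\<close> is finitely generated, some \<open>z\<close> outside \<open>I\<close> annihilates it.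
\<close>

lemma hprime_radical:
  fixes I :: "'k :: field_char_0 mat3_poly set"
  assumes I: "hprime I" and r: "r ^ n \<in> I"
  shows "r \<in> I"
proof -
  note I' = hprimeD [OF I] and J = poisson_stableD [OF hprimeD(1) [OF I]]
  define T where "T = {a. \<exists>n. a ^ n \<in> I}"
  have Ti: "ideal_set T" unfolding T_def by (rule ideal_set_radical [OF J(1)])
  have IT: "I \<subseteq> T" unfolding T_def by (auto intro: exI [of _ 1])
  have T: "poisson_stable T"
    unfolding poisson_stable_def
  proof (intro conjI ballI allI)
    show "Det - 1 \<in> T" using IT J(2) by blast
    show "M3_bracket a b \<in> T" if "a \<in> T" for a b using that nilpotent_bracket [OF I'(1)] by (auto simp: T_def)
    fix h :: "(3 \<Rightarrow> 'k) \<times> (3 \<Rightarrow> 'k)" and a assume "h \<in> torus" "a \<in> T"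
    then obtain n where "a ^ n \<in> I" by (auto simp: T_def)
    then have "torus_act h (a ^ n) \<in> I" by (rule J(5) [OF \<open>h \<in> torus\<close>])
    then show "torus_act h a \<in> T" by (auto simp: T_def torus_act_power)
  qed (rule Ti)
  obtain B where B: "finite B" "B \<subseteq> T" "T = ideal_gen B"
    using polynomial_ideal_finitely_generated [OF Ti] by blast
  \<comment> \<open>One generator at a time, multiply \<open>z\<close> by the largest power of the generator that stays outside \<open>I\<close>.\<close>
  have "\<exists>z. z \<notin> I \<and> (\<forall>b\<in>B. z * b \<in> I)"
    using B(1,2)
  proof induct
    case empty
    show ?case using I'(3) by blast
  next
    case (insert b B)
    then obtain z where z: "z \<notin> I" "\<And>b. b \<in> B \<Longrightarrow> z * b \<in> I" by blast
    obtain n where "b ^ n \<in> I" using insert by (auto simp: T_def)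
    then have ex: "z * b ^ n \<in> I" using J(1) by (intro ideal_setD(3))
    define m where "m = (LEAST n. z * b ^ n \<in> I)"
    have m: "z * b ^ m \<in> I" unfolding m_def using ex by (rule LeastI)
    have "m \<noteq> 0" using m z(1) by (auto intro: ccontr)
    then obtain l where l: "m = Suc l" by (cases m) auto
    have "z * b ^ l \<notin> I" using not_less_Least [of l "\<lambda>n. z * b ^ n \<in> I"] l unfolding m_def by simp
    moreover have "z * b ^ l * b \<in> I" using m l by (simp add: ac_simps)
    moreover have "z * b ^ l * c \<in> I" if "c \<in> B" for c
      using ideal_setD(4) [OF J(1) z(2) [OF that], of "b ^ l"] by (simp add: ac_simps)
    ultimately show ?case by (intro exI [of _ "z * b ^ l"]) auto
  qed
  then obtain z where z: "z \<notin> I" "\<forall>b\<in>B. z * b \<in> I" by blast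
  have "ideal_set {t. t * z \<in> I}" using ideal_set_quotient [OF J(1), of "{z}"] by simp
  then have "T \<subseteq> {t. t * z \<in> I}"
    unfolding B(3) using z(2) by (intro ideal_gen_least) (auto simp: mult.commute)
  then have "z \<in> {s. \<forall>t\<in>T. s * t \<in> I}" by (auto simp: mult.commute)
  moreover have "T \<subseteq> I \<or> {s. \<forall>t\<in>T. s * t \<in> I} \<subseteq> I"
    by (rule I'(4) [OF T poisson_stable_annihilator [OF I'(1) T]]) (auto simp: mult.commute)
  ultimately have "T \<subseteq> I" using z(1) by blast
  with r show ?thesis by (auto simp: T_def)
qed

definition weight :: "((3 \<Rightarrow> 'k :: field) \<times> (3 \<Rightarrow> 'k) \<Rightarrow> 'k) \<Rightarrow> 'k mat3_poly \<Rightarrow> bool" where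
  "weight w g \<longleftrightarrow> (\<forall>h\<in>torus. w h \<noteq> 0 \<and> torus_act h g = const_poly (w h) * g)"

lemma weight_mvar: "weight (\<lambda>h. fst h i * snd h j) (mvar i j)"
  by (auto simp: weight_def torus_def torus_act_mvar)

lemma weight_mult: "weight v f \<Longrightarrow> weight w g \<Longrightarrow> weight (\<lambda>h. v h * w h) (f * g)"
  by (simp add: weight_def torus_act_mult const_poly_mult ac_simps)

lemma weight_power: "weight v f \<Longrightarrow> weight (\<lambda>h. v h ^ n) (f ^ n)"
proof (induct n)
  case 0
  show ?case by (simp add: weight_def torus_act_one)
next
  case (Suc n)
  then show ?case using weight_mult by fastforce
qed

text \<open>
  The elements killed modulo \<open>I\<close> by some power of \<open>g\<close> form a stable ideal \<open>T\<close>: brackets are handled by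
  one further factor \<open>g\<close>, the torus by \<open>g\<close> being a weight vector. Since \<open>T\<close> is finitely generated, one
  power \<open>g ^ N\<close> kills it. The annihilator of \<open>T\<close> is stable as well and contains \<open>g ^ N\<close>, which is not in
  \<open>I\<close> because \<open>I\<close> is a radical ideal; so \<open>T\<close> lies in \<open>I\<close>.
\<close>

lemma hprime_regular:
  fixes I :: "'k :: field_char_0 mat3_poly set"
  assumes I: "hprime I" and g: "weight w g" "g \<notin> I" and r: "g * r \<in> I"
  shows "r \<in> I"
proof -
  note I' = hprimeD [OF I] and J = poisson_stableD [OF hprimeD(1) [OF I]]
  define T where "T = {r. \<exists>n. g ^ n * r \<in> I}"
  have Ti: "ideal_set T" unfolding T_def by (rule ideal_set_saturation [OF J(1)])
  have IT: "I \<subseteq> T" unfolding T_def by (auto intro: exI [of _ 0])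
  have br: "M3_bracket a x \<in> T" if a: "a \<in> T" for a x
  proof -
    obtain n where n: "g ^ n * a \<in> I" using a by (auto simp: T_def)
    have "g * M3_bracket (g ^ n * a) x - of_nat n * M3_bracket g x * (g ^ n * a) \<in> I"
      by (rule ideal_setD(6) [OF J(1) ideal_setD(3) [OF J(1) J(3) [OF n]] ideal_setD(3) [OF J(1) n]])
    moreover have "g * M3_bracket (g ^ n * a) x - of_nat n * M3_bracket g x * (g ^ n * a)
        = g ^ Suc n * M3_bracket a x"
      unfolding M3_bracket_mult_left M3_bracket_power by (cases n) (simp_all add: algebra_simps)
    ultimately have "g ^ Suc n * M3_bracket a x \<in> I" by simp
    then show ?thesis unfolding T_def by blast
  qed
  have st: "torus_act h a \<in> T" if h: "h \<in> torus" and "a \<in> T" for h a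
  proof -
    obtain n where n: "g ^ n * a \<in> I" using \<open>a \<in> T\<close> by (auto simp: T_def)
    have w: "w h ^ n \<noteq> 0" "torus_act h (g ^ n) = const_poly (w h ^ n) * g ^ n"
      using weight_power [OF g(1), of n] h unfolding weight_def by blast+
    have "torus_act h (g ^ n * a) \<in> I" by (rule J(5) [OF h n])
    then have "const_poly (w h ^ n) * (g ^ n * torus_act h a) \<in> I"
      unfolding torus_act_mult w(2) mult.assoc .
    then have "g ^ n * torus_act h a \<in> I" by (rule const_poly_cancel [OF J(1) w(1)])
    then show ?thesis unfolding T_def by blast
  qed
  have T: "poisson_stable T" unfolding poisson_stable_def using Ti IT J(2) br st by blast
  obtain B where B: "finite B" "B \<subseteq> T" "T = ideal_gen B"
    using polynomial_ideal_finitely_generated [OF Ti] by blast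
  have "\<exists>N. \<forall>b\<in>B. g ^ N * b \<in> I"
    using B(1,2)
  proof induct
    case (insert b B)
    then obtain N where N: "\<And>c. c \<in> B \<Longrightarrow> g ^ N * c \<in> I" by blast
    obtain n where n: "g ^ n * b \<in> I" using insert by (auto simp: T_def)
    have eq: "g ^ (N + n) * c = g ^ n * (g ^ N * c)" "g ^ (N + n) * c = g ^ N * (g ^ n * c)" for c
      by (simp_all add: power_add ac_simps)
    have "g ^ (N + n) * b \<in> I" unfolding eq(2) by (rule ideal_setD(3) [OF J(1) n])
    moreover have "g ^ (N + n) * c \<in> I" if "c \<in> B" for c
      unfolding eq(1) by (rule ideal_setD(3) [OF J(1) N [OF that]])
    ultimately show ?case by blast
  qed simp
  then obtain N where N: "\<forall>b\<in>B. g ^ N * b \<in> I" by blast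
  have "ideal_set {t. t * g ^ N \<in> I}" using ideal_set_quotient [OF J(1), of "{g ^ N}"] by simp
  then have "T \<subseteq> {t. t * g ^ N \<in> I}"
    unfolding B(3) using N by (intro ideal_gen_least) (auto simp: mult.commute)
  then have "g ^ N \<in> {s. \<forall>t\<in>T. s * t \<in> I}" by (auto simp: mult.commute)
  moreover have "g ^ N \<notin> I" using hprime_radical [OF I] g(2) by blast
  moreover have "T \<subseteq> I \<or> {s. \<forall>t\<in>T. s * t \<in> I} \<subseteq> I"
    by (rule I'(4) [OF T poisson_stable_annihilator [OF I'(1) T]]) (auto simp: mult.commute)
  ultimately have "T \<subseteq> I" by blast
  moreover have "r \<in> T" using r unfolding T_def by (intro CollectI exI [of _ 1]) simp
  ultimately show ?thesis by blast
qed

lemma hprime_regular_power: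
  fixes I :: "'k :: field_char_0 mat3_poly set"
  assumes "hprime I" "weight w g" "g \<notin> I" "g ^ n * r \<in> I"
  shows "r \<in> I"
  using assms(4)
proof (induct n)
  case (Suc n)
  then have "g * (g ^ n * r) \<in> I" by (simp add: mult.assoc)
  then show ?case using hprime_regular [OF assms(1-3)] Suc by blast
qed simp


section \<open>Symmetries\<close>

lemma coefficient_hom_const_poly: "coefficient_hom (const_poly :: 'k :: comm_ring_1 \<Rightarrow> _)"
  using coefficient_hom_coeff_poly by (simp add: const_poly_def [abs_def])

interpretation const: coefficient_hom const_poly
  by (rule coefficient_hom_const_poly)

text \<open>
  Two symmetries of \<open>SL\<^sub>3\<close>, the transpose and a variant of the inverse, preserve all the structure.
  They are given by endomorphisms of \<open>R\<close> whose squares need only be the identity modulo \<open>Det - 1\<close>.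
\<close>

locale poisson_involution =
  fixes t :: "3 \<times> 3 \<Rightarrow> 'k :: field_char_0 mat3_poly"
  assumes t_bracket: "M3_bracket (t (i, j)) (t (l, m)) = (order_sign i l + order_sign j m) * t (i, m) * t (l, j)"
    and t_involution: "\<exists>r. psubst const_poly t (t (i, j)) - mvar i j = r * (Det - 1)"
    and t_Det: "\<exists>r. psubst const_poly t Det - 1 = r * (Det - 1)"
    and t_torus: "h \<in> torus \<Longrightarrow> \<exists>h'\<in>torus. \<forall>i j. torus_act h' (t (i, j)) = const_poly (fst h i * snd h j) * t (i, j)"
begin

abbreviation \<theta> where "\<theta> \<equiv> psubst const_poly t"

lemma theta_order_sign: "\<theta> (order_sign a b) = order_sign a b"
  by (simp add: order_sign_def const.psubst_uminus)

lemma theta_bracket: "M3_bracket (\<theta> f) (\<theta> g) = \<theta> (M3_bracket f g)"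
proof (induct f rule: mat3_poly_induct)
  case (var i j)
  show ?case
  proof (induct g rule: mat3_poly_induct)
    case (var l m)
    show ?case
      by (simp add: const.psubst_hom t_bracket M3_bracket_mvar distrib_right mult.assoc theta_order_sign)
  qed (simp_all add: const.psubst_hom M3_bracket_const_right M3_bracket_add_right M3_bracket_mult_right)
qed (simp_all add: const.psubst_hom M3_bracket_const_left M3_bracket_add_left M3_bracket_mult_left)

lemma theta_theta: "\<exists>r. \<theta> (\<theta> f) - f = r * (Det - 1)"
proof (induct f rule: mat3_poly_induct)
  case (const c)
  show ?case by (auto simp: const.psubst_hom intro: exI [of _ 0])
next
  case (var i j)
  show ?case using t_involution by (simp add: const.psubst_hom)
next
  case (add f g)
  then obtain r s where rs: "\<theta> (\<theta> f) - f = r * (Det - 1)" "\<theta> (\<theta> g) - g = s * (Det - 1)" by blast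
  have "\<theta> (\<theta> (f + g)) - (f + g) = (\<theta> (\<theta> f) - f) + (\<theta> (\<theta> g) - g)"
    by (simp add: const.psubst_add)
  also have "\<dots> = (r + s) * (Det - 1)" unfolding rs by (simp add: algebra_simps)
  finally show ?case ..
next
  case (mult f g)
  then obtain r s where rs: "\<theta> (\<theta> f) - f = r * (Det - 1)" "\<theta> (\<theta> g) - g = s * (Det - 1)" by blast
  have "\<theta> (\<theta> (f * g)) - f * g = (\<theta> (\<theta> f) - f) * \<theta> (\<theta> g) + f * (\<theta> (\<theta> g) - g)"
    by (simp add: const.psubst_mult algebra_simps)
  also have "\<dots> = (r * \<theta> (\<theta> g) + f * s) * (Det - 1)" unfolding rs by (simp add: algebra_simps)
  finally show ?case ..
qed

lemma theta_torus: "h \<in> torus \<Longrightarrow> \<exists>h'\<in>torus. \<forall>f. torus_act h' (\<theta> f) = \<theta> (torus_act h f)"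
proof -
  assume "h \<in> torus"
  then obtain h' where h': "h' \<in> torus"
    "\<And>i j. torus_act h' (t (i, j)) = const_poly (fst h i * snd h j) * t (i, j)" using t_torus by blast
  have "torus_act h' (\<theta> f) = \<theta> (torus_act h f)" for f
    by (induct f rule: mat3_poly_induct)
      (simp_all add: const.psubst_hom torus_act_const torus_act_add torus_act_mult torus_act_mvar h'(2))
  with h'(1) show ?thesis by blast
qed

lemma theta_theta_iff:
  assumes "poisson_stable J"
  shows "\<theta> (\<theta> f) \<in> J \<longleftrightarrow> f \<in> J"
proof -
  obtain r where "\<theta> (\<theta> f) - f = r * (Det - 1)" using theta_theta by blast
  then have "\<theta> (\<theta> f) - f \<in> J" using poisson_stableD(1,2) [OF assms] by (simp add: ideal_setD(3))
  then show ?thesis by (rule ideal_set_cong [OF poisson_stableD(1) [OF assms]])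
qed

lemma poisson_stable_vimage:
  assumes J: "poisson_stable J"
  shows "poisson_stable {f. \<theta> f \<in> J}"
  unfolding poisson_stable_def
proof (intro conjI ballI allI)
  note J' = poisson_stableD [OF J]
  show "ideal_set {f. \<theta> f \<in> J}"
    using ideal_setD(1-3) [OF J'(1)] by (simp add: ideal_set_def const.psubst_hom)
  obtain r where "\<theta> Det - 1 = r * (Det - 1)" using t_Det by blast
  then show "Det - 1 \<in> {f. \<theta> f \<in> J}"
    using ideal_setD(3) [OF J'(1,2)] by (simp add: const.psubst_hom)
  fix a assume a: "a \<in> {f. \<theta> f \<in> J}"
  show "M3_bracket a b \<in> {f. \<theta> f \<in> J}" for b
    using J'(3) [of "\<theta> a" "\<theta> b"] a by (simp add: theta_bracket)
  show "torus_act h a \<in> {f. \<theta> f \<in> J}" if h: "h \<in> torus" for h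
  proof -
    obtain h' where h': "h' \<in> torus" "\<And>f. torus_act h' (\<theta> f) = \<theta> (torus_act h f)" using theta_torus [OF h] by blast
    have "torus_act h' (\<theta> a) \<in> J" using a by (intro J'(5) h'(1)) simp
    then show ?thesis by (simp add: h'(2))
  qed
qed

lemma hprime_vimage:
  assumes I: "hprime I"
  shows "hprime {f. \<theta> f \<in> I}"
  unfolding hprime_def
proof (intro conjI allI impI)
  note I' = hprimeD [OF I]
  show "poisson_stable {f. \<theta> f \<in> I}" by (rule poisson_stable_vimage [OF I'(1)])
  show "1 \<notin> {f. \<theta> f \<in> I}" using I'(3) by simp
  fix J K assume J: "poisson_stable J" and K: "poisson_stable K" and JK: "\<forall>a\<in>J. \<forall>b\<in>K. a * b \<in> {f. \<theta> f \<in> I}"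
  have "{f. \<theta> f \<in> J} \<subseteq> I \<or> {f. \<theta> f \<in> K} \<subseteq> I"
  proof (rule I'(4) [OF poisson_stable_vimage [OF J] poisson_stable_vimage [OF K]])
    fix a b assume "a \<in> {f. \<theta> f \<in> J}" "b \<in> {f. \<theta> f \<in> K}"
    then have "\<theta> a * \<theta> b \<in> {f. \<theta> f \<in> I}" using JK by blast
    then have "\<theta> (\<theta> (a * b)) \<in> I" by (simp add: const.psubst_mult)
    then show "a * b \<in> I" by (simp only: theta_theta_iff [OF I'(1)])
  qed
  moreover have "L \<subseteq> {f. \<theta> f \<in> I}" if L: "poisson_stable L" "{f. \<theta> f \<in> L} \<subseteq> I" for L
    using L(2) theta_theta_iff [OF L(1)] by blast
  ultimately show "J \<subseteq> {f. \<theta> f \<in> I} \<or> K \<subseteq> {f. \<theta> f \<in> I}" using J K by blast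
qed

end

definition minor :: "3 \<Rightarrow> 3 \<Rightarrow> 3 \<Rightarrow> 3 \<Rightarrow> 'k :: comm_ring_1 mat3_poly" where
  "minor i l j m = mvar i j * mvar l m - mvar i m * mvar l j"

lemma transpose_involution: "poisson_involution (\<lambda>v. mvar (snd v) (fst v) :: 'k :: field_char_0 mat3_poly)"
proof (unfold_locales, unfold fst_conv snd_conv)
  let ?t = "\<lambda>v::3 \<times> 3. mvar (snd v) (fst v) :: 'k mat3_poly"
  fix i j l m :: 3
  show "M3_bracket (mvar j i) (mvar m l :: 'k mat3_poly) = (order_sign i l + order_sign j m) * mvar m i * mvar j l"
    by (simp add: M3_bracket_mvar algebra_simps)
  show "\<exists>r. psubst const_poly ?t (mvar j i) - mvar i j = r * (Det - 1)"
    by (intro exI [of _ 0]) (simp add: const.psubst_hom)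
  show "\<exists>r. psubst const_poly ?t Det - 1 = r * (Det - 1)"
    by (intro exI [of _ 1]) (simp add: Det_expand const.psubst_hom algebra_simps)
next
  fix h :: "(3 \<Rightarrow> 'k) \<times> (3 \<Rightarrow> 'k)" assume "h \<in> torus"
  then have "(snd h, fst h) \<in> torus" by (auto simp: torus_def mult.commute)
  then show "\<exists>h'\<in>torus. \<forall>i j. torus_act h' (mvar j i) = const_poly (fst h i * snd h j) * mvar j i"
    by (intro bexI [of _ "(snd h, fst h)"]) (simp_all add: torus_act_mvar mult.commute)
qed

text \<open>The rows other than \<open>2 - i\<close>, in increasing order.\<close>

definition lower_index :: "3 \<Rightarrow> 3" where "lower_index i = (if i = 2 then 1 else 0)"
definition upper_index :: "3 \<Rightarrow> 3" where "upper_index i = (if i = 0 then 1 else 2)"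

text \<open>
  The cofactor matrix rotated by 180 degrees. Taking cofactors reverses the sign of the bracket,
  and so does reversing the order of rows and columns; the combination preserves it. It sends
  \<open>x 0 0\<close> to \<open>[0 1|0 1]\<close>.
\<close>

definition cofactor :: "3 \<times> 3 \<Rightarrow> 'k :: comm_ring_1 mat3_poly" where
  "cofactor = (\<lambda>(i, j). (if (i = 1) = (j = 1) then 1 else - 1) *
     minor (lower_index i) (upper_index i) (lower_index j) (upper_index j))"

lemma num3_neq: "(0::3) \<noteq> 1" "(0::3) \<noteq> 2" "(1::3) \<noteq> 2" "(1::3) \<noteq> 0" "(2::3) \<noteq> 0" "(2::3) \<noteq> 1"
  using num3_less by (auto dest: less_imp_neq)

lemma cofactor_simps:
  "cofactor (0, 0) = minor 0 1 0 1" "cofactor (0, 1) = - minor 0 1 0 2" "cofactor (0, 2) = minor 0 1 1 2"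
  "cofactor (1, 0) = - minor 0 2 0 1" "cofactor (1, 1) = minor 0 2 0 2" "cofactor (1, 2) = - minor 0 2 1 2"
  "cofactor (2, 0) = minor 1 2 0 1" "cofactor (2, 1) = - minor 1 2 0 2" "cofactor (2, 2) = minor 1 2 1 2"
  by (simp_all add: cofactor_def lower_index_def upper_index_def num3_neq)

lemma cofactor_bracket:
  "M3_bracket (cofactor (i, j)) (cofactor (l, m)) =
    (order_sign i l + order_sign j m) * cofactor (i, m) * (cofactor (l, j) :: 'k :: comm_ring_1 mat3_poly)"
  using num3_cases [of i] num3_cases [of j] num3_cases [of l] num3_cases [of m]
  by (elim disjE; hypsubst; simp only: cofactor_simps minor_def order_sign_num3;
      simp add: M3_bracket_diff M3_bracket_uminus M3_bracket_mult_left M3_bracket_mult_right M3_bracket_mvar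
        order_sign_num3 algebra_simps)

lemma cofactor_cofactor: "psubst const_poly cofactor (cofactor (i, j)) = Det * (mvar i j :: 'k :: field mat3_poly)"
  using num3_cases [of i] num3_cases [of j]
  by (elim disjE; hypsubst; simp only: cofactor_simps;
      simp add: minor_def const.psubst_hom cofactor_simps Det_expand algebra_simps)

lemma cofactor_Det: "psubst const_poly cofactor Det = Det * (Det :: 'k :: field mat3_poly)"
  by (simp add: Det_expand const.psubst_hom cofactor_simps minor_def algebra_simps)

lemma torus_act_minor:
  "torus_act h (minor i l j m) = const_poly (fst h i * fst h l * snd h j * snd h m) * minor i l j m"
  by (simp add: minor_def torus_act_diff torus_act_mult torus_act_mvar const_poly_mult algebra_simps)

lemma weight_minor: "weight (\<lambda>h. fst h i * fst h l * snd h j * snd h m) (minor i l j m)"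
  by (auto simp: weight_def torus_act_minor torus_def)

lemma cofactor_involution: "poisson_involution (cofactor :: _ \<Rightarrow> 'k :: field_char_0 mat3_poly)"
proof
  fix i j l m :: 3
  show "M3_bracket (cofactor (i, j)) (cofactor (l, m)) =
      (order_sign i l + order_sign j m) * cofactor (i, m) * (cofactor (l, j) :: 'k mat3_poly)"
    by (rule cofactor_bracket)
  show "\<exists>r. psubst const_poly cofactor (cofactor (i, j)) - mvar i j = r * (Det - 1 :: 'k mat3_poly)"
    unfolding cofactor_cofactor by (intro exI [of _ "mvar i j"]) (simp add: algebra_simps)
  show "\<exists>r. psubst const_poly cofactor Det - 1 = r * (Det - 1 :: 'k mat3_poly)"
    unfolding cofactor_Det by (intro exI [of _ "Det + 1"]) (simp add: algebra_simps)
next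
  fix h :: "(3 \<Rightarrow> 'k) \<times> (3 \<Rightarrow> 'k)" assume h: "h \<in> torus"
  \<comment> \<open>\<open>UNIV_3\<close> lists the indices as \<open>1, 2, 3\<close>, and \<open>3\<close> is \<open>0\<close> in the type of indices.\<close>
  have 3: "(3::3) = 0" by simp
  have nz: "fst h i \<noteq> 0" "snd h i \<noteq> 0" for i using h by (auto simp: torus_def)
  have p: "fst h 0 * fst h 1 * fst h 2 * (snd h 0 * snd h 1 * snd h 2) = 1"
    using h unfolding torus_def UNIV_3 3 by (auto simp: ac_simps num3_neq)
  define h' where "h' = ((\<lambda>i. 1 / fst h (2 - i)), (\<lambda>j. 1 / snd h (2 - j)))"
  have s: "2 - (0::3) = 2" "2 - (1::3) = 1" "2 - (2::3) = 0" by simp_all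
  have "(\<Prod>i\<in>UNIV. fst h' i) * (\<Prod>j\<in>UNIV. snd h' j) =
      1 / (fst h 0 * fst h 1 * fst h 2 * (snd h 0 * snd h 1 * snd h 2))"
    unfolding UNIV_3 3 by (simp add: h'_def num3_neq s)
  then have h': "h' \<in> torus" using p nz by (simp add: torus_def h'_def case_prod_beta)
  define a where "a = fst h 0 * fst h 1 * fst h 2"
  define b where "b = snd h 0 * snd h 1 * snd h 2"
  have ab: "1 / a * (1 / b) = 1" using p by (simp add: a_def b_def)
  have row: "fst h' (lower_index i) * fst h' (upper_index i) = fst h i * (1 / a)"
    and column: "snd h' (lower_index i) * snd h' (upper_index i) = snd h i * (1 / b)" for i
    using num3_cases [of i] nz
    by (auto simp: h'_def s lower_index_def upper_index_def num3_neq a_def b_def field_simps)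
  have "torus_act h' (cofactor (i, j)) = const_poly (fst h i * snd h j) * cofactor (i, j)" for i j
  proof -
    have "fst h' (lower_index i) * fst h' (upper_index i) * snd h' (lower_index j) * snd h' (upper_index j)
      = (fst h i * (1 / a)) * (snd h j * (1 / b))"
      unfolding row [symmetric] column [symmetric] by (simp only: mult.assoc)
    also have "\<dots> = fst h i * snd h j * (1 / a * (1 / b))" by (simp only: ac_simps)
    finally have c: "fst h' (lower_index i) * fst h' (upper_index i) * snd h' (lower_index j) * snd h' (upper_index j)
      = fst h i * snd h j" unfolding ab by simp
    show ?thesis by (simp add: cofactor_def torus_act_minor torus_act_uminus c)
  qed
  with h' show "\<exists>h'\<in>torus. \<forall>i j. torus_act h' (cofactor (i, j)) = const_poly (fst h i * snd h j) * cofactor (i, j)"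
    by blast
qed

interpretation transpose: poisson_involution "\<lambda>v. mvar (snd v) (fst v) :: 'k :: field_char_0 mat3_poly"
  by (rule transpose_involution)

interpretation cofactor: poisson_involution "cofactor :: _ \<Rightarrow> 'k :: field_char_0 mat3_poly"
  by (rule cofactor_involution)


section \<open>The entries and minors contained in a Poisson \<open>H\<close>-prime\<close>

lemma hprime_mvar_mult:
  assumes "hprime I" "mvar i j * r \<in> I"
  shows "mvar i j \<in> I \<or> r \<in> (I :: 'k :: field_char_0 mat3_poly set)"
  using hprime_regular [OF assms(1) weight_mvar _ assms(2)] by blast

lemma hprime_bracket_mem:
  assumes "hprime I" "f \<in> I"
  shows "M3_bracket f g \<in> I" "M3_bracket g f \<in> I"
  using poisson_stableD(3,4) [OF hprimeD(1) [OF assms(1)] assms(2)] by blast+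

lemma hprime_Det: "hprime I \<Longrightarrow> Det \<notin> I"
  using ideal_setD(6) [of I Det "Det - 1"] hprimeD [of I] poisson_stableD(2) [of I] by auto

text \<open>
  The bracket of two entries in diagonal position is twice the product of the other two entries of
  the submatrix, which can be split by regularity.
\<close>

lemma diagonal_bracket_mem:
  assumes I: "hprime (I :: 'k :: field_char_0 mat3_poly set)" and il: "i < l" "j < m"
    and f: "mvar i j \<in> I \<or> mvar l m \<in> I"
  shows "mvar i m \<in> I \<or> mvar l j \<in> I"
proof -
  have "M3_bracket (mvar i j) (mvar l m) \<in> I" using f hprime_bracket_mem [OF I] by blast
  then have "of_nat 2 * (mvar i m * mvar l j) \<in> I" unfolding M3_bracket_diagonal [OF il] by (simp add: mult.assoc)
  then have "mvar i m * mvar l j \<in> I" by (rule of_nat_cancel [OF hprimeD(2) [OF I], rotated]) simp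
  then show ?thesis by (rule hprime_mvar_mult [OF I])
qed

lemma first_row_column_mem:
  "ideal_set I \<Longrightarrow> mvar 0 0 \<in> I \<Longrightarrow> mvar 0 1 \<in> I \<Longrightarrow> mvar 0 2 \<in> I \<Longrightarrow> Det \<in> I"
  "ideal_set I \<Longrightarrow> mvar 0 0 \<in> I \<Longrightarrow> mvar 1 0 \<in> I \<Longrightarrow> mvar 2 0 \<in> I \<Longrightarrow> Det \<in> I"
  unfolding Det_expand by (intro ideal_setD(2,6); auto intro: ideal_setD(3,4))+

text \<open>
  By \<open>diagonal_bracket_mem\<close>, \<open>x 0 0 \<in> I\<close> would force the whole first row or the whole first column
  into \<open>I\<close>, and with it \<open>Det\<close>, which is \<open>1\<close> modulo \<open>I\<close>.
\<close>

lemma corner_notin: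
  assumes I: "hprime (I :: 'k :: field_char_0 mat3_poly set)"
  shows "mvar 0 0 \<notin> I"
proof
  assume m: "mvar 0 0 \<in> I"
  note d = diagonal_bracket_mem [OF I, of 0 _ 0 _] num3_less
  have "(mvar 0 1 \<in> I \<or> mvar 1 0 \<in> I) \<and> (mvar 0 1 \<in> I \<or> mvar 2 0 \<in> I) \<and>
      (mvar 0 2 \<in> I \<or> mvar 1 0 \<in> I) \<and> (mvar 0 2 \<in> I \<or> mvar 2 0 \<in> I)"
    using d m by blast
  then show False using first_row_column_mem [OF hprimeD(2) [OF I] m] hprime_Det [OF I] by blast
qed

lemma leading_minor_notin:
  assumes I: "hprime (I :: 'k :: field_char_0 mat3_poly set)"
  shows "minor 0 1 0 1 \<notin> I"
  using corner_notin [OF cofactor.hprime_vimage [OF I]] by (simp add: const.psubst_hom cofactor_simps)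

lemma centre_notin:
  assumes I: "hprime (I :: 'k :: field_char_0 mat3_poly set)"
  shows "mvar 1 1 \<notin> I"
proof
  assume m: "mvar 1 1 \<in> I"
  then have "mvar 0 1 * mvar 1 0 \<in> I"
    using diagonal_bracket_mem [OF I, of 0 1 0 1] num3_less ideal_setD(3,4) [OF hprimeD(2) [OF I]] by blast
  then have "minor 0 1 0 1 \<in> I"
    unfolding minor_def using m hprimeD(2) [OF I] by (intro ideal_setD(6)) (auto intro: ideal_setD(3))
  then show False using leading_minor_notin [OF I] by blast
qed

lemma subdiagonal_mem:
  assumes I: "hprime (I :: 'k :: field_char_0 mat3_poly set)"
  shows "mvar 1 0 \<in> I \<Longrightarrow> mvar 2 0 \<in> I" "mvar 2 1 \<in> I \<Longrightarrow> mvar 2 0 \<in> I"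
    "mvar 0 1 \<in> I \<Longrightarrow> mvar 0 2 \<in> I" "mvar 1 2 \<in> I \<Longrightarrow> mvar 0 2 \<in> I"
  using diagonal_bracket_mem [OF I, of 1 2 0 1] diagonal_bracket_mem [OF I, of 0 1 1 2]
    centre_notin [OF I] num3_less by blast+

lemma corner_minor_mem:
  assumes I: "hprime (I :: 'k :: field_char_0 mat3_poly set)"
  shows "mvar 2 0 \<in> I \<Longrightarrow> minor 1 2 0 1 \<in> I \<longleftrightarrow> mvar 1 0 \<in> I \<or> mvar 2 1 \<in> I"
    "mvar 0 2 \<in> I \<Longrightarrow> minor 0 1 1 2 \<in> I \<longleftrightarrow> mvar 0 1 \<in> I \<or> mvar 1 2 \<in> I"
proof -
  note i = hprimeD(2) [OF I]
  have eq: "a * b - c \<in> I \<longleftrightarrow> a * b \<in> I" if "c \<in> I" for a b c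
    using ideal_set_cong [OF i, of "a * b - c" "a * b"] ideal_setD(5) [OF i that] by simp
  have "mvar i j * b \<in> I \<longleftrightarrow> mvar i j \<in> I \<or> b \<in> I" for i j b
    using hprime_mvar_mult [OF I] ideal_setD(3,4) [OF i] by blast
  moreover have "mvar 1 1 * mvar 2 0 \<in> I" if "mvar 2 0 \<in> I" using that by (rule ideal_setD(3) [OF i])
  moreover have "mvar 0 2 * mvar 1 1 \<in> I" if "mvar 0 2 \<in> I" using that by (rule ideal_setD(4) [OF i])
  ultimately show "mvar 2 0 \<in> I \<Longrightarrow> minor 1 2 0 1 \<in> I \<longleftrightarrow> mvar 1 0 \<in> I \<or> mvar 2 1 \<in> I"
    "mvar 0 2 \<in> I \<Longrightarrow> minor 0 1 1 2 \<in> I \<longleftrightarrow> mvar 0 1 \<in> I \<or> mvar 1 2 \<in> I"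
    unfolding minor_def by (simp_all add: eq)
qed


section \<open>Elements that become polynomial after clearing denominators\<close>

text \<open>
  \<open>Q\<close> is an ideal to be computed with, \<open>S\<close> the subring generated by the chosen coordinates, and \<open>f\<close> an
  element that will be inverted. An element is \<open>clearable\<close> if it lies in \<open>S[1 / f]\<close> modulo \<open>Q\<close>, in a
  form that makes sense without forming quotients.
\<close>

locale clearing =
  fixes Q S :: "'k :: field_char_0 mat3_poly set" and f :: "'k mat3_poly"
  assumes Q: "ideal_set Q" and S: "subring_set S" and S_const: "const_poly c \<in> S"
    and f_S: "\<exists>s\<in>S. f - s \<in> Q"
begin

definition clearable :: "'k mat3_poly \<Rightarrow> bool" where
  "clearable x \<longleftrightarrow> (\<exists>n. \<exists>s\<in>S. f ^ n * x - s \<in> Q)"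

lemma clearable_mem: "s \<in> S \<Longrightarrow> clearable s"
  unfolding clearable_def by (intro exI [of _ 0] bexI [of _ s]) (simp_all add: ideal_setD(1) [OF Q])

lemma clearable_ideal: "q \<in> Q \<Longrightarrow> clearable q"
  unfolding clearable_def by (intro exI [of _ 0] bexI [of _ 0]) (simp_all add: subring_setD(2) [OF S])

lemma power_f_S: "\<exists>s\<in>S. f ^ n - s \<in> Q"
proof (induct n)
  case 0
  show ?case by (intro bexI [of _ 1]) (simp_all add: ideal_setD(1) [OF Q] subring_setD(1) [OF S])
next
  case (Suc n)
  then obtain s t where st: "s \<in> S" "f ^ n - s \<in> Q" "t \<in> S" "f - t \<in> Q" using f_S by blast
  have "f ^ Suc n - t * s = (f - t) * f ^ n + t * (f ^ n - s)" by (simp add: algebra_simps)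
  then have "f ^ Suc n - t * s \<in> Q" using st ideal_setD(2-4) [OF Q] by simp
  then show ?case using subring_setD(4) [OF S st(3,1)] by blast
qed

lemma clearable_more:
  assumes "f ^ n * x - s \<in> Q" "s \<in> S"
  shows "\<exists>s\<in>S. f ^ (m + n) * x - s \<in> Q"
proof -
  obtain t where t: "t \<in> S" "f ^ m - t \<in> Q" using power_f_S by blast
  have "f ^ (m + n) * x - t * s = (f ^ m - t) * (f ^ n * x) + t * (f ^ n * x - s)"
    by (simp add: algebra_simps power_add)
  then have "f ^ (m + n) * x - t * s \<in> Q" using t assms ideal_setD(2-4) [OF Q] by simp
  then show ?thesis using subring_setD(4) [OF S t(1) assms(2)] by blast
qed

lemma clearable_add: assumes "clearable x" "clearable y" shows "clearable (x + y)"
proof -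
  obtain m n s t where "f ^ m * x - s \<in> Q" "s \<in> S" "f ^ n * y - t \<in> Q" "t \<in> S"
    using assms unfolding clearable_def by blast
  then obtain s' t' where st: "s' \<in> S" "f ^ (n + m) * x - s' \<in> Q" "t' \<in> S" "f ^ (m + n) * y - t' \<in> Q"
    using clearable_more by blast
  have "(f ^ (n + m) * x - s') + (f ^ (m + n) * y - t') \<in> Q" using st by (intro ideal_setD(2) [OF Q])
  moreover have "(f ^ (n + m) * x - s') + (f ^ (m + n) * y - t') = f ^ (n + m) * (x + y) - (s' + t')"
    by (simp add: algebra_simps)
  ultimately show ?thesis unfolding clearable_def using subring_setD(6) [OF S st(1,3)] by auto
qed

lemma clearable_mult: assumes "clearable x" "clearable y" shows "clearable (x * y)"
proof -
  obtain m n s t where st: "f ^ m * x - s \<in> Q" "s \<in> S" "f ^ n * y - t \<in> Q" "t \<in> S"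
    using assms unfolding clearable_def by blast
  have "f ^ (m + n) * (x * y) - s * t = (f ^ m * x - s) * (f ^ n * y) + s * (f ^ n * y - t)"
    by (simp add: algebra_simps power_add)
  then have "f ^ (m + n) * (x * y) - s * t \<in> Q" using st ideal_setD(2-4) [OF Q] by simp
  then show ?thesis unfolding clearable_def using subring_setD(4) [OF S st(2,4)] by blast
qed

lemma clearable_const: "clearable (const_poly c)"
  by (rule clearable_mem [OF S_const])

lemma clearable_1: "clearable 1"
  using clearable_const [of 1] by simp

lemma clearable_uminus: "clearable x \<Longrightarrow> clearable (- x)"
  using clearable_mult [OF clearable_const [of "- 1"], of x] by (simp add: const_poly_def single_uminus)

lemma clearable_diff: "clearable x \<Longrightarrow> clearable y \<Longrightarrow> clearable (x - y)"
  using clearable_add [OF _ clearable_uminus, of x y] by simp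

lemmas clearable_ring = clearable_add clearable_mult clearable_diff clearable_uminus clearable_1

lemma clearable_cong: "x - y \<in> Q \<Longrightarrow> clearable y \<Longrightarrow> clearable x"
  using clearable_add [OF clearable_ideal, of "x - y" y] by simp

lemma clearable_divide:
  assumes "clearable (a * x)" "clearable b" "f = a * b"
  shows "clearable x"
proof -
  have "clearable ((a * x) * b)" using assms(1,2) by (rule clearable_mult)
  then obtain n s where "f ^ n * ((a * x) * b) - s \<in> Q" "s \<in> S" unfolding clearable_def by blast
  moreover have "f ^ n * ((a * x) * b) = f ^ Suc n * x" by (simp add: assms(3) ac_simps)
  ultimately show ?thesis unfolding clearable_def by metis
qed

lemma clearable_all:
  assumes "\<And>i j. clearable (mvar i j)"
  shows "clearable g"
  by (induct g rule: mat3_poly_induct)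
    (simp_all add: assms clearable_const clearable_add clearable_mult)

end


section \<open>Algebraic independence of log-canonical elements\<close>

definition scale_monomials :: "(('v \<Rightarrow>\<^sub>0 nat) \<Rightarrow> 'k) \<Rightarrow> (('v \<Rightarrow>\<^sub>0 nat) \<Rightarrow>\<^sub>0 'k) \<Rightarrow> ('v \<Rightarrow>\<^sub>0 nat) \<Rightarrow>\<^sub>0 'k :: comm_ring_1" where
  "scale_monomials l = Poly_Mapping.mapp (\<lambda>m c. l m * c)"

lemma lookup_scale_monomials: "Poly_Mapping.lookup (scale_monomials l G) m = l m * Poly_Mapping.lookup G m"
  by (simp add: scale_monomials_def lookup_mapp when_def in_keys_iff)

lemma scale_monomials_diff:
  "scale_monomials (\<lambda>m. l m - a) G = scale_monomials l G - coeff_poly a * G"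
proof (rule poly_mapping_eqI)
  fix m
  show "Poly_Mapping.lookup (scale_monomials (\<lambda>m. l m - a) G) m = Poly_Mapping.lookup (scale_monomials l G - coeff_poly a * G) m"
    using lookup_single_mult [of 0 a G m] by (simp add: lookup_scale_monomials lookup_minus algebra_simps)
qed

text \<open>
  The argument for independence of characters. If two monomials of \<open>G\<close> are separated by the scaling
  \<open>l\<close>, then subtracting a multiple of \<open>G\<close> from its rescaled version removes one of the two and keeps
  the other. Iterating leaves a single term.
\<close>

lemma monomial_separation:
  fixes G :: "('v \<Rightarrow>\<^sub>0 nat) \<Rightarrow>\<^sub>0 'k :: field"
  assumes "P G" "G \<noteq> 0" "Poly_Mapping.keys G \<subseteq> M"
    and scale: "\<And>l a F. l \<in> Ops \<Longrightarrow> P F \<Longrightarrow> Poly_Mapping.keys F \<subseteq> M \<Longrightarrow> P (scale_monomials (\<lambda>m. l m - a) F)"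
    and sep: "\<And>m m'. m \<in> M \<Longrightarrow> m' \<in> M \<Longrightarrow> (\<And>l. l \<in> Ops \<Longrightarrow> l m = l m') \<Longrightarrow> m = m'"
  shows "\<exists>m\<in>M. \<exists>c. c \<noteq> 0 \<and> P (Poly_Mapping.single m c)"
  using assms(1-3)
proof (induct "card (Poly_Mapping.keys G)" arbitrary: G rule: less_induct)
  case less
  obtain m where m: "m \<in> Poly_Mapping.keys G" using less.prems(2) by (metis ex_in_conv keys_eq_empty)
  show ?case
  proof (cases "Poly_Mapping.keys G = {m}")
    case True
    have "Poly_Mapping.lookup G k = 0" if "k \<noteq> m" for k using True that by (metis in_keys_iff singletonD)
    then have "G = Poly_Mapping.single m (Poly_Mapping.lookup G m)"
      by (intro poly_mapping_eqI) (simp add: lookup_single when_def)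
    moreover have "Poly_Mapping.lookup G m \<noteq> 0" using m by (simp add: in_keys_iff)
    ultimately show ?thesis using less.prems(1,3) m by (metis subsetD)
  next
    case False
    then obtain m' where m': "m' \<in> Poly_Mapping.keys G" "m' \<noteq> m" using m by blast
    obtain l where l: "l \<in> Ops" "l m \<noteq> l m'" using sep [of m m'] m m' less.prems(3) by blast
    define F where "F = scale_monomials (\<lambda>a. l a - l m) G"
    have keys: "Poly_Mapping.keys F \<subseteq> Poly_Mapping.keys G - {m}" and "m' \<in> Poly_Mapping.keys F"
      using l(2) m'(1) by (auto simp: F_def in_keys_iff lookup_scale_monomials)
    then have nz: "F \<noteq> 0" by auto
    have lt: "card (Poly_Mapping.keys F) < card (Poly_Mapping.keys G)"
      using keys m by (intro psubset_card_mono) auto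
    have PF: "P F" unfolding F_def using l(1) less.prems(1,3) by (rule scale)
    have "Poly_Mapping.keys F \<subseteq> M" using keys less.prems(3) by (blast dest: subsetD)
    then show ?thesis by (rule less.hyps [OF lt PF nz])
  qed
qed

interpretation coeff: coefficient_hom "coeff_poly :: 'k :: comm_ring_1 \<Rightarrow> ('v \<Rightarrow>\<^sub>0 nat) \<Rightarrow>\<^sub>0 'k"
  by (rule coefficient_hom_coeff_poly)

lemma torus_act_prod:
  assumes "finite W" "\<And>v. v \<in> W \<Longrightarrow> weight (w v) (y v)" "h \<in> torus"
  shows "torus_act h (\<Prod>v\<in>W. y v ^ e v) = const_poly (\<Prod>v\<in>W. w v h ^ e v) * (\<Prod>v\<in>W. y v ^ e v)"
  using assms(1,2)
proof (induct W)
  case empty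
  show ?case by (simp add: torus_act_one)
next
  case (insert v W)
  have "torus_act h (y v ^ e v) = const_poly (w v h ^ e v) * y v ^ e v"
    using weight_power [OF insert.prems [of v], of "e v"] assms(3) by (simp add: weight_def)
  with insert show ?case by (simp add: torus_act_mult const_poly_mult ac_simps)
qed

text \<open>
  If the bracket with \<open>u\<close> multiplies each \<open>y v\<close> by an integer multiple of \<open>u\<close>, then by the product rule
  it does so for monomials in the \<open>y v\<close>, and the integers add up.
\<close>

lemma log_canonical_prod:
  fixes I :: "'k :: field_char_0 mat3_poly set"
  assumes I: "ideal_set I" and "finite W"
    and c: "\<And>v. v \<in> W \<Longrightarrow> M3_bracket u (y v) - of_int (c v) * u * y v \<in> I"
  shows "M3_bracket u (\<Prod>v\<in>W. y v ^ e v) - of_int (\<Sum>v\<in>W. c v * int (e v)) * u * (\<Prod>v\<in>W. y v ^ e v) \<in> I"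
  using assms(2) c
proof (induct W)
  case empty
  show ?case using M3_bracket_const_right [of u 1] ideal_setD(1) [OF I] by simp
next
  case (insert v W)
  let ?P = "\<Prod>v\<in>W. y v ^ e v" and ?s = "of_int (\<Sum>v\<in>W. c v * int (e v)) :: 'k mat3_poly"
  have 1: "M3_bracket u (y v ^ e v) - of_int (c v * int (e v)) * u * y v ^ e v \<in> I"
  proof (cases "e v")
    case 0
    then show ?thesis using M3_bracket_const_right [of u 1] ideal_setD(1) [OF I] by simp
  next
    case (Suc n)
    have "M3_bracket u (y v ^ e v) = of_nat (e v) * y v ^ n * M3_bracket u (y v)"
      using M3_bracket_power [of "y v" "e v" u] M3_bracket_antisym [of u] by (simp add: Suc)
    then have "M3_bracket u (y v ^ e v) - of_int (c v * int (e v)) * u * y v ^ e v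
      = (of_nat (e v) * y v ^ n) * (M3_bracket u (y v) - of_int (c v) * u * y v)"
      by (simp add: Suc algebra_simps)
    then show ?thesis using ideal_setD(3) [OF I insert.prems [of v]] by simp
  qed
  have "(\<Prod>v\<in>insert v W. y v ^ e v) = y v ^ e v * ?P"
    "of_int (\<Sum>v\<in>insert v W. c v * int (e v)) = of_int (c v * int (e v)) + ?s"
    using insert.hyps by simp_all
  then have "M3_bracket u (\<Prod>v\<in>insert v W. y v ^ e v) -
      of_int (\<Sum>v\<in>insert v W. c v * int (e v)) * u * (\<Prod>v\<in>insert v W. y v ^ e v)
    = y v ^ e v * (M3_bracket u ?P - ?s * u * ?P)
      + (M3_bracket u (y v ^ e v) - of_int (c v * int (e v)) * u * y v ^ e v) * ?P"
    by (simp only: M3_bracket_mult_right) (simp only: algebra_simps)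
  then show ?case using ideal_setD(2-4) [OF I] insert 1 by simp
qed

text \<open>
  The relations \<open>G\<close> with \<open>psubst const_poly y G \<in> I\<close> are stable under two kinds of rescaling of
  monomials: by the torus weights, because \<open>I\<close> is torus stable, and by the coefficients of the
  bracket with \<open>y u\<close>, because \<open>I\<close> is a Poisson ideal and the extra factor \<open>y u\<close> can be cancelled by
  regularity. If these scalings separate all monomials, a nontrivial relation would produce a
  single monomial in \<open>I\<close>, which regularity excludes.
\<close>

lemma independent_mod_hprime:
  fixes I :: "'k :: field_char_0 mat3_poly set" and y :: "nat \<Rightarrow> 'k mat3_poly"
  assumes I: "hprime I" and V: "finite V"
    and w: "\<And>v. v \<in> V \<Longrightarrow> weight (w v) (y v)" and out: "\<And>v. v \<in> V \<Longrightarrow> y v \<notin> I"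
    and H: "H \<subseteq> torus"
    and U: "\<And>u v. u \<in> U \<Longrightarrow> v \<in> V \<Longrightarrow> M3_bracket (y u) (y v) - of_int (c u v) * y u * y v \<in> I" "U \<subseteq> V"
    and sep: "\<And>a b :: nat \<Rightarrow> nat. (\<And>v. v \<notin> V \<Longrightarrow> a v = 0 \<and> b v = 0) \<Longrightarrow>
      (\<And>h. h \<in> H \<Longrightarrow> (\<Prod>v\<in>V. w v h ^ a v) = (\<Prod>v\<in>V. w v h ^ b v)) \<Longrightarrow>
      (\<And>u. u \<in> U \<Longrightarrow> (\<Sum>v\<in>V. c u v * int (a v)) = (\<Sum>v\<in>V. c u v * int (b v))) \<Longrightarrow> a = b"
    and G: "G \<in> polys_in V" "psubst const_poly y G \<in> I"
  shows "G = 0"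
proof (rule ccontr)
  assume nz: "G \<noteq> 0"
  note i = hprimeD(2) [OF I]
  define M where "M = {m :: nat \<Rightarrow>\<^sub>0 nat. Poly_Mapping.keys m \<subseteq> V}"
  define P where "P F \<longleftrightarrow> psubst const_poly y F \<in> I" for F :: "(nat \<Rightarrow>\<^sub>0 nat) \<Rightarrow>\<^sub>0 'k"
  define wt where "wt h m = (\<Prod>v\<in>V. w v h ^ Poly_Mapping.lookup m v)" for h m
  define ad where "ad u m = (of_int (\<Sum>v\<in>V. c u v * int (Poly_Mapping.lookup m v)) :: 'k)" for u m
  define Ops where "Ops = wt ` H \<union> ad ` U"
  have mono: "monomial_value y m = (\<Prod>v\<in>V. y v ^ Poly_Mapping.lookup m v)" if "m \<in> M" for m
    using that V by (intro monomial_value_superset) (auto simp: M_def)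
  have scale_sum: "psubst const_poly y (scale_monomials l F) =
      (\<Sum>m\<in>Poly_Mapping.keys F. const_poly (l m * Poly_Mapping.lookup F m) * monomial_value y m)" for l F
    unfolding psubst_def
    by (intro sum.mono_neutral_cong_left) (auto simp: in_keys_iff lookup_scale_monomials)
  have "\<exists>m\<in>M. \<exists>a. a \<noteq> 0 \<and> P (Poly_Mapping.single m a)"
  proof (rule monomial_separation [where G = G and Ops = Ops])
    show "P G" "G \<noteq> 0" "Poly_Mapping.keys G \<subseteq> M" using G nz by (auto simp: P_def polys_in_def M_def)
    show "m = m'" if m: "m \<in> M" "m' \<in> M" and eq: "\<And>l. l \<in> Ops \<Longrightarrow> l m = l m'" for m m'
    proof -
      have "Poly_Mapping.lookup m = Poly_Mapping.lookup m'"
      proof (rule sep)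
        show "Poly_Mapping.lookup m v = 0 \<and> Poly_Mapping.lookup m' v = 0" if "v \<notin> V" for v
          using that m by (auto simp: M_def in_keys_iff)
        show "(\<Prod>v\<in>V. w v h ^ Poly_Mapping.lookup m v) = (\<Prod>v\<in>V. w v h ^ Poly_Mapping.lookup m' v)" if "h \<in> H" for h
          using eq [of "wt h"] that by (auto simp: Ops_def wt_def)
        fix u assume "u \<in> U"
        then have "ad u m = ad u m'" using eq [of "ad u"] by (auto simp: Ops_def)
        then show "(\<Sum>v\<in>V. c u v * int (Poly_Mapping.lookup m v)) = (\<Sum>v\<in>V. c u v * int (Poly_Mapping.lookup m' v))"
          unfolding ad_def of_int_eq_iff .
      qed
      then show ?thesis by (simp only: poly_mapping_eq_iff [of m])
    qed
    fix l a and F :: "(nat \<Rightarrow>\<^sub>0 nat) \<Rightarrow>\<^sub>0 'k"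
    assume l: "l \<in> Ops" and F: "P F" "Poly_Mapping.keys F \<subseteq> M"
    have "psubst const_poly y (scale_monomials l F) \<in> I"
      using l unfolding Ops_def
    proof
      assume "l \<in> wt ` H"
      then obtain h where h: "h \<in> H" "l = wt h" by blast
      have "torus_act h (const_poly b * monomial_value y m) = const_poly (l m * b) * monomial_value y m"
        if "m \<in> M" for m b
      proof -
        have "h \<in> torus" using h(1) H by blast
        then have t: "torus_act h (\<Prod>v\<in>V. y v ^ Poly_Mapping.lookup m v) =
            const_poly (wt h m) * (\<Prod>v\<in>V. y v ^ Poly_Mapping.lookup m v)"
          unfolding wt_def by (intro torus_act_prod V w)
        show ?thesis
          unfolding mono [OF that] h(2) torus_act_mult torus_act_const t const_poly_mult by (simp only: ac_simps)
      qed
      moreover have sum: "torus_act h (sum g T) = (\<Sum>m\<in>T. torus_act h (g m))" for g :: "(nat \<Rightarrow>\<^sub>0 nat) \<Rightarrow> 'k mat3_poly" and T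
        by (induct T rule: infinite_finite_induct) (simp_all add: torus_act_add)
      ultimately have "torus_act h (psubst const_poly y F) = psubst const_poly y (scale_monomials l F)"
        unfolding scale_sum unfolding psubst_def sum using F(2) by (intro sum.cong) auto
      moreover have "torus_act h (psubst const_poly y F) \<in> I"
        using F(1) unfolding P_def by (rule poisson_stableD(5) [OF hprimeD(1) [OF I] subsetD [OF H h(1)]])
      ultimately show ?thesis by simp
    next
      assume "l \<in> ad ` U"
      then obtain u where u: "u \<in> U" "l = ad u" by blast
      have t: "M3_bracket (y u) (const_poly b * monomial_value y m) - y u * (const_poly (l m * b) * monomial_value y m) \<in> I"
        if "m \<in> M" for m b
      proof -
        let ?d = "\<Sum>v\<in>V. c u v * int (Poly_Mapping.lookup m v)"
        have "const_poly b * (M3_bracket (y u) (monomial_value y m) - of_int ?d * y u * monomial_value y m) \<in> I"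
          unfolding mono [OF that] by (rule ideal_setD(3) [OF i log_canonical_prod [OF i V U(1) [OF u(1)]]])
        moreover have "of_int ?d = const_poly (l m)" unfolding u(2) ad_def const_poly_def single_of_int ..
        ultimately show ?thesis
          by (simp add: M3_bracket_mult_right M3_bracket_const_right const_poly_mult algebra_simps)
      qed
      have sum: "M3_bracket (y u) (sum g T) = (\<Sum>m\<in>T. M3_bracket (y u) (g m))" for g :: "(nat \<Rightarrow>\<^sub>0 nat) \<Rightarrow> 'k mat3_poly" and T
        by (induct T rule: infinite_finite_induct) (simp_all add: M3_bracket_add_right)
      have 1: "M3_bracket (y u) (psubst const_poly y F) - y u * psubst const_poly y (scale_monomials l F) \<in> I"
        unfolding scale_sum unfolding psubst_def sum sum_distrib_left sum_subtractf [symmetric]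
        using F(2) t by (intro ideal_set_sum [OF i]) blast
      have 2: "M3_bracket (y u) (psubst const_poly y F) \<in> I"
        using F(1) hprime_bracket_mem(2) [OF I] by (simp add: P_def)
      from ideal_setD(6) [OF i 2 1] have "y u * psubst const_poly y (scale_monomials l F) \<in> I" by simp
      then show ?thesis using hprime_regular [OF I w out] u(1) U(2) by blast
    qed
    moreover have "const_poly a * psubst const_poly y F \<in> I" using F(1) by (simp add: P_def ideal_setD(3) [OF i])
    ultimately show "P (scale_monomials (\<lambda>m. l m - a) F)"
      unfolding P_def scale_monomials_diff const.psubst_diff const.psubst_mult const.psubst_coeff
      by (rule ideal_setD(6) [OF i])
  qed
  then obtain m a where m: "m \<in> M" "a \<noteq> 0" "const_poly a * monomial_value y m \<in> I"
    by (auto simp: P_def const.psubst_single)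
  then have "(\<Prod>v\<in>V. y v ^ Poly_Mapping.lookup m v) \<in> I" using const_poly_cancel [OF i] mono by metis
  moreover have "(\<Prod>v\<in>W. y v ^ e v) \<notin> I" if "W \<subseteq> V" for W and e :: "nat \<Rightarrow> nat"
    using finite_subset [OF that V] that
  proof (induct W)
    case (insert v W)
    then show ?case using hprime_regular_power [OF I w out, of v "e v" "\<Prod>v\<in>W. y v ^ e v"] by auto
  qed (use hprimeD(3) [OF I] in simp)
  ultimately show False by blast
qed


section \<open>Generators of a Poisson \<open>H\<close>-prime up to denominators\<close>

text \<open>
  The entries and minors on which the distinction of the Poisson \<open>H\<close>-primes rests: \<open>I\<close> is recovered
  from the subset it contains, after inverting \<open>chart_denominator I\<close>.
\<close>

definition corner_elements :: "'k :: comm_ring_1 mat3_poly set" where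
  "corner_elements = {mvar 1 0, mvar 2 0, mvar 2 1, minor 1 2 0 1, mvar 0 1, mvar 0 2, mvar 1 2, minor 0 1 1 2}"

definition corner_ideal :: "'k :: comm_ring_1 mat3_poly set \<Rightarrow> 'k mat3_poly set" where
  "corner_ideal I = ideal_gen (insert (Det - 1) (corner_elements \<inter> I))"

definition chart_denominator :: "'k :: comm_ring_1 mat3_poly set \<Rightarrow> 'k mat3_poly" where
  "chart_denominator I = mvar 0 0 * minor 0 1 0 1 *
     ((if mvar 1 0 \<in> I then 1 else mvar 1 0) * (if mvar 0 1 \<in> I then 1 else mvar 0 1))"

text \<open>
  The elements of the corner set, completed by \<open>x 0 0\<close> and \<open>[0 1|0 1]\<close>. Of \<open>x 1 0\<close> and \<open>x 2 1\<close>, only one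
  is taken: the other can be recovered from \<open>[1 2|0 1]\<close> if \<open>x 1 0\<close> is invertible, and lies in \<open>I\<close>
  otherwise. The same holds for \<open>x 0 1\<close> and \<open>x 1 2\<close>.
\<close>

definition seed :: "'k :: comm_ring_1 mat3_poly set \<Rightarrow> nat \<Rightarrow> 'k mat3_poly" where
  "seed I v = [mvar 0 0, minor 0 1 0 1, if mvar 1 0 \<in> I then mvar 2 1 else mvar 1 0, mvar 2 0, minor 1 2 0 1,
     if mvar 0 1 \<in> I then mvar 1 2 else mvar 0 1, mvar 0 2, minor 0 1 1 2] ! v"

text \<open>
  Exponents of the weights of the seeds, for a one-parameter subgroup of the torus with exponents
  \<open>p\<close> for the rows and \<open>q\<close> for the columns.
\<close>

definition seed_degree :: "'k :: comm_ring_1 mat3_poly set \<Rightarrow> (3 \<Rightarrow> int) \<Rightarrow> (3 \<Rightarrow> int) \<Rightarrow> nat \<Rightarrow> int" where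
  "seed_degree I p q v = [p 0 + q 0, p 0 + p 1 + q 0 + q 1, if mvar 1 0 \<in> I then p 2 + q 1 else p 1 + q 0,
     p 2 + q 0, p 1 + p 2 + q 0 + q 1, if mvar 0 1 \<in> I then p 1 + q 2 else p 0 + q 1, p 0 + q 2,
     p 0 + p 1 + q 1 + q 2] ! v"

definition seed_weight :: "'k :: field mat3_poly set \<Rightarrow> nat \<Rightarrow> (3 \<Rightarrow> 'k) \<times> (3 \<Rightarrow> 'k) \<Rightarrow> 'k" where
  "seed_weight I v h = (case h of (p, q) \<Rightarrow> [p 0 * q 0, p 0 * p 1 * q 0 * q 1,
     if mvar 1 0 \<in> I then p 2 * q 1 else p 1 * q 0,
     p 2 * q 0, p 1 * p 2 * q 0 * q 1, if mvar 0 1 \<in> I then p 1 * q 2 else p 0 * q 1, p 0 * q 2,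
     p 0 * p 1 * q 1 * q 2] ! v)"

text \<open>
  The coefficients of the brackets between the seeds, for those first arguments whose seed divides
  the denominator: for \<open>u = 0\<close> and \<open>u = 1\<close>, for \<open>u = 2\<close> if \<open>x 1 0 \<notin> I\<close>, and for \<open>u = 5\<close> if \<open>x 0 1 \<notin> I\<close>.
\<close>

definition seed_bracket :: "'k :: comm_ring_1 mat3_poly set \<Rightarrow> nat \<Rightarrow> nat \<Rightarrow> int" where
  "seed_bracket I u v = (let a = (if mvar 1 0 \<in> I then 0 else 1); b = (if mvar 0 1 \<in> I then 0 else 1) in
     (if u = 0 then [0, 0, a, 1, 1, b, 1, 1]
      else if u = 1 then [0, 0, 1 - a, 1, 1, 1 - b, 1, 1]
      else if u = 2 then [- 1, 0, 0, 1, 0, 1 - b, 0, 1]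
      else [- 1, 0, 1 - a, 0, 1, 0, 1, 0]) ! v)"

lemma less_8_cases: "v < (8::nat) \<Longrightarrow> v = 0 \<or> v = 1 \<or> v = 2 \<or> v = 3 \<or> v = 4 \<or> v = 5 \<or> v = 6 \<or> v = 7"
  by auto

lemma seed_bracket_exact:
  "M3_bracket (mvar 0 0) (minor 0 1 0 1) = (0 :: 'k :: comm_ring_1 mat3_poly)"
    "M3_bracket (mvar 0 0) (minor 1 2 0 1) = (mvar 0 0 * minor 1 2 0 1 :: 'k mat3_poly)"
    "M3_bracket (mvar 0 0) (minor 0 1 1 2) = (mvar 0 0 * minor 0 1 1 2 :: 'k mat3_poly)"
    "M3_bracket (minor 0 1 0 1) (mvar 0 0) = (0 :: 'k mat3_poly)"
    "M3_bracket (minor 0 1 0 1) (minor 0 1 0 1) = (0 :: 'k mat3_poly)"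
    "M3_bracket (minor 0 1 0 1) (mvar 1 0) = (0 :: 'k mat3_poly)"
    "M3_bracket (minor 0 1 0 1) (mvar 0 1) = (0 :: 'k mat3_poly)"
    "M3_bracket (minor 0 1 0 1) (mvar 2 1) = (minor 0 1 0 1 * mvar 2 1 :: 'k mat3_poly)"
    "M3_bracket (minor 0 1 0 1) (mvar 1 2) = (minor 0 1 0 1 * mvar 1 2 :: 'k mat3_poly)"
    "M3_bracket (minor 0 1 0 1) (mvar 2 0) = (minor 0 1 0 1 * mvar 2 0 :: 'k mat3_poly)"
    "M3_bracket (minor 0 1 0 1) (mvar 0 2) = (minor 0 1 0 1 * mvar 0 2 :: 'k mat3_poly)"
    "M3_bracket (minor 0 1 0 1) (minor 1 2 0 1) = (minor 0 1 0 1 * minor 1 2 0 1 :: 'k mat3_poly)"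
    "M3_bracket (minor 0 1 0 1) (minor 0 1 1 2) = (minor 0 1 0 1 * minor 0 1 1 2 :: 'k mat3_poly)"
    "M3_bracket (mvar 1 0) (minor 0 1 0 1) = (0 :: 'k mat3_poly)"
    "M3_bracket (mvar 1 0) (minor 1 2 0 1) = (0 :: 'k mat3_poly)"
    "M3_bracket (mvar 1 0) (minor 0 1 1 2) = (mvar 1 0 * minor 0 1 1 2 :: 'k mat3_poly)"
    "M3_bracket (mvar 0 1) (minor 0 1 0 1) = (0 :: 'k mat3_poly)"
    "M3_bracket (mvar 0 1) (minor 1 2 0 1) = (mvar 0 1 * minor 1 2 0 1 :: 'k mat3_poly)"
    "M3_bracket (mvar 0 1) (minor 0 1 1 2) = (0 :: 'k mat3_poly)"
  by (simp_all add: minor_def M3_bracket_diff M3_bracket_mult_left M3_bracket_mult_right M3_bracket_mvar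
      order_sign_num3 algebra_simps)

lemma seed_bracket_mem:
  fixes I :: "'k :: field_char_0 mat3_poly set"
  assumes I: "hprime I" and v: "v < 8"
    and u: "u = 0 \<or> u = 1 \<or> u = 2 \<and> mvar 1 0 \<notin> I \<or> u = 5 \<and> mvar 0 1 \<notin> I"
  shows "M3_bracket (seed I u) (seed I v) - of_int (seed_bracket I u v) * seed I u * seed I v \<in> I"
proof -
  note i = hprimeD(2) [OF I]
  \<comment> \<open>Brackets of entries in diagonal position have the required form only because these products lie in \<open>I\<close>.\<close>
  have 1: "2 * (mvar 0 1 * mvar 2 0) \<in> I" if "mvar 1 0 \<in> I"
    using subdiagonal_mem(1) [OF I that] by (intro ideal_setD(3) [OF i])
  have 2: "2 * (mvar 0 2 * mvar 1 0) \<in> I" if "mvar 0 1 \<in> I"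
    using subdiagonal_mem(3) [OF I that] by (intro ideal_setD(3) [OF i] ideal_setD(4) [OF i])
  show ?thesis
    using u less_8_cases [OF v]
    by (elim disjE conjE; hypsubst; cases "mvar 1 0 \<in> I"; cases "mvar 0 1 \<in> I";
        simp add: seed_def seed_bracket_def seed_bracket_exact M3_bracket_mvar order_sign_num3 ideal_setD(1) [OF i]
          1 2 mult.assoc)
qed

lemma seed_weight: "v < 8 \<Longrightarrow> weight (seed_weight I v) (seed I v)"
proof -
  assume "v < 8"
  have m: "weight (\<lambda>h. case h of (p, q) \<Rightarrow> p i * q j) (mvar i j)"
    "weight (\<lambda>h. case h of (p, q) \<Rightarrow> p i * p l * q j * q m) (minor i l j m)" for i j l m
    using weight_mvar [of i j] weight_minor [of i l j m] by (simp_all add: case_prod_beta)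
  show ?thesis
    using less_8_cases [OF \<open>v < 8\<close>]
    by (elim disjE; hypsubst; cases "mvar 1 0 \<in> I"; cases "mvar 0 1 \<in> I";
        simp add: seed_def seed_weight_def [abs_def] m)
qed

text \<open>
  As \<open>2\<close> has infinite order, comparing characters on these elements is the same as comparing integer
  exponents.
\<close>

definition power_torus :: "(3 \<Rightarrow> int) \<Rightarrow> (3 \<Rightarrow> int) \<Rightarrow> (3 \<Rightarrow> 'k :: field_char_0) \<times> (3 \<Rightarrow> 'k)" where
  "power_torus p q = ((\<lambda>i. 2 powi p i), (\<lambda>j. 2 powi q j))"

lemma power_torus_in_torus: "p 0 + p 1 + p 2 + (q 0 + q 1 + q 2) = 0 \<Longrightarrow> power_torus p q \<in> torus"
proof -
  assume s: "p 0 + p 1 + p 2 + (q 0 + q 1 + q 2) = 0"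
  have 3: "(3::3) = 0" by simp
  have "(\<Prod>i\<in>UNIV. 2 powi p i) * (\<Prod>j\<in>UNIV. 2 powi q j :: 'a) = 2 powi (p 0 + p 1 + p 2 + (q 0 + q 1 + q 2))"
    unfolding UNIV_3 3 by (simp add: num3_neq power_int_add ac_simps)
  then show ?thesis unfolding s by (simp add: power_torus_def torus_def)
qed

lemma seed_weight_power_torus: "v < 8 \<Longrightarrow> seed_weight I v (power_torus p q) = (2 :: 'k :: field_char_0) powi seed_degree I p q v"
proof -
  assume "v < 8"
  from less_8_cases [OF this] show ?thesis
    by (elim disjE; simp add: seed_weight_def seed_degree_def power_torus_def power_int_add)
qed

lemma two_powi_inject: "(2 :: 'k :: field_char_0) powi a = 2 powi b \<Longrightarrow> a = b"
proof -
  have pos: "a \<le> b" if "(2 :: 'k) powi a = 2 powi b" for a b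
  proof (rule ccontr)
    assume "\<not> a \<le> b"
    then obtain n where n: "a = b + int n" "n \<noteq> 0" using zle_iff_zadd [of b a] by (metis add.right_neutral nle_le of_nat_0)
    have "(2 :: 'k) ^ n = 1" using that by (simp add: n(1) power_int_add)
    then have "of_nat (2 ^ n) = (of_nat 1 :: 'k)" by simp
    then have "(2::nat) ^ n = 1" by (simp only: of_nat_eq_iff)
    with n(2) show False by simp
  qed
  assume "(2 :: 'k) powi a = 2 powi b"
  from pos [OF this] pos [OF this [symmetric]] show "a = b" by simp
qed

lemma prod_two_powi: "finite V \<Longrightarrow> (\<Prod>v\<in>V. (2 powi r v) ^ a v) = (2 :: 'k :: field_char_0) powi (\<Sum>v\<in>V. r v * int (a v))"
  by (induct V rule: finite_induct) (simp_all add: power_int_add power_int_mult)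

lemma sum_less_8: "(\<Sum>v<(8::nat). g v) = g 0 + g 1 + g 2 + g 3 + g 4 + g 5 + g 6 + (g 7 :: int)"
  by (simp add: eval_nat_numeral lessThan_Suc ac_simps)

text \<open>
  A system of linear equations for the differences of exponents: four from one-parameter subgroups
  that act on the rows only or on the columns only, and two to four from the brackets. One bracket
  is missing if \<open>x 1 0 \<in> I\<close>, but then the seeds \<open>3\<close> and \<open>4\<close> lie in \<open>I\<close>; likewise for \<open>x 0 1 \<in> I\<close> and the
  seeds \<open>6\<close> and \<open>7\<close>.
\<close>

lemma seed_monomials_separated:
  fixes I :: "'k :: field_char_0 mat3_poly set" and a b :: "nat \<Rightarrow> nat"
  defines "V \<equiv> {v. v < 8 \<and> seed I v \<notin> I}"
  assumes I: "hprime I" and ab: "\<And>v. v \<notin> V \<Longrightarrow> a v = 0 \<and> b v = 0"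
    and torus: "\<And>p q. p 0 + p 1 + p 2 + (q 0 + q 1 + q 2) = 0 \<Longrightarrow>
      (\<Sum>v\<in>V. seed_degree I p q v * int (a v)) = (\<Sum>v\<in>V. seed_degree I p q v * int (b v))"
    and bracket: "\<And>u. u = 0 \<or> u = 1 \<or> u = 2 \<and> mvar 1 0 \<notin> I \<or> u = 5 \<and> mvar 0 1 \<notin> I \<Longrightarrow>
      (\<Sum>v\<in>V. seed_bracket I u v * int (a v)) = (\<Sum>v\<in>V. seed_bracket I u v * int (b v))"
  shows "a = b"
proof -
  have V: "V \<subseteq> {..<8}" by (auto simp: V_def)
  have full: "(\<Sum>v\<in>V. g v * int (e v)) = (\<Sum>v<8. g v * int (e v))" if "e = a \<or> e = b" for g e
    using that ab by (intro sum.mono_neutral_left) (auto simp: V_def)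
  have T: "(\<Sum>v<8. seed_degree I p q v * int (a v)) = (\<Sum>v<8. seed_degree I p q v * int (b v))"
    if "p 0 + p 1 + p 2 + (q 0 + q 1 + q 2) = 0" for p q
    using torus [OF that] by (simp add: full)
  note T1 = T [of "\<lambda>i. if i = 0 then 1 else if i = 1 then - 1 else 0" "\<lambda>_. 0"]
  note T2 = T [of "\<lambda>i. if i = 1 then 1 else if i = 2 then - 1 else 0" "\<lambda>_. 0"]
  note T3 = T [of "\<lambda>_. 0" "\<lambda>i. if i = 0 then 1 else if i = 1 then - 1 else 0"]
  note T4 = T [of "\<lambda>_. 0" "\<lambda>i. if i = 1 then 1 else if i = 2 then - 1 else 0"]
  have B: "(\<Sum>v<8. seed_bracket I u v * int (a v)) = (\<Sum>v<8. seed_bracket I u v * int (b v))"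
    if "u = (0 :: nat) \<or> u = 1 \<or> u = 2 \<and> mvar 1 0 \<notin> I \<or> u = 5 \<and> mvar 0 1 \<notin> I" for u
    using bracket [OF that] by (simp add: full)
  have lower: "a 3 = 0 \<and> b 3 = 0 \<and> a 4 = 0 \<and> b 4 = 0" if "mvar 1 0 \<in> I"
    using subdiagonal_mem(1) [OF I that] corner_minor_mem(1) [OF I] that
    by (intro conjI) (use ab in \<open>auto simp: V_def seed_def\<close>)
  have upper: "a 6 = 0 \<and> b 6 = 0 \<and> a 7 = 0 \<and> b 7 = 0" if "mvar 0 1 \<in> I"
    using subdiagonal_mem(3) [OF I that] corner_minor_mem(2) [OF I] that
    by (intro conjI) (use ab in \<open>auto simp: V_def seed_def\<close>)
  note defs = sum_less_8 seed_degree_def seed_bracket_def num3_neq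
  have "a 0 = b 0 \<and> a (Suc 0) = b (Suc 0) \<and> a 2 = b 2 \<and> a 3 = b 3 \<and> a 4 = b 4 \<and> a 5 = b 5 \<and> a 6 = b 6 \<and> a 7 = b 7"
  proof (cases "mvar 1 0 \<in> I"; cases "mvar 0 1 \<in> I")
    assume c: "mvar 1 0 \<in> I" "mvar 0 1 \<in> I"
    note e = T1 T2 T3 T4 B [of 0] B [of 1]
    note e = e [simplified defs c, simplified]
    show ?thesis by (insert lower [OF c(1)] upper [OF c(2)] e, (intro conjI; linarith))
  next
    assume c: "mvar 1 0 \<in> I" "mvar 0 1 \<notin> I"
    note e = T1 T2 T3 T4 B [of 0] B [of 1] B [of 5]
    note e = e [simplified defs c, simplified]
    show ?thesis by (insert lower [OF c(1)] e, (intro conjI; linarith))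
  next
    assume c: "mvar 1 0 \<notin> I" "mvar 0 1 \<in> I"
    note e = T1 T2 T3 T4 B [of 0] B [of 1] B [of 2]
    note e = e [simplified defs c, simplified]
    show ?thesis by (insert upper [OF c(2)] e, (intro conjI; linarith))
  next
    assume c: "mvar 1 0 \<notin> I" "mvar 0 1 \<notin> I"
    note e = T1 T2 T3 T4 B [of 0] B [of 1] B [of 2] B [of 5]
    note e = e [simplified defs c, simplified]
    show ?thesis by (insert e, (intro conjI; linarith))
  qed
  then have "a v = b v" if "v < 8" for v using less_8_cases [OF that] by auto
  moreover have "a v = b v" if "\<not> v < 8" for v using that ab [of v] by (auto simp: V_def)
  ultimately show ?thesis by blast
qed

lemma seeds_independent:
  fixes I :: "'k :: field_char_0 mat3_poly set"
  defines "V \<equiv> {v. v < 8 \<and> seed I v \<notin> I}"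
  assumes I: "hprime I" and G: "G \<in> polys_in V" "psubst const_poly (seed I) G \<in> I"
  shows "G = 0"
proof -
  let ?H = "{power_torus p q | p q. p 0 + p 1 + p 2 + (q 0 + q 1 + q 2) = 0} :: ((3 \<Rightarrow> 'k) \<times> (3 \<Rightarrow> 'k)) set"
  let ?U = "{u \<in> V. u = 0 \<or> u = 1 \<or> u = 2 \<and> mvar 1 0 \<notin> I \<or> u = 5 \<and> mvar 0 1 \<notin> I}"
  have fin: "finite V" by (simp add: V_def)
  have UV: "u \<in> V" if "u = (0 :: nat) \<or> u = 1 \<or> u = 2 \<and> mvar 1 0 \<notin> I \<or> u = 5 \<and> mvar 0 1 \<notin> I" for u
    using that corner_notin [OF I] leading_minor_notin [OF I] by (auto simp: V_def seed_def)
  show ?thesis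
  proof (rule independent_mod_hprime [OF I fin _ _ _ _ _ _ G, where w = "seed_weight I" and H = ?H and U = ?U
        and c = "seed_bracket I"])
    show "weight (seed_weight I v) (seed I v)" if "v \<in> V" for v
      using that by (intro seed_weight) (simp add: V_def)
    show "seed I v \<notin> I" if "v \<in> V" for v using that by (simp add: V_def)
    show "?H \<subseteq> torus" using power_torus_in_torus by blast
    show "M3_bracket (seed I u) (seed I v) - of_int (seed_bracket I u v) * seed I u * seed I v \<in> I"
      if "u \<in> ?U" "v \<in> V" for u v
      using that by (intro seed_bracket_mem [OF I]) (auto simp: V_def)
    show "?U \<subseteq> V" by blast
    fix a b :: "nat \<Rightarrow> nat"
    assume ab: "\<And>v. v \<notin> V \<Longrightarrow> a v = 0 \<and> b v = 0"
      and t: "\<And>h. h \<in> ?H \<Longrightarrow> (\<Prod>v\<in>V. seed_weight I v h ^ a v) = (\<Prod>v\<in>V. seed_weight I v h ^ b v)"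
      and br: "\<And>u. u \<in> ?U \<Longrightarrow> (\<Sum>v\<in>V. seed_bracket I u v * int (a v)) = (\<Sum>v\<in>V. seed_bracket I u v * int (b v))"
    show "a = b"
    proof (rule seed_monomials_separated [OF I, folded V_def, OF ab])
      fix p q :: "3 \<Rightarrow> int" assume pq: "p 0 + p 1 + p 2 + (q 0 + q 1 + q 2) = 0"
      have w: "(\<Prod>v\<in>V. seed_weight I v (power_torus p q) ^ e v) =
          (2 :: 'k) powi (\<Sum>v\<in>V. seed_degree I p q v * int (e v))" for e :: "nat \<Rightarrow> nat"
        unfolding prod_two_powi [OF fin, symmetric]
        by (intro prod.cong refl) (simp add: V_def seed_weight_power_torus)
      show "(\<Sum>v\<in>V. seed_degree I p q v * int (a v)) = (\<Sum>v\<in>V. seed_degree I p q v * int (b v))"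
        using t [of "power_torus p q"] pq unfolding w by (intro two_powi_inject) blast
    next
      fix u :: nat assume "u = 0 \<or> u = 1 \<or> u = 2 \<and> mvar 1 0 \<notin> I \<or> u = 5 \<and> mvar 0 1 \<notin> I"
      then show "(\<Sum>v\<in>V. seed_bracket I u v * int (a v)) = (\<Sum>v\<in>V. seed_bracket I u v * int (b v))"
        using UV by (intro br) blast
    qed
  qed
qed

lemma corner_ideal_subset: "hprime I \<Longrightarrow> corner_ideal I \<subseteq> I"
  unfolding corner_ideal_def using hprimeD(2) poisson_stableD(2) [OF hprimeD(1)] by (intro ideal_gen_least) auto

lemma corner_idealI:
  "Det - 1 \<in> corner_ideal I" "g \<in> corner_elements \<Longrightarrow> g \<in> I \<Longrightarrow> g \<in> corner_ideal I"
  unfolding corner_ideal_def by (auto intro: ideal_gen_base)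

lemma psubst_image_subring: "subring_set (psubst const_poly y ` polys_in V)"
  unfolding subring_set_def
proof (intro conjI ballI)
  show "1 \<in> psubst const_poly y ` polys_in V"
    using subring_setD(1) [OF polys_in_subring] by (intro rev_image_eqI [of 1]) simp_all
  fix a b assume "a \<in> psubst const_poly y ` polys_in V" "b \<in> psubst const_poly y ` polys_in V"
  then obtain f g where fg: "f \<in> polys_in V" "a = psubst const_poly y f" "g \<in> polys_in V" "b = psubst const_poly y g"
    by blast
  show "a - b \<in> psubst const_poly y ` polys_in V"
    using subring_setD(3) [OF polys_in_subring fg(1,3)] by (rule rev_image_eqI) (simp add: fg const.psubst_diff)
  show "a * b \<in> psubst const_poly y ` polys_in V"
    using subring_setD(4) [OF polys_in_subring fg(1,3)] by (rule rev_image_eqI) (simp add: fg const.psubst_mult)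
qed

lemma psubst_image_mem:
  "v \<in> V \<Longrightarrow> y v \<in> psubst const_poly y ` polys_in V" "const_poly c \<in> psubst const_poly y ` polys_in V"
  by (rule rev_image_eqI [OF var_in_polys_in], simp, simp)
    (rule rev_image_eqI [OF coeff_in_polys_in], simp)

text \<open>
  Every entry of the matrix is polynomial in the seeds outside \<open>I\<close>, up to the denominator and modulo
  the corner ideal: solve \<open>[0 1|0 1]\<close> for \<open>x 1 1\<close>, the corner minors for \<open>x 2 1\<close> and \<open>x 1 2\<close>, and \<open>Det = 1\<close>
  for \<open>x 2 2\<close>. So \<open>g\<close> becomes a polynomial in these seeds, and as it lies in \<open>I\<close>, this polynomial is
  zero by independence.
\<close>

theorem hprime_corner_ideal:
  fixes I :: "'k :: field_char_0 mat3_poly set"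
  assumes I: "hprime I" and g: "g \<in> I"
  shows "\<exists>n. chart_denominator I ^ n * g \<in> corner_ideal I"
proof -
  define V where "V = {v. v < 8 \<and> seed I v \<notin> I}"
  define S where "S = psubst const_poly (seed I) ` polys_in V"
  have Qi: "ideal_set (corner_ideal I)" unfolding corner_ideal_def by (rule ideal_gen_ideal)
  have S: "subring_set S" unfolding S_def by (rule psubst_image_subring)
  have seedS: "seed I v \<in> S" if "v < 8" "seed I v \<notin> I" for v
    using that unfolding S_def by (intro psubst_image_mem) (simp add: V_def)
  have s00: "mvar 0 0 \<in> S" using seedS [of 0] corner_notin [OF I] by (simp add: seed_def)
  have sD: "minor 0 1 0 1 \<in> S" using seedS [of 1] leading_minor_notin [OF I] by (simp add: seed_def)
  have s10: "mvar 1 0 \<in> S" if "mvar 1 0 \<notin> I" using seedS [of 2] that by (simp add: seed_def)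
  have s01: "mvar 0 1 \<in> S" if "mvar 0 1 \<notin> I" using seedS [of 5] that by (simp add: seed_def)
  have fS: "chart_denominator I \<in> S"
    unfolding chart_denominator_def using s00 sD s10 s01 subring_setD(1,4) [OF S] by simp
  interpret clearing "corner_ideal I" S "chart_denominator I"
  proof
    show "const_poly c \<in> S" for c unfolding S_def by (rule psubst_image_mem)
    show "\<exists>s\<in>S. chart_denominator I - s \<in> corner_ideal I"
      using fS ideal_setD(1) [OF Qi] by (intro bexI [of _ "chart_denominator I"]) simp_all
  qed (fact Qi S)+
  have corner: "clearable x" if "x \<in> corner_elements" "x \<notin> I \<Longrightarrow> x \<in> S" for x
    using that clearable_mem clearable_ideal corner_idealI(2) by blast
  have m10: "clearable (mvar 1 0)" and m01: "clearable (mvar 0 1)"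
    using s10 s01 by (auto intro!: corner simp: corner_elements_def)
  have m20: "clearable (mvar 2 0)" using seedS [of 3] by (intro corner) (auto simp: corner_elements_def seed_def)
  have m02: "clearable (mvar 0 2)" using seedS [of 6] by (intro corner) (auto simp: corner_elements_def seed_def)
  have M: "clearable (minor 1 2 0 1)" using seedS [of 4] by (intro corner) (auto simp: corner_elements_def seed_def)
  have M': "clearable (minor 0 1 1 2)" using seedS [of 7] by (intro corner) (auto simp: corner_elements_def seed_def)
  note m00 = clearable_mem [OF s00] and D = clearable_mem [OF sD]
  let ?r = "(if mvar 1 0 \<in> I then 1 else mvar 1 0) :: 'k mat3_poly" and ?c = "(if mvar 0 1 \<in> I then 1 else mvar 0 1) :: 'k mat3_poly"
  have rc: "clearable ?r" "clearable ?c" using m10 m01 clearable_1 by simp_all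
  have m11: "clearable (mvar 1 1)"
  proof (rule clearable_divide)
    show "clearable (mvar 0 0 * mvar 1 1)"
      using clearable_add [OF D clearable_mult [OF m01 m10]] by (simp add: minor_def)
    show "clearable (minor 0 1 0 1 * (?r * ?c))" by (intro clearable_mult D rc)
  qed (simp add: chart_denominator_def)
  have m21: "clearable (mvar 2 1)"
  proof (cases "mvar 1 0 \<in> I")
    case True
    then show ?thesis using seedS [of 2] by (intro corner) (auto simp: corner_elements_def seed_def)
  next
    case False
    show ?thesis
    proof (rule clearable_divide)
      show "clearable (mvar 1 0 * mvar 2 1)"
        using clearable_add [OF M clearable_mult [OF m11 m20]] by (simp add: minor_def)
      show "clearable (mvar 0 0 * minor 0 1 0 1 * ?c)" by (intro clearable_mult D rc m00)
    qed (simp add: chart_denominator_def False)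
  qed
  have m12: "clearable (mvar 1 2)"
  proof (cases "mvar 0 1 \<in> I")
    case True
    then show ?thesis using seedS [of 5] by (intro corner) (auto simp: corner_elements_def seed_def)
  next
    case False
    show ?thesis
    proof (rule clearable_divide)
      show "clearable (mvar 0 1 * mvar 1 2)"
        using clearable_add [OF M' clearable_mult [OF m02 m11]] by (simp add: minor_def)
      show "clearable (mvar 0 0 * minor 0 1 0 1 * ?r)" by (intro clearable_mult D rc m00)
    qed (simp add: chart_denominator_def False)
  qed
  have m22: "clearable (mvar 2 2)"
  proof (rule clearable_divide)
    have eq: "minor 0 1 0 1 * mvar 2 2 = (Det - 1) + 1 - (mvar 0 1 * mvar 1 2 * mvar 2 0 + mvar 0 2 * mvar 1 0 * mvar 2 1
        - mvar 0 0 * mvar 1 2 * mvar 2 1 - mvar 0 2 * mvar 1 1 * mvar 2 0)"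
      by (simp add: minor_def Det_expand algebra_simps)
    show "clearable (minor 0 1 0 1 * mvar 2 2)"
      unfolding eq by (intro clearable_ring clearable_ideal corner_idealI(1) m00 m01 m02 m10 m11 m12 m20 m21)
    show "clearable (mvar 0 0 * (?r * ?c))" by (intro clearable_mult m00 rc)
  qed (simp add: chart_denominator_def)
  have "clearable (mvar i j)" for i j
    using num3_cases [of i] num3_cases [of j] m00 m01 m02 m10 m11 m12 m20 m21 m22 by auto
  then have "clearable g" by (rule clearable_all)
  then obtain n G where G: "G \<in> polys_in V" "chart_denominator I ^ n * g - psubst const_poly (seed I) G \<in> corner_ideal I"
    unfolding clearable_def unfolding S_def by blast
  have "chart_denominator I ^ n * g - psubst const_poly (seed I) G \<in> I" using G(2) corner_ideal_subset [OF I] by blast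
  then have "psubst const_poly (seed I) G \<in> I"
    using ideal_set_cong [OF hprimeD(2) [OF I]] ideal_setD(3) [OF hprimeD(2) [OF I] g] by blast
  then have "G = 0" using seeds_independent [OF I] G(1) by (simp add: V_def)
  with G(2) show ?thesis by auto
qed


section \<open>Unique factorisation in subrings\<close>

definition divides_in :: "'a :: idom set \<Rightarrow> 'a \<Rightarrow> 'a \<Rightarrow> bool" where
  "divides_in A a b \<longleftrightarrow> (\<exists>c\<in>A. b = a * c)"

text \<open>
  Units are admitted, since in the applications it depends on \<open>I\<close> whether an element is prime or
  invertible, and both serve equally well as factors.
\<close>

definition prime_or_unit :: "'a :: idom set \<Rightarrow> 'a \<Rightarrow> bool" where
  "prime_or_unit A p \<longleftrightarrow>
     (\<forall>g\<in>A. \<forall>h\<in>A. divides_in A p (g * h) \<longrightarrow> divides_in A p g \<or> divides_in A p h)"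

definition ufd_set :: "'a :: idom set \<Rightarrow> bool" where
  "ufd_set A \<longleftrightarrow> subring_set A \<and>
     (\<forall>a\<in>A. a \<noteq> 0 \<longrightarrow> (\<exists>ps. set ps \<subseteq> {p\<in>A. p \<noteq> 0 \<and> prime_or_unit A p} \<and> a = prod_list ps))"

lemma divides_inI: "c \<in> A \<Longrightarrow> b = a * c \<Longrightarrow> divides_in A a b"
  by (auto simp: divides_in_def)

lemma prime_or_unitI_unit:
  assumes "subring_set A" "divides_in A u 1"
  shows "prime_or_unit A u"
proof -
  obtain c where c: "c \<in> A" "1 = u * c" using assms(2) by (auto simp: divides_in_def)
  have "divides_in A u g" if "g \<in> A" for g
    unfolding divides_in_def
  proof
    show "c * g \<in> A" using assms(1) c(1) that by (rule subring_setD(4))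
    show "g = u * (c * g)" by (simp add: mult.assoc [symmetric] c(2) [symmetric])
  qed
  then show ?thesis by (auto simp: prime_or_unit_def)
qed

lemma divides_in_mult_unit:
  assumes "subring_set A" "u \<in> A" "v \<in> A" "u * v = 1"
  shows "divides_in A (u * q) g \<longleftrightarrow> divides_in A q g"
proof
  assume "divides_in A (u * q) g"
  then obtain c where "c \<in> A" "g = u * q * c" by (auto simp: divides_in_def)
  then show "divides_in A q g" using assms(1,2)
    by (auto simp: divides_in_def ac_simps intro!: bexI [of _ "u * c"] subring_setD)
next
  assume "divides_in A q g"
  then obtain c where c: "c \<in> A" "g = q * c" by (auto simp: divides_in_def)
  have "u * q * (v * c) = (u * v) * (q * c)" by (simp add: ac_simps)
  then have "g = u * q * (v * c)" by (simp add: assms(4) c(2))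
  then show "divides_in A (u * q) g" using assms(1,3) c(1)
    by (auto simp: divides_in_def intro: subring_setD)
qed

text \<open>
  If \<open>q\<close> divides the product of \<open>g\<close> with some primes, and only units among these divide \<open>q\<close>, then they
  can be stripped off one by one.
\<close>

lemma prime_or_unit_cancel_list:
  assumes A: "subring_set A" and P: "set ms \<subseteq> {p\<in>A. p \<noteq> 0 \<and> prime_or_unit A p}"
    and q: "q \<in> A" "\<And>p. p \<in> set ms \<Longrightarrow> divides_in A p q \<Longrightarrow> divides_in A p 1"
    and d: "d \<in> A" "prod_list ms * g = q * d" and g: "g \<in> A"
  shows "divides_in A q g"
  using P q(2) d
proof (induct ms arbitrary: d)
  case Nil
  then show ?case by (auto simp: divides_in_def)
next
  case (Cons p ms)
  have p: "p \<in> A" "p \<noteq> 0" "prime_or_unit A p" and ms: "set ms \<subseteq> A" using Cons.prems(1) by auto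
  have "prod_list ms * g \<in> A" using subring_set_prod_list [OF A ms] g A by (intro subring_setD)
  moreover have eq: "q * d = p * (prod_list ms * g)" using Cons.prems(4) by (simp add: mult.assoc)
  ultimately have "divides_in A p (q * d)" by (auto simp: divides_in_def)
  then have "divides_in A p q \<or> divides_in A p d" using p(3) q(1) Cons.prems(3) by (auto simp: prime_or_unit_def)
  then have "divides_in A p d"
  proof
    assume "divides_in A p q"
    then have "divides_in A p 1" by (intro Cons.prems(2)) simp_all
    then obtain c where c: "c \<in> A" "1 = p * c" by (auto simp: divides_in_def)
    then have "d = p * (c * d)" by (simp add: mult.assoc [symmetric])
    then show ?thesis by (rule divides_inI [OF subring_setD(4) [OF A c(1) Cons.prems(3)]])
  qed
  then obtain d' where d': "d' \<in> A" "d = p * d'" by (auto simp: divides_in_def)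
  have "p * (prod_list ms * g) = p * (q * d')" using eq unfolding d'(2) by (simp only: ac_simps)
  then have "prod_list ms * g = q * d'" using p(2) by (rule mult_left_cancel [THEN iffD1, rotated])
  with Cons d'(1) show ?case by auto
qed

text \<open>
  Nagata's theorem: \<open>A\<close> is factorial if its localisation \<open>B\<close> at the primes in \<open>P\<close> is. The chain
  condition on \<open>A\<close> is replaced by what is used of it, \<open>decomp\<close>: one can split off the primes in \<open>P\<close> from
  any element until none is left. For an element \<open>q\<close> without such prime factors, divisibility by \<open>q\<close>
  in \<open>A\<close> and in \<open>B\<close> agree, and hence \<open>q\<close> is prime in \<open>A\<close> if it is in \<open>B\<close>.
\<close>

lemma nagata:
  assumes A: "subring_set A" and B: "ufd_set B" and AB: "A \<subseteq> B"
    and P: "P \<subseteq> {p\<in>A. p \<noteq> 0 \<and> prime_or_unit A p}"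
    and inv: "\<And>p. p \<in> P \<Longrightarrow> \<exists>c\<in>B. p * c = 1"
    and denom: "\<And>b. b \<in> B \<Longrightarrow> \<exists>ms. set ms \<subseteq> P \<and> prod_list ms * b \<in> A"
    and decomp: "\<And>a. a \<in> A \<Longrightarrow> a \<noteq> 0 \<Longrightarrow> \<exists>ms q. set ms \<subseteq> P \<and> q \<in> A \<and>
      (\<forall>p\<in>P. divides_in A p q \<longrightarrow> divides_in A p 1) \<and> a = prod_list ms * q"
  shows "ufd_set A"
proof -
  define reduced where "reduced q \<longleftrightarrow> (\<forall>p\<in>P. divides_in A p q \<longrightarrow> divides_in A p 1)" for q
  have Bs: "subring_set B" using B by (simp add: ufd_set_def)
  have PA: "set ms \<subseteq> P \<Longrightarrow> prod_list ms \<in> A" for ms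
    using A P by (blast intro: subring_set_prod_list)
  have nz: "set ms \<subseteq> P \<Longrightarrow> prod_list ms \<noteq> 0" for ms
    using P by (auto simp: prod_list_zero_iff)
  have invl: "\<exists>c\<in>B. prod_list ms * c = 1" if "set ms \<subseteq> P" for ms
    using that
  proof (induct ms)
    case Nil
    then show ?case using subring_setD(1) [OF Bs] by auto
  next
    case (Cons p ms)
    then obtain c where "c \<in> B" "prod_list ms * c = 1" by auto
    moreover obtain d where "d \<in> B" "p * d = 1" using inv [of p] Cons.prems by auto
    ultimately have c: "c \<in> B" "prod_list ms * c = 1" "d \<in> B" "p * d = 1" .
    have "prod_list (p # ms) * (c * d) = (p * d) * (prod_list ms * c)" by (simp add: ac_simps)
    then have "prod_list (p # ms) * (c * d) = 1" by (simp only: c) simp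
    then show ?case using subring_setD(4) [OF Bs c(1,3)] by blast
  qed
  have cancel: "divides_in A q g"
    if q: "q \<in> A" "reduced q" and "g \<in> A" and dv: "divides_in B q g" for q g
  proof -
    obtain b where b: "b \<in> B" "g = q * b" using dv by (auto simp: divides_in_def)
    obtain ms where ms: "set ms \<subseteq> P" "prod_list ms * b \<in> A" using denom [OF b(1)] by blast
    show ?thesis
    proof (rule prime_or_unit_cancel_list [OF A _ q(1) _ ms(2) _ \<open>g \<in> A\<close>])
      show "prod_list ms * g = q * (prod_list ms * b)" by (simp add: b(2) ac_simps)
    qed (use ms(1) P q(2) in \<open>auto simp: reduced_def\<close>)
  qed
  have descend: "prime_or_unit A q" if q: "q \<in> A" "reduced q" "prime_or_unit B q" for q
    unfolding prime_or_unit_def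
  proof (intro ballI impI)
    fix g h assume gh: "g \<in> A" "h \<in> A" and "divides_in A q (g * h)"
    then have "divides_in B q (g * h)" using AB by (auto simp: divides_in_def)
    then have "divides_in B q g \<or> divides_in B q h" using q(3) gh AB by (auto simp: prime_or_unit_def)
    then show "divides_in A q g \<or> divides_in A q h" using cancel [OF q(1,2)] gh by blast
  qed
  have unit_part: "\<exists>u\<in>B. \<exists>v\<in>B. \<exists>q\<in>A. u * v = 1 \<and> reduced q \<and> b = u * q" if b: "b \<in> B" "b \<noteq> 0" for b
  proof -
    obtain ms where ms: "set ms \<subseteq> P" "prod_list ms * b \<in> A" using denom [OF b(1)] by blast
    then have "prod_list ms * b \<noteq> 0" using nz b(2) by simp
    then obtain ns q where q: "set ns \<subseteq> P" "q \<in> A" "reduced q" "prod_list ms * b = prod_list ns * q"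
      using decomp [OF ms(2)] unfolding reduced_def by blast
    obtain c where c: "c \<in> B" "prod_list ms * c = 1" using invl [OF ms(1)] by blast
    obtain d where d: "d \<in> B" "prod_list ns * d = 1" using invl [OF q(1)] by blast
    have "b = (prod_list ms * c) * b" by (simp add: c(2))
    also have "\<dots> = c * (prod_list ms * b)" by (simp add: ac_simps)
    finally have "b = (c * prod_list ns) * q" unfolding q(4) by (simp add: ac_simps)
    moreover have "(c * prod_list ns) * (prod_list ms * d) = (prod_list ms * c) * (prod_list ns * d)"
      by (simp add: ac_simps)
    then have "(c * prod_list ns) * (prod_list ms * d) = 1" by (simp only: c(2) d(2)) simp
    moreover have "c * prod_list ns \<in> B" "prod_list ms * d \<in> B"
      using c(1) d(1) PA [OF q(1)] PA [OF ms(1)] AB Bs by (auto intro: subring_setD)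
    ultimately show ?thesis using q(2,3) by blast
  qed
  have prod_part: "\<exists>u\<in>B. \<exists>v\<in>B. \<exists>qs. set qs \<subseteq> {q\<in>A. q \<noteq> 0 \<and> reduced q \<and> prime_or_unit B q} \<and>
      u * v = 1 \<and> prod_list bs = u * prod_list qs"
    if "set bs \<subseteq> {p\<in>B. p \<noteq> 0 \<and> prime_or_unit B p}" for bs
    using that
  proof (induct bs)
    case Nil
    show ?case
      by (rule bexI [of _ 1], rule bexI [of _ 1], rule exI [of _ "[]"]) (simp_all add: subring_setD(1) [OF Bs])
  next
    case (Cons b bs)
    then obtain u v qs where IH: "u \<in> B" "v \<in> B" "u * v = 1" "prod_list bs = u * prod_list qs"
      "set qs \<subseteq> {q\<in>A. q \<noteq> 0 \<and> reduced q \<and> prime_or_unit B q}" by auto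
    have b: "b \<in> B" "b \<noteq> 0" "prime_or_unit B b" using Cons.prems by auto
    then obtain w x q where q: "w \<in> B" "x \<in> B" "q \<in> A" "w * x = 1" "reduced q" "b = w * q"
      using unit_part by blast
    have "prime_or_unit B q"
      using b(3) unfolding q(6) prime_or_unit_def divides_in_mult_unit [OF Bs q(1,2,4)] .
    moreover have "q \<noteq> 0" using b(2) q(6) by auto
    moreover have "(u * w) * (v * x) = (u * v) * (w * x)" by (simp add: ac_simps)
    then have "(u * w) * (v * x) = 1" by (simp only: IH(3) q(4)) simp
    moreover have "prod_list (b # bs) = (u * w) * prod_list (q # qs)" by (simp add: IH(4) q(6) ac_simps)
    moreover have "u * w \<in> B" "v * x \<in> B" using IH(1,2) q(1,2) Bs by (auto intro: subring_setD)
    ultimately show ?case using IH(5) q(3,5)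
      by (intro bexI [of _ "u * w"] bexI [of _ "v * x"] exI [of _ "q # qs"]) auto
  qed
  have reduced_prod: "reduced (prod_list qs)" if "set qs \<subseteq> {q\<in>A. reduced q}" for qs
    using that
  proof (induct qs)
    case (Cons q qs)
    show ?case
      unfolding reduced_def
    proof (intro ballI impI)
      fix p assume p: "p \<in> P" "divides_in A p (prod_list (q # qs))"
      have "q \<in> A" "prod_list qs \<in> A" using Cons.prems A by (auto intro: subring_set_prod_list)
      moreover have "prime_or_unit A p" using p(1) P by blast
      ultimately have "divides_in A p q \<or> divides_in A p (prod_list qs)"
        using p(2) by (auto simp: prime_or_unit_def)
      with Cons p(1) show "divides_in A p 1" by (auto simp: reduced_def)
    qed
  qed (simp add: reduced_def)
  show ?thesis
    unfolding ufd_set_def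
  proof (intro conjI A ballI impI)
    fix a assume a: "a \<in> A" "a \<noteq> 0"
    then obtain bs where "set bs \<subseteq> {p\<in>B. p \<noteq> 0 \<and> prime_or_unit B p}" "a = prod_list bs"
      using B AB unfolding ufd_set_def by (meson subsetD)
    then obtain u v qs where u: "u \<in> B" "v \<in> B" "u * v = 1" "a = u * prod_list qs"
      and qs: "set qs \<subseteq> {q\<in>A. q \<noteq> 0 \<and> reduced q \<and> prime_or_unit B q}"
      using prod_part by blast
    define b where "b = prod_list qs"
    have b: "b \<in> A" "reduced b" "b \<noteq> 0"
      using qs A unfolding b_def by (auto intro!: reduced_prod subring_set_prod_list simp: prod_list_zero_iff)
    have "divides_in B b a" using u(1,4) by (auto simp: divides_in_def b_def mult.commute)
    then obtain d where d: "d \<in> A" "a = b * d" using cancel [OF b(1,2) a(1)] by (auto simp: divides_in_def)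
    have "d = u" using d(2) u(4) b(3) by (simp add: b_def [symmetric] mult.commute)
    then have dv: "d * v = 1" "d \<noteq> 0" using u(3) by auto
    obtain ms e where e: "set ms \<subseteq> P" "e \<in> A" "reduced e" "d = prod_list ms * e"
      using decomp [OF d(1) dv(2)] unfolding reduced_def by blast
    have "e * (prod_list ms * v) = 1" using dv(1) e(4) by (simp add: ac_simps)
    moreover have "prod_list ms * v \<in> B" using PA [OF e(1)] u(2) AB Bs by (auto intro: subring_setD)
    ultimately have "divides_in B e 1" by (metis divides_in_def)
    then have "divides_in A e 1" using cancel [OF e(2,3)] subring_setD(1) [OF A] by blast
    then have "prime_or_unit A e" using A by (rule prime_or_unitI_unit [rotated])
    moreover have "set qs \<subseteq> {p\<in>A. p \<noteq> 0 \<and> prime_or_unit A p}" using qs descend by blast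
    moreover have "a = prod_list (e # ms @ qs)" unfolding d(2) e(4) b_def by (simp add: ac_simps)
    moreover have "e \<noteq> 0" using dv(2) e(4) by auto
    ultimately show "\<exists>ps. set ps \<subseteq> {p\<in>A. p \<noteq> 0 \<and> prime_or_unit A p} \<and> a = prod_list ps"
      using e(1,2) P by (intro exI [of _ "e # ms @ qs"]) auto
  qed
qed

subsection \<open>Localisation at one element\<close>

definition localisation :: "'a :: field set \<Rightarrow> 'a \<Rightarrow> 'a set" where
  "localisation A e = {x. \<exists>n. x * e ^ n \<in> A}"

lemma subset_localisation: "A \<subseteq> localisation A e"
  by (auto simp: localisation_def intro: exI [of _ 0])

lemma localisation_subring:
  assumes "subring_set A" "e \<in> A"
  shows "subring_set (localisation A e)"
  unfolding subring_set_def
proof (intro conjI ballI)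
  show "1 \<in> localisation A e" using subset_localisation subring_setD(1) [OF assms(1)] by blast
  fix x y assume "x \<in> localisation A e" "y \<in> localisation A e"
  then obtain m n where mn: "x * e ^ m \<in> A" "y * e ^ n \<in> A" by (auto simp: localisation_def)
  note e = subring_set_power [OF assms]
  have "(x * e ^ m) * e ^ n - (y * e ^ n) * e ^ m \<in> A" using mn e assms(1) by (blast intro: subring_setD(3,4))
  then have "(x - y) * e ^ (m + n) \<in> A" by (simp add: power_add algebra_simps)
  then show "x - y \<in> localisation A e" by (auto simp: localisation_def)
  have "(x * e ^ m) * (y * e ^ n) \<in> A" using assms(1) mn by (rule subring_setD(4))
  then have "(x * y) * e ^ (m + n) \<in> A" by (simp add: power_add algebra_simps)
  then show "x * y \<in> localisation A e" by (auto simp: localisation_def)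
qed

text \<open>
  Multiplying by a power of \<open>e\<close> brings a divisibility in the localisation back to \<open>A\<close>.
\<close>

lemma prime_or_unit_localisation:
  assumes A: "subring_set A" and e: "e \<in> A" "e \<noteq> 0" and p: "p \<in> A" "prime_or_unit A p"
  shows "prime_or_unit (localisation A e) p"
  unfolding prime_or_unit_def
proof (intro ballI impI)
  fix g h assume "g \<in> localisation A e" "h \<in> localisation A e" "divides_in (localisation A e) p (g * h)"
  then obtain c i j l where i: "g * e ^ i \<in> A" and j: "h * e ^ j \<in> A" and l: "c * e ^ l \<in> A"
    and c: "g * h = p * c"
    by (auto simp: divides_in_def localisation_def)
  have lift: "divides_in (localisation A e) p x" if "divides_in A p (x * e ^ n)" for x n
  proof -
    obtain d where d: "d \<in> A" "x * e ^ n = p * d" using \<open>divides_in A p (x * e ^ n)\<close> by (auto simp: divides_in_def)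
    have "x = p * (d / e ^ n)" using d(2) e(2) by (simp add: field_simps)
    moreover have "d / e ^ n \<in> localisation A e"
      using d(1) e(2) by (auto simp: localisation_def intro!: exI [of _ n])
    ultimately show ?thesis by (rule divides_inI [rotated])
  qed
  have "(g * e ^ i) * (h * e ^ (j + l)) = p * ((c * e ^ l) * e ^ (i + j))"
    using c by (simp add: power_add algebra_simps)
  moreover have "(c * e ^ l) * e ^ (i + j) \<in> A" using A l subring_set_power [OF A e(1)] by (rule subring_setD(4))
  ultimately have "divides_in A p ((g * e ^ i) * (h * e ^ (j + l)))" by (auto simp: divides_in_def)
  moreover have "h * e ^ (j + l) \<in> A"
    unfolding power_add mult.assoc [symmetric]
    by (rule subring_setD(4) [OF A j subring_set_power [OF A e(1)]])
  ultimately have "divides_in A p (g * e ^ i) \<or> divides_in A p (h * e ^ (j + l))"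
    using p(2) i by (auto simp: prime_or_unit_def)
  then show "divides_in (localisation A e) p g \<or> divides_in (localisation A e) p h" using lift by blast
qed

lemma ufd_set_localisation:
  assumes "ufd_set A" and e: "e \<in> A" "e \<noteq> 0"
  shows "ufd_set (localisation A e)"
  unfolding ufd_set_def
proof (intro conjI ballI impI)
  let ?L = "localisation A e"
  have A: "subring_set A" using assms(1) by (simp add: ufd_set_def)
  show L: "subring_set ?L" using A e(1) by (rule localisation_subring)
  fix x assume "x \<in> ?L" "x \<noteq> 0"
  then obtain n where "x * e ^ n \<in> A" "x * e ^ n \<noteq> 0" using e(2) by (auto simp: localisation_def)
  then obtain ps where ps: "set ps \<subseteq> {p\<in>A. p \<noteq> 0 \<and> prime_or_unit A p}" "x * e ^ n = prod_list ps"
    using assms(1) unfolding ufd_set_def by blast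
  have en: "e ^ n \<in> ?L" using subset_localisation subring_set_power [OF A e(1)] by blast
  have en': "1 / e ^ n \<in> ?L"
    using subring_setD(1) [OF A] e(2) by (auto simp: localisation_def intro!: exI [of _ n])
  from en en' have en: "e ^ n \<in> ?L" "1 / e ^ n \<in> ?L" .
  then have "divides_in ?L (1 / e ^ n) 1" using e(2) by (auto simp: divides_in_def intro!: bexI [of _ "e ^ n"])
  then have "prime_or_unit ?L (1 / e ^ n)" using L by (rule prime_or_unitI_unit [rotated])
  moreover have "x = prod_list (1 / e ^ n # ps)" using ps(2) e(2) by (simp add: field_simps)
  moreover have "set ps \<subseteq> {p\<in>?L. p \<noteq> 0 \<and> prime_or_unit ?L p}"
    using ps(1) prime_or_unit_localisation [OF A e] subset_localisation [of A e] by blast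
  ultimately show "\<exists>ps. set ps \<subseteq> {p\<in>?L. p \<noteq> 0 \<and> prime_or_unit ?L p} \<and> x = prod_list ps"
    using en(2) e(2) by (intro exI [of _ "1 / e ^ n # ps"]) auto
qed


section \<open>Gauss's lemma\<close>

text \<open>
  A measure \<open>\<delta>\<close> that drops under proper division. It passes to polynomials, with the degree as
  further summand, and makes it possible to split off prime factors as in \<open>nagata\<close>.
\<close>

definition finite_divisors :: "'a :: idom set \<Rightarrow> bool" where
  "finite_divisors A \<longleftrightarrow> (\<exists>\<delta> :: 'a \<Rightarrow> nat. \<forall>a\<in>A. \<forall>p\<in>A. a \<noteq> 0 \<longrightarrow> p \<noteq> 0 \<longrightarrow>
     \<delta> a \<le> \<delta> (p * a) \<and> (\<delta> (p * a) = \<delta> a \<longrightarrow> divides_in A p 1))"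

lemma fractions_in_field:
  fixes S :: "'a :: field set"
  assumes "subring_set S"
  defines "F \<equiv> {x. \<exists>s\<in>S. s \<noteq> 0 \<and> x * s \<in> S}"
  shows "subring_set F" "S \<subseteq> F" "x \<in> F \<Longrightarrow> x \<noteq> 0 \<Longrightarrow> 1 / x \<in> F" "s \<in> S \<Longrightarrow> s \<noteq> 0 \<Longrightarrow> 1 / s \<in> F"
proof -
  note S = subring_setD [OF assms(1)]
  show SF: "S \<subseteq> F" using S(1) by (auto simp: F_def intro!: bexI [of _ 1])
  show "subring_set F"
    unfolding subring_set_def
  proof (intro conjI ballI)
    show "1 \<in> F" using SF S(1) by blast
    fix x y assume "x \<in> F" "y \<in> F"
    then obtain s t where st: "s \<in> S" "s \<noteq> 0" "x * s \<in> S" "t \<in> S" "t \<noteq> 0" "y * t \<in> S"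
      by (auto simp: F_def)
    have "(x * s) * t - (y * t) * s \<in> S" by (rule S(3) [OF S(4) [OF st(3,4)] S(4) [OF st(6,1)]])
    then have "(x - y) * (s * t) \<in> S" by (simp add: algebra_simps)
    then show "x - y \<in> F" using st(1,2,4,5) S(4) unfolding F_def by (intro CollectI bexI [of _ "s * t"]) auto
    have "(x * s) * (y * t) \<in> S" by (rule S(4) [OF st(3,6)])
    then have "(x * y) * (s * t) \<in> S" by (simp add: algebra_simps)
    then show "x * y \<in> F" using st(1,2,4,5) S(4) unfolding F_def by (intro CollectI bexI [of _ "s * t"]) auto
  qed
  show "1 / x \<in> F" if "x \<in> F" "x \<noteq> 0"
  proof -
    from that obtain s where "s \<in> S" "s \<noteq> 0" "x * s \<in> S" by (auto simp: F_def)
    with that(2) show ?thesis unfolding F_def by (intro CollectI bexI [of _ "x * s"]) auto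
  qed
  show "1 / s \<in> F" if "s \<in> S" "s \<noteq> 0"
    using that S(1) by (auto simp: F_def intro!: bexI [of _ s])
qed

definition coeffs_in :: "'a :: idom set \<Rightarrow> 'a poly set" where
  "coeffs_in F = {p. \<forall>i. coeff p i \<in> F}"

lemma coeffs_in_subring:
  assumes "subring_set F"
  shows "subring_set (coeffs_in F)"
  unfolding subring_set_def coeffs_in_def
  using subring_setD(1-3) [OF assms]
  by (auto simp: coeff_mult coeff_1 intro!: subring_set_sum [OF assms] subring_setD(4) [OF assms])

lemma monom_coeffs_in: "subring_set F \<Longrightarrow> a \<in> F \<Longrightarrow> monom a n \<in> coeffs_in F"
  by (auto simp: coeffs_in_def intro: subring_setD)

lemma coeffs_in_division:
  fixes a b :: "'a :: field poly"
  assumes F: "subring_set F" "\<And>x. x \<in> F \<Longrightarrow> x \<noteq> 0 \<Longrightarrow> 1 / x \<in> F"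
    and b: "b \<in> coeffs_in F" "b \<noteq> 0" and a: "a \<in> coeffs_in F"
  shows "\<exists>q\<in>coeffs_in F. \<exists>r\<in>coeffs_in F. a = b * q + r \<and> (r = 0 \<or> degree r < degree b)"
  using a
proof (induct "degree a" arbitrary: a rule: less_induct)
  case less
  note FP = subring_setD [OF coeffs_in_subring [OF F(1)]]
  show ?case
  proof (cases "a = 0 \<or> degree a < degree b")
    case True
    with FP(2) less.prems show ?thesis by (intro bexI [of _ 0] bexI [of _ a]) auto
  next
    case False
    define m where "m = monom (lead_coeff a * (1 / lead_coeff b)) (degree a - degree b)"
    have "1 / lead_coeff b \<in> F" using b by (intro F(2)) (auto simp: coeffs_in_def)
    then have m: "m \<in> coeffs_in F"
      unfolding m_def using less.prems F(1) by (intro monom_coeffs_in subring_setD(4)) (auto simp: coeffs_in_def)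
    define a' where "a' = a - b * m"
    have a': "a' \<in> coeffs_in F" unfolding a'_def using less.prems b(1) m by (intro FP)
    have mn: "m \<noteq> 0" using False b(2) by (simp add: m_def monom_eq_0_iff)
    have dm: "degree m = degree a - degree b" using False b(2) by (simp add: m_def degree_monom_eq)
    have bm: "degree (b * m) = degree a" using mn b(2) dm False by (simp add: degree_mult_eq)
    have "coeff (b * m) (degree a) = lead_coeff b * lead_coeff m"
      using lead_coeff_mult [of b m] bm by simp
    then have "coeff a' (degree a) = 0" using b(2) dm by (simp add: a'_def m_def)
    moreover have "degree a' \<le> degree a" unfolding a'_def using bm by (intro degree_diff_le) auto
    ultimately have "a' = 0 \<or> degree a' < degree a" by (metis eq_zero_or_degree_less)
    then have "\<exists>q\<in>coeffs_in F. \<exists>r\<in>coeffs_in F. a' = b * q + r \<and> (r = 0 \<or> degree r < degree b)"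
    proof
      assume "a' = 0"
      with FP(2) show ?thesis by (intro bexI [of _ 0]) auto
    qed (use less.hyps a' in blast)
    then obtain q r where qr: "q \<in> coeffs_in F" "r \<in> coeffs_in F" "a' = b * q + r" "r = 0 \<or> degree r < degree b"
      by blast
    have "a = b * (q + m) + r" using qr(3) by (simp add: a'_def algebra_simps)
    with qr(1,2,4) FP(6) [OF qr(1) m] show ?thesis by blast
  qed
qed

text \<open>
  Over a field \<open>F\<close>, by Bezout: the ideal generated by \<open>a\<close> and \<open>g\<close> consists of the multiples of its
  nonzero element \<open>d\<close> of least degree. As \<open>a\<close> is irreducible, either \<open>d\<close> is constant and \<open>a\<close> divides \<open>h\<close>, or
  \<open>a\<close> is a constant times \<open>d\<close> and divides \<open>g\<close>.
\<close>

lemma prime_or_unit_coeffs_in_irreducible: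
  fixes a :: "'a :: field poly"
  assumes F: "subring_set F" "\<And>x. x \<in> F \<Longrightarrow> x \<noteq> 0 \<Longrightarrow> 1 / x \<in> F"
    and a: "a \<in> coeffs_in F" "a \<noteq> 0"
    and irr: "\<And>b c. b \<in> coeffs_in F \<Longrightarrow> c \<in> coeffs_in F \<Longrightarrow> a = b * c \<Longrightarrow> degree b = 0 \<or> degree c = 0"
  shows "prime_or_unit (coeffs_in F) a"
  unfolding prime_or_unit_def
proof (intro ballI impI)
  note FPs = coeffs_in_subring [OF F(1)]
  note FP = subring_setD [OF FPs]
  fix g h assume g: "g \<in> coeffs_in F" and h: "h \<in> coeffs_in F" and gh: "divides_in (coeffs_in F) a (g * h)"
  have unit: "\<exists>c\<in>coeffs_in F. d * c = 1" if "d \<in> coeffs_in F" "d \<noteq> 0" "degree d = 0" for d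
  proof -
    obtain x where x: "d = [:x:]" using \<open>degree d = 0\<close> by (rule degree_eq_zeroE)
    have "x = coeff d 0" by (simp add: x)
    then have "x \<in> F" using that(1) by (auto simp: coeffs_in_def)
    moreover have "x \<noteq> 0" using that(2) x by auto
    ultimately have "[:1 / x:] \<in> coeffs_in F" "d * [:1 / x:] = 1"
      using F monom_coeffs_in [OF F(1), of "1 / x" 0] by (simp_all add: x monom_0 one_pCons)
    then show ?thesis by blast
  qed
  define T where "T = {d. \<exists>x\<in>coeffs_in F. \<exists>y\<in>coeffs_in F. d = a * x + g * y}"
  have "a \<in> T" unfolding T_def using FP(1,2) by (intro CollectI bexI [of _ 1] bexI [of _ 0]) auto
  then obtain d where d: "d \<in> T" "d \<noteq> 0" and min: "\<And>c. c \<in> T \<Longrightarrow> c \<noteq> 0 \<Longrightarrow> degree d \<le> degree c"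
    using ex_has_least_nat [of "\<lambda>d. d \<in> T \<and> d \<noteq> 0" a degree] a(2) by blast
  obtain x y where xy: "x \<in> coeffs_in F" "y \<in> coeffs_in F" "d = a * x + g * y" using d(1) by (auto simp: T_def)
  have dF: "d \<in> coeffs_in F" unfolding xy(3) using a(1) g xy(1,2) by (intro FP(4) FP(6))
  have div: "divides_in (coeffs_in F) d c" if c: "c \<in> T" for c
  proof -
    obtain u v where uv: "u \<in> coeffs_in F" "v \<in> coeffs_in F" "c = a * u + g * v" using c by (auto simp: T_def)
    have "c \<in> coeffs_in F" unfolding uv(3) using a(1) g uv(1,2) by (intro FP(4) FP(6))
    then obtain q r where qr: "q \<in> coeffs_in F" "c = d * q + r" "r = 0 \<or> degree r < degree d"
      using coeffs_in_division [OF F dF d(2)] by blast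
    have "r = a * (u - x * q) + g * (v - y * q)" using qr(2) uv(3) xy(3) by (simp add: algebra_simps)
    moreover have "u - x * q \<in> coeffs_in F" "v - y * q \<in> coeffs_in F" using uv(1,2) xy(1,2) qr(1) by (auto intro: FP)
    ultimately have "r \<in> T" by (auto simp: T_def)
    with min [of r] qr(3) have "r = 0" by (metis not_le)
    with qr(1,2) show ?thesis by (intro divides_inI [of q]) simp_all
  qed
  have "g \<in> T" unfolding T_def using FP(1,2) by (intro CollectI bexI [of _ 0] bexI [of _ 1]) auto
  then obtain e where e: "e \<in> coeffs_in F" "g = d * e" using div by (auto simp: divides_in_def)
  obtain f where f: "f \<in> coeffs_in F" "a = d * f" using div [OF \<open>a \<in> T\<close>] by (auto simp: divides_in_def)
  show "divides_in (coeffs_in F) a g \<or> divides_in (coeffs_in F) a h"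
  proof (cases "degree d = 0")
    case True
    then obtain c where c: "c \<in> coeffs_in F" "d * c = 1" using unit dF d(2) by blast
    obtain k where k: "k \<in> coeffs_in F" "g * h = a * k" using gh by (auto simp: divides_in_def)
    have "h = (d * c) * h" by (simp add: c(2))
    also have "\<dots> = a * (x * c * h) + (g * h) * (y * c)" by (simp add: xy(3) algebra_simps)
    also have "\<dots> = a * (x * c * h + k * y * c)" by (simp add: k(2) algebra_simps)
    finally have "divides_in (coeffs_in F) a h"
      using xy(1,2) c(1) h k(1) by (intro divides_inI [of "x * c * h + k * y * c"] FP(4) FP(6))
    then show ?thesis ..
  next
    case False
    then have "degree f = 0" using irr [OF dF f] by simp
    moreover have "f \<noteq> 0" using f(2) a(2) by auto
    ultimately obtain c where c: "c \<in> coeffs_in F" "f * c = 1" using unit f(1) by blast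
    have "a * (c * e) = (f * c) * (d * e)" unfolding f(2) by (simp only: ac_simps)
    then have "a * (c * e) = g" by (simp only: c(2) e(2) mult_1_left)
    from FP(4) [OF c(1) e(1)] this [symmetric] have "divides_in (coeffs_in F) a g" by (rule divides_inI)
    then show ?thesis ..
  qed
qed

lemma ufd_set_coeffs_in_field:
  fixes F :: "'a :: field set"
  assumes F: "subring_set F" "\<And>x. x \<in> F \<Longrightarrow> x \<noteq> 0 \<Longrightarrow> 1 / x \<in> F"
  shows "ufd_set (coeffs_in F)"
  unfolding ufd_set_def
proof (intro conjI ballI impI coeffs_in_subring F(1))
  fix a :: "'a poly" assume "a \<in> coeffs_in F" "a \<noteq> 0"
  then show "\<exists>ps. set ps \<subseteq> {p \<in> coeffs_in F. p \<noteq> 0 \<and> prime_or_unit (coeffs_in F) p} \<and> a = prod_list ps"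
  proof (induct "degree a" arbitrary: a rule: less_induct)
    case less
    show ?case
    proof (cases "\<exists>b\<in>coeffs_in F. \<exists>c\<in>coeffs_in F. a = b * c \<and> degree b \<noteq> 0 \<and> degree c \<noteq> 0")
      case True
      then obtain b c where bc: "b \<in> coeffs_in F" "c \<in> coeffs_in F" "a = b * c" "degree b \<noteq> 0" "degree c \<noteq> 0"
        by blast
      then have "b \<noteq> 0" "c \<noteq> 0" by auto
      moreover from this have "degree b < degree a" "degree c < degree a"
        using bc(3-5) by (auto simp: degree_mult_eq)
      ultimately obtain ps qs where
        "set ps \<subseteq> {p \<in> coeffs_in F. p \<noteq> 0 \<and> prime_or_unit (coeffs_in F) p}" "b = prod_list ps"
        "set qs \<subseteq> {p \<in> coeffs_in F. p \<noteq> 0 \<and> prime_or_unit (coeffs_in F) p}" "c = prod_list qs"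
        using less.hyps bc(1,2) by meson
      then show ?thesis by (intro exI [of _ "ps @ qs"]) (auto simp: bc(3))
    next
      case False
      then have "prime_or_unit (coeffs_in F) a"
        using less.prems F by (intro prime_or_unit_coeffs_in_irreducible) auto
      with less.prems show ?thesis by (intro exI [of _ "[a]"]) auto
    qed
  qed
qed

lemma ufd_set_image:
  assumes A: "ufd_set A" and inj: "inj_on \<phi> A"
    and hom: "\<phi> 1 = 1" "\<And>a b. a \<in> A \<Longrightarrow> b \<in> A \<Longrightarrow> \<phi> (a - b) = \<phi> a - \<phi> b"
      "\<And>a b. a \<in> A \<Longrightarrow> b \<in> A \<Longrightarrow> \<phi> (a * b) = \<phi> a * \<phi> b"
  shows "ufd_set (\<phi> ` A)"
  unfolding ufd_set_def
proof (intro conjI ballI impI)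
  have As: "subring_set A" using A by (simp add: ufd_set_def)
  note AD = subring_setD [OF As]
  show "subring_set (\<phi> ` A)"
    unfolding subring_set_def using AD(1,3,4) hom by (metis image_iff)
  have dvd: "divides_in (\<phi> ` A) (\<phi> a) (\<phi> b) \<longleftrightarrow> divides_in A a b" if "a \<in> A" "b \<in> A" for a b
    using that AD(4) hom(3) inj_onD [OF inj] by (auto simp: divides_in_def) metis+
  have pu: "prime_or_unit (\<phi> ` A) (\<phi> p)" if p: "p \<in> A" "prime_or_unit A p" for p
    unfolding prime_or_unit_def
  proof (intro ballI impI)
    fix x y assume "x \<in> \<phi> ` A" "y \<in> \<phi> ` A" and d: "divides_in (\<phi> ` A) (\<phi> p) (x * y)"
    then obtain g h where gh: "g \<in> A" "x = \<phi> g" "h \<in> A" "y = \<phi> h" by blast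
    then have "divides_in A p (g * h)" using d dvd [OF p(1) AD(4)] hom(3) by simp
    then show "divides_in (\<phi> ` A) (\<phi> p) x \<or> divides_in (\<phi> ` A) (\<phi> p) y"
      using p gh dvd by (auto simp: prime_or_unit_def)
  qed
  have zero: "\<phi> 0 = 0" using hom(2) [OF AD(1) AD(1)] by simp
  have prod: "prod_list (map \<phi> ps) = \<phi> (prod_list ps)" if "set ps \<subseteq> A" for ps
    using that by (induct ps) (auto simp: hom subring_set_prod_list [OF As])
  fix x assume "x \<in> \<phi> ` A" "x \<noteq> 0"
  then obtain a where a: "a \<in> A" "x = \<phi> a" "a \<noteq> 0" using zero by auto
  then obtain ps where ps: "set ps \<subseteq> {p\<in>A. p \<noteq> 0 \<and> prime_or_unit A p}" "a = prod_list ps"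
    using A by (auto simp: ufd_set_def)
  have nz: "\<phi> p \<noteq> 0" if "p \<in> A" "p \<noteq> 0" for p
    using that zero inj_onD [OF inj, of p 0] AD(2) by auto
  have "set (map \<phi> ps) \<subseteq> {p\<in>\<phi> ` A. p \<noteq> 0 \<and> prime_or_unit (\<phi> ` A) p}" using ps(1) pu nz by auto
  moreover have "x = prod_list (map \<phi> ps)"
  proof -
    have "set ps \<subseteq> A" using ps(1) by blast
    then show ?thesis unfolding a(2) ps(2) by (rule prod [symmetric])
  qed
  ultimately show "\<exists>ps. set ps \<subseteq> {p\<in>\<phi> ` A. p \<noteq> 0 \<and> prime_or_unit (\<phi> ` A) p} \<and> x = prod_list ps" by blast
qed

lemma divides_in_add: "subring_set A \<Longrightarrow> divides_in A p a \<Longrightarrow> divides_in A p b \<Longrightarrow> divides_in A p (a + b)"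
  by (auto simp: divides_in_def distrib_left [symmetric] intro: subring_setD)

lemma divides_in_diff: "subring_set A \<Longrightarrow> divides_in A p a \<Longrightarrow> divides_in A p b \<Longrightarrow> divides_in A p (a - b)"
  by (auto simp: divides_in_def right_diff_distrib [symmetric] intro: subring_setD)

lemma divides_in_mult: "subring_set A \<Longrightarrow> divides_in A p a \<Longrightarrow> b \<in> A \<Longrightarrow> divides_in A p (a * b)"
  by (auto simp: divides_in_def mult.assoc intro!: subring_setD(4) bexI)

lemma divides_in_sum: "subring_set A \<Longrightarrow> (\<And>i. i \<in> J \<Longrightarrow> divides_in A p (f i)) \<Longrightarrow> divides_in A p (sum f J)"
proof (induct J rule: infinite_finite_induct)
  case (insert j J)
  then show ?case by (simp add: divides_in_add)
qed (auto simp: divides_in_def intro!: bexI [of _ 0] subring_setD(2))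

text \<open>
  Take the first coefficient of \<open>f\<close> and the first coefficient of \<open>g\<close> not divisible by \<open>p\<close>, and compare
  coefficients of \<open>f * g\<close> at the sum of their indices.
\<close>

lemma prime_or_unit_coeffs:
  fixes f g :: "'a :: idom poly"
  assumes S: "subring_set S" and p: "p \<in> S" "prime_or_unit S p"
    and f: "f \<in> coeffs_in S" and g: "g \<in> coeffs_in S" and fg: "\<And>i. divides_in S p (coeff (f * g) i)"
  shows "(\<forall>i. divides_in S p (coeff f i)) \<or> (\<forall>i. divides_in S p (coeff g i))"
proof (rule ccontr)
  assume "\<not> ?thesis"
  then obtain i0 j0 where "\<not> divides_in S p (coeff f i0)" "\<not> divides_in S p (coeff g j0)" by blast
  then obtain i j where i: "\<not> divides_in S p (coeff f i)" "\<And>k. k < i \<Longrightarrow> divides_in S p (coeff f k)"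
    and j: "\<not> divides_in S p (coeff g j)" "\<And>k. k < j \<Longrightarrow> divides_in S p (coeff g k)"
    using exists_least_iff [of "\<lambda>i. \<not> divides_in S p (coeff f i)"]
      exists_least_iff [of "\<lambda>i. \<not> divides_in S p (coeff g i)"] by blast
  have fS: "coeff f k \<in> S" and gS: "coeff g k \<in> S" for k using f g by (auto simp: coeffs_in_def)
  let ?t = "\<lambda>k. coeff f k * coeff g (i + j - k)"
  have "coeff (f * g) (i + j) = ?t i + sum ?t ({..i + j} - {i})"
    unfolding coeff_mult by (intro sum.remove) auto
  then have "?t i = coeff (f * g) (i + j) - sum ?t ({..i + j} - {i})" by simp
  moreover have "divides_in S p (sum ?t ({..i + j} - {i}))"
  proof (rule divides_in_sum [OF S])
    fix k assume "k \<in> {..i + j} - {i}"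
    then consider "k < i" | "i + j - k < j" "k \<noteq> i" by force
    then show "divides_in S p (?t k)"
    proof cases
      case 1
      then show ?thesis using divides_in_mult [OF S i(2)] gS by blast
    next
      case 2
      then show ?thesis using divides_in_mult [OF S j(2)] fS by (metis mult.commute)
    qed
  qed
  ultimately have "divides_in S p (?t i)" using divides_in_diff [OF S fg] by simp
  then have "divides_in S p (coeff f i * coeff g j)" by simp
  with p(2) fS gS i(1) j(1) show False by (auto simp: prime_or_unit_def)
qed

lemma common_denominator:
  fixes f :: "'a :: field poly"
  assumes S: "subring_set S" and f: "\<forall>i. \<exists>s\<in>S. s \<noteq> 0 \<and> coeff f i * s \<in> S"
  shows "\<exists>s\<in>S. s \<noteq> 0 \<and> smult s f \<in> coeffs_in S"
  using f
proof (induct f)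
  case 0
  show ?case using subring_setD(1,2) [OF S] by (intro bexI [of _ 1]) (auto simp: coeffs_in_def)
next
  case (pCons a f)
  have "\<forall>i. \<exists>s\<in>S. s \<noteq> 0 \<and> coeff f i * s \<in> S" using spec [OF pCons.prems, of "Suc _"] by simp
  then obtain s where s: "s \<in> S" "s \<noteq> 0" "smult s f \<in> coeffs_in S" using pCons.hyps(2) by blast
  obtain t where t: "t \<in> S" "t \<noteq> 0" "a * t \<in> S" using spec [OF pCons.prems, of 0] by auto
  have "coeff (smult (s * t) (pCons a f)) i \<in> S" for i
  proof (cases i)
    case 0
    then have "coeff (smult (s * t) (pCons a f)) i = s * (a * t)" by simp
    with s(1) t(3) S show ?thesis by (simp add: subring_setD(4))
  next
    case (Suc k)
    then have "coeff (smult (s * t) (pCons a f)) i = coeff (smult s f) k * t" by simp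
    moreover have "coeff (smult s f) k \<in> S" using s(3) by (auto simp: coeffs_in_def)
    ultimately show ?thesis using t(1) S by (metis subring_setD(4))
  qed
  then show ?case using s(1,2) t(1,2) S by (intro bexI [of _ "s * t"]) (auto simp: coeffs_in_def intro: subring_setD)
qed

text \<open>
  Gauss's lemma for \<open>S[t]\<close>, where \<open>S\<close> is a subring of a field that contains \<open>t\<close> and \<open>t\<close> is transcendental
  over \<open>S\<close>. It is an instance of Nagata's theorem: inverting the primes of \<open>S\<close> gives the polynomial
  ring over the field of fractions \<open>F\<close>, and primes of \<open>S\<close> remain prime in \<open>S[t]\<close>.
\<close>

theorem gauss:
  fixes S :: "'a :: field set" and t :: 'a
  assumes S: "ufd_set S" "finite_divisors S"
    and trans: "\<And>f. f \<in> coeffs_in S \<Longrightarrow> poly f t = 0 \<Longrightarrow> f = 0"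
  shows "ufd_set ((\<lambda>f. poly f t) ` coeffs_in S)" "finite_divisors ((\<lambda>f. poly f t) ` coeffs_in S)"
proof -
  have Ss: "subring_set S" using S(1) by (simp add: ufd_set_def)
  define F where "F = {x. \<exists>s\<in>S. s \<noteq> 0 \<and> x * s \<in> S}"
  note F = fractions_in_field [OF Ss, folded F_def]
  let ?e = "\<lambda>f. poly f t"
  let ?A = "?e ` coeffs_in S" and ?B = "?e ` coeffs_in F"
  have SF: "coeffs_in S \<subseteq> coeffs_in F" using F(2) by (auto simp: coeffs_in_def)
  have transF: "f = 0" if "f \<in> coeffs_in F" "poly f t = 0" for f
  proof -
    have "\<forall>i. \<exists>s\<in>S. s \<noteq> 0 \<and> coeff f i * s \<in> S" using that(1) by (auto simp: coeffs_in_def F_def)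
    then obtain s where s: "s \<noteq> 0" "smult s f \<in> coeffs_in S" using common_denominator [OF Ss] by blast
    then have "smult s f = 0" using trans [OF s(2)] that(2) by simp
    with s(1) show ?thesis by simp
  qed
  note FPs = coeffs_in_subring [OF F(1)]
  note SPs = coeffs_in_subring [OF Ss]
  have injF: "inj_on ?e (coeffs_in F)"
  proof (rule inj_onI)
    fix f g assume "f \<in> coeffs_in F" "g \<in> coeffs_in F" "poly f t = poly g t"
    then show "f = g" using transF [of "f - g"] subring_setD(3) [OF FPs] by simp
  qed
  have A: "subring_set ?A"
    unfolding subring_set_def
  proof (intro conjI ballI)
    show "1 \<in> ?A" using subring_setD(1) [OF SPs] by (intro rev_image_eqI [of 1]) simp_all
    fix x y assume "x \<in> ?A" "y \<in> ?A"
    then obtain f g where fg: "f \<in> coeffs_in S" "x = ?e f" "g \<in> coeffs_in S" "y = ?e g" by blast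
    then show "x - y \<in> ?A" "x * y \<in> ?A"
      using subring_setD(3,4) [OF SPs fg(1,3)] by (auto intro: rev_image_eqI)
  qed
  have B: "ufd_set ?B"
    by (rule ufd_set_image [OF ufd_set_coeffs_in_field [OF F(1,3)] injF]) simp_all
  have SA: "S \<subseteq> ?A"
    using monom_coeffs_in [OF Ss, of _ 0] by (auto simp: poly_monom intro!: rev_image_eqI [of "monom _ 0"])
  have mem: "divides_in ?A (?e f) (?e g) \<longleftrightarrow> divides_in (coeffs_in S) f g"
    if "f \<in> coeffs_in S" "g \<in> coeffs_in S" for f g
  proof
    assume "divides_in ?A (?e f) (?e g)"
    then obtain h where h: "h \<in> coeffs_in S" "poly g t = poly (f * h) t" by (auto simp: divides_in_def)
    moreover have "f * h \<in> coeffs_in S" using subring_setD(4) [OF SPs that(1) h(1)] .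
    ultimately have "g = f * h" using inj_onD [OF injF h(2)] that(2) SF by blast
    with h(1) show "divides_in (coeffs_in S) f g" by (rule divides_inI)
  qed (auto simp: divides_in_def)
  obtain \<delta> :: "'a \<Rightarrow> nat" where \<delta>: "\<And>a p. a \<in> S \<Longrightarrow> p \<in> S \<Longrightarrow> a \<noteq> 0 \<Longrightarrow> p \<noteq> 0 \<Longrightarrow> \<delta> a \<le> \<delta> (p * a)"
    "\<And>a p. a \<in> S \<Longrightarrow> p \<in> S \<Longrightarrow> a \<noteq> 0 \<Longrightarrow> p \<noteq> 0 \<Longrightarrow> \<delta> (p * a) = \<delta> a \<Longrightarrow> divides_in S p 1"
    using S(2) by (auto simp: finite_divisors_def)
  define \<delta>' where "\<delta>' x = (let f = the_inv_into (coeffs_in F) ?e x in \<delta> (lead_coeff f) + degree f)" for x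
  have \<delta>': "\<delta>' (?e f) = \<delta> (lead_coeff f) + degree f" if "f \<in> coeffs_in S" for f
    using the_inv_into_f_f [OF injF] that SF by (auto simp: \<delta>'_def)
  have norm: "\<delta>' a \<le> \<delta>' (p * a) \<and> (\<delta>' (p * a) = \<delta>' a \<longrightarrow> divides_in ?A p 1)"
    if ap: "a \<in> ?A" "p \<in> ?A" "a \<noteq> 0" "p \<noteq> 0" for a p
  proof -
    from ap(1,2) obtain f g where f: "f \<in> coeffs_in S" "a = ?e f" and g: "g \<in> coeffs_in S" "p = ?e g" by blast
    have gf: "g * f \<in> coeffs_in S" "p * a = ?e (g * f)" using f g subring_setD(4) [OF SPs] by simp_all
    have nz: "f \<noteq> 0" "g \<noteq> 0" using ap f g by auto
    have l: "lead_coeff f \<in> S" "lead_coeff g \<in> S" using f(1) g(1) by (auto simp: coeffs_in_def)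
    have eq: "\<delta>' (p * a) = \<delta> (lead_coeff g * lead_coeff f) + (degree g + degree f)"
      unfolding gf(2) \<delta>' [OF gf(1)] lead_coeff_mult using nz by (simp add: degree_mult_eq)
    have le: "\<delta> (lead_coeff f) \<le> \<delta> (lead_coeff g * lead_coeff f)" using \<delta>(1) l nz by simp
    have da: "\<delta>' a = \<delta> (lead_coeff f) + degree f" using \<delta>' [OF f(1)] f(2) by simp
    have "divides_in ?A p 1" if "\<delta>' (p * a) = \<delta>' a"
    proof -
      have "degree g = 0" and d: "\<delta> (lead_coeff g * lead_coeff f) = \<delta> (lead_coeff f)"
        using that le unfolding eq da by auto
      then obtain x where x: "g = [:x:]" by (auto elim: degree_eq_zeroE)
      then have "divides_in S x 1" using \<delta>(2) [OF l] nz d by simp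
      moreover have "p = x" using g(2) x by simp
      ultimately show ?thesis using SA by (auto simp: divides_in_def)
    qed
    with le show ?thesis unfolding eq da by auto
  qed
  then show "finite_divisors ?A" unfolding finite_divisors_def by blast
  define P where "P = {p\<in>S. p \<noteq> 0 \<and> prime_or_unit S p}"
  show "ufd_set ?A"
  proof (rule nagata [OF A B, of P])
    show "?A \<subseteq> ?B" using SF by blast
    show "P \<subseteq> {p \<in> ?A. p \<noteq> 0 \<and> prime_or_unit ?A p}"
    proof
      fix p assume p: "p \<in> P"
      have smult: "divides_in ?A p (?e f) \<longleftrightarrow> (\<forall>i. divides_in S p (coeff f i))" if f: "f \<in> coeffs_in S" for f
      proof -
        have pS: "[:p:] \<in> coeffs_in S" using p monom_coeffs_in [OF Ss, of p 0] by (simp add: P_def monom_0)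
        have "divides_in (coeffs_in S) [:p:] f \<longleftrightarrow> (\<forall>i. divides_in S p (coeff f i))"
        proof
          assume R: "\<forall>i. divides_in S p (coeff f i)"
          define h where "h = smult (1 / p) f"
          have "coeff h i \<in> S" for i using spec [OF R, of i] p by (auto simp: divides_in_def h_def P_def)
          then have "h \<in> coeffs_in S" by (simp add: coeffs_in_def)
          moreover have "f = [:p:] * h" using p by (simp add: h_def P_def)
          ultimately show "divides_in (coeffs_in S) [:p:] f" by (rule divides_inI)
        qed (auto simp: divides_in_def coeffs_in_def)
        then show ?thesis using mem [OF pS f] by simp
      qed
      have "prime_or_unit ?A p"
        unfolding prime_or_unit_def
      proof (intro ballI impI)
        fix x y assume "x \<in> ?A" "y \<in> ?A" and d: "divides_in ?A p (x * y)"
        then obtain f g where fg: "f \<in> coeffs_in S" "x = ?e f" "g \<in> coeffs_in S" "y = ?e g" by blast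
        then have fgS: "f * g \<in> coeffs_in S" and xy: "x * y = ?e (f * g)" using subring_setD(4) [OF SPs] by simp_all
        have "divides_in ?A p (?e (f * g))" using d unfolding xy .
        then have "divides_in S p (coeff (f * g) i)" for i unfolding smult [OF fgS] by blast
        then show "divides_in ?A p x \<or> divides_in ?A p y"
          using prime_or_unit_coeffs [OF Ss, of p f g] p fg smult by (simp add: P_def)
      qed
      with p SA show "p \<in> {p \<in> ?A. p \<noteq> 0 \<and> prime_or_unit ?A p}" by (auto simp: P_def)
    qed
    show "\<exists>c\<in>?B. p * c = 1" if "p \<in> P" for p
    proof
      have "1 / p \<in> F" using that F(4) by (auto simp: P_def)
      then show "1 / p \<in> ?B"
        using monom_coeffs_in [OF F(1), of "1 / p" 0] by (intro rev_image_eqI) (auto simp: poly_monom)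
      show "p * (1 / p) = 1" using that by (auto simp: P_def)
    qed
    show "\<exists>ms. set ms \<subseteq> P \<and> prod_list ms * b \<in> ?A" if bB: "b \<in> ?B" for b
    proof -
      obtain f where f: "f \<in> coeffs_in F" "b = ?e f" using bB by blast
      then have "\<forall>i. \<exists>s\<in>S. s \<noteq> 0 \<and> coeff f i * s \<in> S" by (auto simp: coeffs_in_def F_def)
      then obtain s where s: "s \<in> S" "s \<noteq> 0" "smult s f \<in> coeffs_in S" using common_denominator [OF Ss] by blast
      obtain ms where "set ms \<subseteq> P" "s = prod_list ms" using S(1) s(1,2) unfolding P_def ufd_set_def by blast
      moreover have "s * b \<in> ?A" using s(3) f(2) by (intro rev_image_eqI) auto
      ultimately show ?thesis by blast
    qed
    have PA: "P \<subseteq> ?A" using SA by (auto simp: P_def)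
    fix a assume "a \<in> ?A" "a \<noteq> 0"
    then show "\<exists>ms q. set ms \<subseteq> P \<and> q \<in> ?A \<and> (\<forall>p\<in>P. divides_in ?A p q \<longrightarrow> divides_in ?A p 1) \<and> a = prod_list ms * q"
    proof (induct "\<delta>' a" arbitrary: a rule: less_induct)
      case less
      show ?case
      proof (cases "\<exists>p\<in>P. divides_in ?A p a \<and> \<not> divides_in ?A p 1")
        case True
        then obtain p b where p: "p \<in> P" "\<not> divides_in ?A p 1" "b \<in> ?A" "a = p * b"
          by (auto simp: divides_in_def)
        have nz: "b \<noteq> 0" "p \<noteq> 0" using p(4) less.prems(2) by auto
        have "p \<in> ?A" using p(1) PA by blast
        from norm [OF p(3) this nz] p(2) have "\<delta>' b < \<delta>' a" unfolding p(4) by linarith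
        from less.hyps [OF this p(3) nz(1)] obtain ms q where
          "set ms \<subseteq> P" "q \<in> ?A" "\<forall>p\<in>P. divides_in ?A p q \<longrightarrow> divides_in ?A p 1" "b = prod_list ms * q"
          by (elim exE conjE)
        with p(1) show ?thesis unfolding p(4)
          by (intro exI [of _ "p # ms"] exI [of _ q]) (simp add: mult.assoc)
      next
        case False
        with less.prems(1) show ?thesis by (intro exI [of _ "[]"] exI [of _ a]) auto
      qed
    qed
  qed
qed


section \<open>Polynomial rings inside the rational function field\<close>

text \<open>
  All polynomial rings are realised inside the one field of rational functions in countably many
  variables. In this way a variable is added without changing the type.
\<close>

type_synonym 'k rational_function = "((nat \<Rightarrow>\<^sub>0 nat) \<Rightarrow>\<^sub>0 'k) fract"

lemmas to_fract_hom = to_fract_0 to_fract_1 to_fract_add to_fract_mult to_fract_diff to_fract_uminus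

lemma to_fract_power: "to_fract (a ^ n) = to_fract a ^ n"
  by (induct n) simp_all

lemma to_fract_sum: "to_fract (sum f A) = (\<Sum>i\<in>A. to_fract (f i))"
  by (induct A rule: infinite_finite_induct) simp_all

definition polynomial_functions :: "nat set \<Rightarrow> 'k :: field rational_function set" where
  "polynomial_functions V = to_fract ` polys_in V"

definition coordinate :: "nat \<Rightarrow> 'k :: field rational_function" where
  "coordinate v = to_fract (var_poly v)"

lemma subring_set_image:
  assumes "subring_set A" "\<phi> 1 = 1" "\<And>a b. \<phi> (a - b) = \<phi> a - \<phi> b" "\<And>a b. \<phi> (a * b) = \<phi> a * \<phi> b"
  shows "subring_set (\<phi> ` A)"
  unfolding subring_set_def
proof (intro conjI ballI)
  show "1 \<in> \<phi> ` A" using subring_setD(1) [OF assms(1)] assms(2) by (metis imageI)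
  fix x y assume "x \<in> \<phi> ` A" "y \<in> \<phi> ` A"
  then obtain a b where "a \<in> A" "x = \<phi> a" "b \<in> A" "y = \<phi> b" by blast
  then show "x - y \<in> \<phi> ` A" "x * y \<in> \<phi> ` A"
    using subring_setD(3,4) [OF assms(1)] assms(3,4) by (metis imageI)+
qed

lemma polynomial_functions_subring: "subring_set (polynomial_functions V)"
  unfolding polynomial_functions_def by (rule subring_set_image [OF polys_in_subring]) (simp_all add: to_fract_hom)

lemma coordinate_mem: "v \<in> V \<Longrightarrow> coordinate v \<in> polynomial_functions V"
  by (simp add: polynomial_functions_def coordinate_def)

lemma var_poly_power: "var_poly v ^ i = Poly_Mapping.single (Poly_Mapping.single v i) 1"
  by (induct i) (simp_all add: var_poly_def mult_single single_add [symmetric])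

text \<open>Compare the exponents of \<open>v\<close>: the summands have no monomial in common.\<close>

lemma polys_in_power_sum_zero:
  fixes s :: "nat \<Rightarrow> ('v \<Rightarrow>\<^sub>0 nat) \<Rightarrow>\<^sub>0 'k :: field"
  assumes v: "v \<notin> V" and s: "\<And>i. s i \<in> polys_in V" and sum: "(\<Sum>i\<le>n. s i * var_poly v ^ i) = 0" and i: "i \<le> n"
  shows "s i = 0"
proof (rule poly_mapping_eqI)
  fix m
  have key: "Poly_Mapping.lookup a v = 0" if "a \<in> Poly_Mapping.keys (s j)" for a j
  proof -
    have "Poly_Mapping.keys a \<subseteq> V" using that s [of j] by (auto simp: polys_in_def)
    then have "v \<notin> Poly_Mapping.keys a" using v by blast
    then show ?thesis by (simp add: in_keys_iff)
  qed
  show "Poly_Mapping.lookup (s i) m = Poly_Mapping.lookup 0 m"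
  proof (cases "m \<in> Poly_Mapping.keys (s i)")
    case True
    have other: "Poly_Mapping.lookup (s j * var_poly v ^ j) (Poly_Mapping.single v i + m) = 0" if "j \<noteq> i" for j
    proof (rule ccontr)
      assume "\<not> ?thesis"
      then have "Poly_Mapping.single v i + m \<in> Poly_Mapping.keys (Poly_Mapping.single (Poly_Mapping.single v j) 1 * s j)"
        by (simp add: var_poly_power in_keys_iff mult.commute)
      then obtain a where a: "a \<in> Poly_Mapping.keys (s j)" "Poly_Mapping.single v i + m = Poly_Mapping.single v j + a"
        using keys_single_mult by blast
      from a(2) have "Poly_Mapping.lookup (Poly_Mapping.single v i + m) v = Poly_Mapping.lookup (Poly_Mapping.single v j + a) v"
        by simp
      then show False using key [OF a(1)] key [OF True] that by (simp add: lookup_add)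
    qed
    have "0 = Poly_Mapping.lookup (\<Sum>j\<le>n. s j * var_poly v ^ j) (Poly_Mapping.single v i + m)" by (simp add: sum)
    also have "\<dots> = (\<Sum>j\<le>n. if j = i then Poly_Mapping.lookup (s i * var_poly v ^ i) (Poly_Mapping.single v i + m) else 0)"
      unfolding lookup_sum by (intro sum.cong) (auto simp: other)
    also have "\<dots> = Poly_Mapping.lookup (Poly_Mapping.single (Poly_Mapping.single v i) 1 * s i) (Poly_Mapping.single v i + m)"
      using i by (simp add: var_poly_power mult.commute)
    also have "\<dots> = Poly_Mapping.lookup (s i) m" by (simp only: lookup_single_mult mult_1_left)
    finally show ?thesis by simp
  qed (simp add: in_keys_iff)
qed

lemma polynomial_functions_insert:
  assumes v: "v \<notin> V"
  shows "(\<lambda>f. poly f (coordinate v)) ` coeffs_in (polynomial_functions V) =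
    (polynomial_functions (insert v V) :: 'k :: field rational_function set)" (is "?L = ?R")
proof
  have mono: "polynomial_functions V \<subseteq> ?R" by (auto simp: polynomial_functions_def polys_in_def)
  show "?L \<subseteq> ?R"
  proof (rule image_subsetI)
    fix f :: "'k rational_function poly" assume "f \<in> coeffs_in (polynomial_functions V)"
    then show "poly f (coordinate v) \<in> ?R"
      unfolding poly_altdef using mono
      by (intro subring_set_sum [OF polynomial_functions_subring] subring_setD(4) [OF polynomial_functions_subring]
          subring_set_power [OF polynomial_functions_subring] coordinate_mem) (auto simp: coeffs_in_def)
  qed
  have L: "subring_set ?L"
    by (rule subring_set_image [OF coeffs_in_subring [OF polynomial_functions_subring]]) simp_all
  show "?R \<subseteq> ?L"
  proof
    fix x assume "x \<in> ?R"
    then obtain g where g: "g \<in> polys_in (insert v V)" "x = to_fract g" by (auto simp: polynomial_functions_def)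
    have "g = (\<Sum>m\<in>Poly_Mapping.keys g. Poly_Mapping.single m (Poly_Mapping.lookup g m))"
      by (rule poly_mapping_eqI) (auto simp: lookup_sum lookup_single when_def in_keys_iff sum.delta)
    then have x: "x = (\<Sum>m\<in>Poly_Mapping.keys g. to_fract (Poly_Mapping.single m (Poly_Mapping.lookup g m)))"
      unfolding g(2) to_fract_sum [symmetric] by simp
    have "to_fract (Poly_Mapping.single m c) \<in> ?L" if m: "Poly_Mapping.keys m \<subseteq> insert v V" for m and c :: 'k
    proof -
      define n where "n = Poly_Mapping.lookup m v"
      define a where "a = m - Poly_Mapping.single v n"
      have ma: "m = Poly_Mapping.single v n + a"
        by (rule poly_mapping_eqI) (simp add: a_def n_def lookup_add lookup_minus lookup_single when_def)
      have "Poly_Mapping.keys a \<subseteq> Poly_Mapping.keys m - {v}"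
        by (auto simp: a_def n_def in_keys_iff lookup_minus lookup_single when_def split: if_splits)
      then have "Poly_Mapping.keys a \<subseteq> V" using m by blast
      then have "to_fract (Poly_Mapping.single a c) \<in> polynomial_functions V"
        by (auto simp: polynomial_functions_def polys_in_def)
      then have "monom (to_fract (Poly_Mapping.single a c)) n \<in> coeffs_in (polynomial_functions V)"
        by (rule monom_coeffs_in [OF polynomial_functions_subring])
      moreover have "to_fract (Poly_Mapping.single m c) = poly (monom (to_fract (Poly_Mapping.single a c)) n) (coordinate v)"
        by (simp add: ma poly_monom coordinate_def var_poly_power mult_single add.commute flip: to_fract_power to_fract_mult)
      ultimately show ?thesis by blast
    qed
    then show "x \<in> ?L" unfolding x using g(1) by (intro subring_set_sum [OF L]) (auto simp: polys_in_def)
  qed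
qed

lemma coordinate_transcendental:
  fixes f :: "'k :: field rational_function poly"
  assumes v: "v \<notin> V" and f: "f \<in> coeffs_in (polynomial_functions V)" "poly f (coordinate v) = 0"
  shows "f = 0"
proof -
  have "\<forall>i. \<exists>s. s \<in> polys_in V \<and> coeff f i = to_fract s"
    using f(1) by (auto simp: coeffs_in_def polynomial_functions_def)
  then obtain s where s: "\<And>i. s i \<in> polys_in V" "\<And>i. coeff f i = to_fract (s i)" by metis
  have "to_fract (\<Sum>i\<le>degree f. s i * var_poly v ^ i) = 0"
    using f(2) by (simp add: poly_altdef s(2) to_fract_sum to_fract_power coordinate_def)
  then have "(\<Sum>i\<le>degree f. s i * var_poly v ^ i) = 0" by (simp only: to_fract_eq_0_iff)
  then have "s i = 0" if "i \<le> degree f" for i using polys_in_power_sum_zero [where s = s and n = "degree f" and i = i, OF v s(1)] that by blast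
  then have "lead_coeff f = 0" using s(2) by (simp add: to_fract_hom)
  then show ?thesis by simp
qed

theorem polynomial_functions_ufd:
  assumes "finite V"
  shows "ufd_set (polynomial_functions V :: 'k :: field rational_function set) \<and>
    finite_divisors (polynomial_functions V :: 'k rational_function set)"
  using assms
proof induct
  case empty
  let ?S = "polynomial_functions {} :: 'k rational_function set"
  have unit: "divides_in ?S a 1" if a: "a \<in> ?S" "a \<noteq> 0" for a
  proof -
    obtain g where g: "g \<in> polys_in {}" "a = to_fract g" using a(1) by (auto simp: polynomial_functions_def)
    define c where "c = Poly_Mapping.lookup g 0"
    have gc: "g = coeff_poly c"
      using g(1) by (intro poly_mapping_eqI) (auto simp: c_def lookup_single when_def polys_in_def in_keys_iff)
    then have "c \<noteq> 0" using a(2) g(2) by auto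
    then have "g * coeff_poly (1 / c) = 1" by (simp add: gc mult_single)
    then have "1 = a * to_fract (coeff_poly (1 / c))" by (simp add: g(2) flip: to_fract_mult)
    moreover have "to_fract (coeff_poly (1 / c)) \<in> ?S" by (simp add: polynomial_functions_def)
    ultimately show ?thesis by (intro divides_inI)
  qed
  have "ufd_set ?S"
    unfolding ufd_set_def
  proof (intro conjI ballI impI polynomial_functions_subring)
    fix a assume a: "a \<in> ?S" "a \<noteq> 0"
    then have "prime_or_unit ?S a" by (intro prime_or_unitI_unit polynomial_functions_subring unit)
    with a show "\<exists>ps. set ps \<subseteq> {p \<in> ?S. p \<noteq> 0 \<and> prime_or_unit ?S p} \<and> a = prod_list ps"
      by (intro exI [of _ "[a]"]) auto
  qed
  moreover have "finite_divisors ?S"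
    unfolding finite_divisors_def by (rule exI [of _ "\<lambda>_. 0"]) (auto intro: unit)
  ultimately show ?case ..
next
  case (insert v V)
  then show ?case
    using gauss [of "polynomial_functions V" "coordinate v"] coordinate_transcendental [OF insert.hyps(2)]
    unfolding polynomial_functions_insert [OF insert.hyps(2)] by blast
qed

text \<open>
  Setting the variable \<open>v\<close> to zero is a homomorphism into a domain whose kernel consists of the
  multiples of \<open>v\<close>; this makes \<open>v\<close> prime.
\<close>

definition vanish :: "nat \<Rightarrow> ((nat \<Rightarrow>\<^sub>0 nat) \<Rightarrow>\<^sub>0 'k :: field) \<Rightarrow> (nat \<Rightarrow>\<^sub>0 nat) \<Rightarrow>\<^sub>0 'k" where
  "vanish v = psubst coeff_poly (\<lambda>w. if w = v then 0 else var_poly w)"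

lemma vanish_mult: "vanish v (f * g) = vanish v f * vanish v g"
  by (simp add: vanish_def coeff.psubst_mult)

lemma vanish_var: "vanish v (var_poly v) = 0"
  by (simp add: vanish_def)

lemma vanish_remainder: "\<exists>r. f - vanish v f = var_poly v * r"
proof (induct f rule: poly_induct_gens)
  case (const c)
  show ?case by (rule exI [of _ 0]) (simp add: vanish_def)
next
  case (var w)
  show ?case by (rule exI [of _ "if w = v then 1 else 0"]) (simp add: vanish_def)
next
  case (add f g)
  then obtain r s where rs: "f - vanish v f = var_poly v * r" "g - vanish v g = var_poly v * s" by blast
  have "f + g - vanish v (f + g) = (f - vanish v f) + (g - vanish v g)"
    by (simp add: vanish_def coeff.psubst_add)
  also have "\<dots> = var_poly v * (r + s)" unfolding rs by (simp add: distrib_left)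
  finally show ?case ..
next
  case (mult f g)
  then obtain r s where rs: "f - vanish v f = var_poly v * r" "g - vanish v g = var_poly v * s" by blast
  have "f * g - vanish v (f * g) = (f - vanish v f) * g + vanish v f * (g - vanish v g)"
    by (simp add: vanish_mult algebra_simps)
  also have "\<dots> = var_poly v * (r * g + vanish v f * s)" unfolding rs by (simp add: algebra_simps)
  finally show ?case ..
qed

lemma coordinate_divides_iff:
  assumes f: "f \<in> polys_in V"
  shows "divides_in (polynomial_functions V) (coordinate v) (to_fract f) \<longleftrightarrow> vanish v f = 0"
proof
  assume "divides_in (polynomial_functions V) (coordinate v) (to_fract f)"
  then obtain r where "to_fract f = to_fract (var_poly v * r)"
    by (auto simp: divides_in_def polynomial_functions_def coordinate_def to_fract_hom)
  then have "f = var_poly v * r" by (simp only: to_fract_eq_iff)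
  then show "vanish v f = 0" by (simp add: vanish_mult vanish_var)
next
  assume "vanish v f = 0"
  then obtain r where r: "f = var_poly v * r" using vanish_remainder [of f v] by auto
  have "r \<in> polys_in V"
    unfolding polys_in_def
  proof (intro CollectI ballI)
    fix m assume "m \<in> Poly_Mapping.keys r"
    then have "Poly_Mapping.single v 1 + m \<in> Poly_Mapping.keys f"
      using lookup_single_mult [of "Poly_Mapping.single v 1" 1 r m] by (simp add: r var_poly_def in_keys_iff)
    then have "Poly_Mapping.keys (Poly_Mapping.single v 1 + m) \<subseteq> V" using f by (auto simp: polys_in_def)
    then show "Poly_Mapping.keys m \<subseteq> V" by (auto simp: in_keys_iff lookup_add)
  qed
  then show "divides_in (polynomial_functions V) (coordinate v) (to_fract f)"
    by (intro divides_inI [of "to_fract r"]) (simp_all add: polynomial_functions_def r coordinate_def to_fract_hom)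
qed

lemma coordinate_prime_or_unit: "prime_or_unit (polynomial_functions V) (coordinate v)"
  unfolding prime_or_unit_def
proof (intro ballI impI)
  fix x y assume xy: "x \<in> polynomial_functions V" "y \<in> polynomial_functions V"
    and d: "divides_in (polynomial_functions V) (coordinate v) (x * y)"
  then obtain f g where fg: "f \<in> polys_in V" "x = to_fract f" "g \<in> polys_in V" "y = to_fract g"
    by (auto simp: polynomial_functions_def)
  have "vanish v (f * g) = 0"
    using d coordinate_divides_iff [OF subring_setD(4) [OF polys_in_subring fg(1,3)]] by (simp add: fg to_fract_hom)
  then have "vanish v f = 0 \<or> vanish v g = 0" by (simp add: vanish_mult)
  then show "divides_in (polynomial_functions V) (coordinate v) x \<or> divides_in (polynomial_functions V) (coordinate v) y"
    using coordinate_divides_iff fg by blast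
qed


section \<open>Charts\<close>

definition const_fraction :: "'k :: field \<Rightarrow> 'k rational_function" where
  "const_fraction c = to_fract (coeff_poly c)"

interpretation rat: coefficient_hom "const_fraction :: 'k :: field \<Rightarrow> _"
  by standard (simp_all add: const_fraction_def coeff_poly_add coeff_poly_mult)

lemma psubst_cong_polys_in:
  assumes "G \<in> polys_in V" "\<And>v. v \<in> V \<Longrightarrow> y v = y' v"
  shows "psubst c y G = psubst c y' G"
  unfolding psubst_def
proof (rule sum.cong [OF refl])
  fix m assume "m \<in> Poly_Mapping.keys G"
  then have "Poly_Mapping.keys m \<subseteq> V" using assms(1) by (auto simp: polys_in_def)
  then have "monomial_value y m = monomial_value y' m"
    unfolding monomial_value_def using assms(2) by (intro prod.cong) auto
  then show "c (Poly_Mapping.lookup G m) * monomial_value y m = c (Poly_Mapping.lookup G m) * monomial_value y' m" by simp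
qed

lemma psubst_psubst: "psubst const_fraction z (psubst const_poly y G) =
    psubst const_fraction (\<lambda>v. psubst const_fraction z (y v)) G"
  by (induct G rule: poly_induct_gens) (simp_all add: rat.psubst_hom const.psubst_hom)

lemma psubst_coordinate: "psubst const_fraction coordinate G = to_fract G"
  by (induct G rule: poly_induct_gens) (simp_all add: rat.psubst_hom coordinate_def flip: const_fraction_def)

text \<open>
  A chart of \<open>R / I\<close> consists of coordinates \<open>y v\<close>, for \<open>v\<close> in \<open>V\<close>, and a denominator \<open>e\<close> that is itself
  polynomial in the coordinates modulo \<open>I\<close>, such that every entry of the matrix becomes polynomial
  in the coordinates after multiplication by a power of \<open>e\<close>. Its inverse is the matrix \<open>z\<close> of rational
  functions, which has to be a zero of the few known elements of \<open>I\<close>.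
\<close>

locale chart_data =
  fixes I :: "'k :: field_char_0 mat3_poly set" and e :: "'k mat3_poly" and y :: "nat \<Rightarrow> 'k mat3_poly" and V :: "nat set"
  assumes I: "hprime I" and e_S: "\<exists>s\<in>psubst const_poly y ` polys_in V. e - s \<in> I"

sublocale chart_data \<subseteq> clearing I "psubst const_poly y ` polys_in V" e
  using hprimeD(2) [OF I] psubst_image_subring psubst_image_mem(2) e_S by unfold_locales blast+

locale chart = chart_data I e y V
  for I :: "'k :: field_char_0 mat3_poly set" and e y V +
  fixes z :: "3 \<times> 3 \<Rightarrow> 'k rational_function"
  assumes V: "finite V" and e_weight: "\<exists>w. weight w e" and e: "e \<notin> I"
    and Det: "psubst const_fraction z Det = 1"
    and corner: "g \<in> corner_elements \<Longrightarrow> g \<in> I \<Longrightarrow> psubst const_fraction z g = 0"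
    and denominator: "psubst const_fraction z (chart_denominator I) \<noteq> 0"
    and coord: "v \<in> V \<Longrightarrow> psubst const_fraction z (y v) = coordinate v"
    and clear: "clearable (mvar i j)"
begin

abbreviation \<Phi> where "\<Phi> \<equiv> psubst const_fraction z"

lemma Phi_psubst: "G \<in> polys_in V \<Longrightarrow> \<Phi> (psubst const_poly y G) = to_fract G"
  unfolding psubst_psubst psubst_coordinate [symmetric] by (erule psubst_cong_polys_in) (erule coord)

text \<open>
  A power of the chart denominator carries \<open>g\<close> into the corner ideal, whose generators vanish at \<open>z\<close>
  while the denominator does not.
\<close>

lemma Phi_ideal: "g \<in> I \<Longrightarrow> \<Phi> g = 0"
proof -
  assume "g \<in> I"
  then obtain n where "chart_denominator I ^ n * g \<in> corner_ideal I" using hprime_corner_ideal [OF I] by blast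
  moreover have "ideal_set {g. \<Phi> g = 0}" by (simp add: ideal_set_def rat.psubst_hom)
  then have "corner_ideal I \<subseteq> {g. \<Phi> g = 0}"
    unfolding corner_ideal_def using Det corner by (intro ideal_gen_least) (auto simp: rat.psubst_hom)
  ultimately have "\<Phi> (chart_denominator I ^ n * g) = 0" by blast
  then show ?thesis using denominator by (simp add: rat.psubst_mult rat.psubst_power)
qed

lemma Phi_cong: "g - h \<in> I \<Longrightarrow> \<Phi> g = \<Phi> h"
  using Phi_ideal [of "g - h"] by (simp add: rat.psubst_diff)

lemma cleared:
  obtains n G where "G \<in> polys_in V" "e ^ n * g - psubst const_poly y G \<in> I" "\<Phi> e ^ n * \<Phi> g = to_fract G"
proof -
  have "clearable g" by (rule clearable_all [OF clear])
  then obtain n G where G: "G \<in> polys_in V" "e ^ n * g - psubst const_poly y G \<in> I"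
    unfolding clearable_def by blast
  have "\<Phi> e ^ n * \<Phi> g = to_fract G"
    using Phi_cong [OF G(2)] Phi_psubst [OF G(1)] by (simp add: rat.psubst_mult rat.psubst_power)
  with G that show thesis by blast
qed

text \<open>
  If \<open>\<Phi> g = 0\<close>, then the polynomial in the coordinates that represents \<open>e ^ n * g\<close> is zero,
  because \<open>\<Phi>\<close> sends the coordinates to independent variables; now cancel \<open>e\<close>.
\<close>

lemma Phi_kernel: "\<Phi> g = 0 \<longleftrightarrow> g \<in> I"
proof
  assume g: "\<Phi> g = 0"
  obtain n G where G: "e ^ n * g - psubst const_poly y G \<in> I" "\<Phi> e ^ n * \<Phi> g = to_fract G"
    using cleared [of g] by blast
  have "G = 0" using G(2) g by simp
  then have "e ^ n * g \<in> I" using G(1) by simp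
  then show "g \<in> I" using hprime_regular_power [OF I _ e] e_weight by blast
qed (rule Phi_ideal)

lemma Phi_eq_iff: "\<Phi> g = \<Phi> h \<longleftrightarrow> g - h \<in> I"
  using Phi_kernel [of "g - h"] by (simp add: rat.psubst_diff)

lemma Phi_range_subring: "subring_set (range \<Phi>)"
  using subring_set_image [of UNIV \<Phi>] by (simp add: subring_set_def rat.psubst_hom)

lemma Phi_e: "\<Phi> e \<in> polynomial_functions V" "\<Phi> e \<noteq> 0"
proof -
  obtain G where "G \<in> polys_in V" "e - psubst const_poly y G \<in> I" using e_S by blast
  then show "\<Phi> e \<in> polynomial_functions V"
    using Phi_cong Phi_psubst by (metis imageI polynomial_functions_def)
  show "\<Phi> e \<noteq> 0" using e Phi_kernel by simp
qed

lemma polynomial_functions_subset: "polynomial_functions V \<subseteq> range \<Phi>"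
  unfolding polynomial_functions_def using Phi_psubst by (metis (no_types, lifting) image_subsetI rangeI)

lemma localisation_eq: "localisation (range \<Phi>) (\<Phi> e) = localisation (polynomial_functions V) (\<Phi> e)"
proof
  show "localisation (polynomial_functions V) (\<Phi> e) \<subseteq> localisation (range \<Phi>) (\<Phi> e)"
    using polynomial_functions_subset by (auto simp: localisation_def)
  show "localisation (range \<Phi>) (\<Phi> e) \<subseteq> localisation (polynomial_functions V) (\<Phi> e)"
  proof
    fix x assume "x \<in> localisation (range \<Phi>) (\<Phi> e)"
    then obtain m g where x: "x * \<Phi> e ^ m = \<Phi> g" by (auto simp: localisation_def)
    obtain n G where G: "G \<in> polys_in V" "\<Phi> e ^ n * \<Phi> g = to_fract G" using cleared [of g] by blast
    have "x * \<Phi> e ^ (m + n) = \<Phi> e ^ n * (x * \<Phi> e ^ m)" by (simp add: power_add ac_simps)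
    then have "x * \<Phi> e ^ (m + n) = to_fract G" unfolding x G(2) .
    with G(1) show "x \<in> localisation (polynomial_functions V) (\<Phi> e)"
      by (auto simp: localisation_def polynomial_functions_def)
  qed
qed

lemma localisation_ufd: "ufd_set (localisation (range \<Phi>) (\<Phi> e))"
  unfolding localisation_eq using polynomial_functions_ufd [OF V] Phi_e by (intro ufd_set_localisation) auto

text \<open>
  After inverting \<open>e\<close>, the coordinate \<open>y v\<close> is a variable of a polynomial ring. Multiplying by a power
  of \<open>e\<close> brings this back to \<open>R / I\<close>.
\<close>

lemma coordinate_prime:
  assumes v: "v \<in> V" and gh: "g * h - y v * r \<in> I"
  shows "\<exists>n s. e ^ n * g - y v * s \<in> I \<or> e ^ n * h - y v * s \<in> I"
proof -
  let ?L = "localisation (range \<Phi>) (\<Phi> e)"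
  have pu: "prime_or_unit ?L (\<Phi> (y v))"
    unfolding localisation_eq coord [OF v]
    using Phi_e coordinate_mem [OF v] coordinate_prime_or_unit
    by (intro prime_or_unit_localisation polynomial_functions_subring)
  have eq: "\<Phi> g * \<Phi> h = \<Phi> (y v) * \<Phi> r"
    using Phi_cong [OF gh] by (simp add: rat.psubst_mult)
  have L: "\<Phi> x \<in> ?L" for x using subset_localisation by blast
  have "divides_in ?L (\<Phi> (y v)) (\<Phi> g * \<Phi> h)" using L eq by (rule divides_inI)
  then have "divides_in ?L (\<Phi> (y v)) (\<Phi> g) \<or> divides_in ?L (\<Phi> (y v)) (\<Phi> h)"
    using pu L unfolding prime_or_unit_def by blast
  moreover have "\<exists>n s. e ^ n * x - y v * s \<in> I" if d: "divides_in ?L (\<Phi> (y v)) (\<Phi> x)" for x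
  proof -
    obtain c n s where "\<Phi> x = \<Phi> (y v) * c" "c * \<Phi> e ^ n = \<Phi> s"
      using d by (auto simp: divides_in_def localisation_def)
    moreover have "\<Phi> e ^ n * (\<Phi> (y v) * c) = \<Phi> (y v) * (c * \<Phi> e ^ n)" by (simp only: ac_simps)
    ultimately have "\<Phi> (e ^ n * x) = \<Phi> (y v * s)" by (simp only: rat.psubst_mult rat.psubst_power)
    then show ?thesis unfolding Phi_eq_iff by blast
  qed
  ultimately show ?thesis by blast
qed

end

text \<open>
  \<open>prime_or_unit\<close> for the residue class of \<open>p\<close> in the quotient by \<open>I\<close>.
\<close>

definition prime_or_unit_mod :: "'a :: comm_ring_1 set \<Rightarrow> 'a \<Rightarrow> bool" where
  "prime_or_unit_mod I p \<longleftrightarrow> (\<forall>g h r. g * h - p * r \<in> I \<longrightarrow> (\<exists>s. g - p * s \<in> I \<or> h - p * s \<in> I))"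

lemma ideal_set_add_principal:
  assumes I: "ideal_set I"
  shows "ideal_set {g. \<exists>s. g - p * s \<in> I}"
  unfolding ideal_set_def
proof (intro conjI ballI allI)
  show "0 \<in> {g. \<exists>s. g - p * s \<in> I}" using ideal_setD(1) [OF I] by (auto intro: exI [of _ 0])
  fix a assume "a \<in> {g. \<exists>s. g - p * s \<in> I}"
  then obtain s where s: "a - p * s \<in> I" by blast
  show "r * a \<in> {g. \<exists>s. g - p * s \<in> I}" for r
    using ideal_setD(3) [OF I s, of r] by (auto intro!: exI [of _ "r * s"] simp: algebra_simps)
  fix b assume "b \<in> {g. \<exists>s. g - p * s \<in> I}"
  then obtain t where t: "b - p * t \<in> I" by blast
  show "a + b \<in> {g. \<exists>s. g - p * s \<in> I}"
    using ideal_setD(2) [OF I s t] by (auto intro!: exI [of _ "s + t"] simp: algebra_simps)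
qed

lemma comaximal_cancel:
  assumes Q: "ideal_set Q" and u: "1 - e * u \<in> Q" and g: "e ^ n * g \<in> Q"
  shows "g \<in> Q"
  using g
proof (induct n)
  case (Suc n)
  have "(1 - e * u) * (e ^ n * g) + u * (e ^ Suc n * g) \<in> Q"
    using u Suc.prems ideal_setD(2-4) [OF Q] by blast
  then have "e ^ n * g \<in> Q" by (simp add: algebra_simps)
  then show ?case by (rule Suc.hyps)
qed simp


section \<open>Three families of charts\<close>

definition matrix9 :: "'b \<Rightarrow> 'b \<Rightarrow> 'b \<Rightarrow> 'b \<Rightarrow> 'b \<Rightarrow> 'b \<Rightarrow> 'b \<Rightarrow> 'b \<Rightarrow> 'b \<Rightarrow> 3 \<times> 3 \<Rightarrow> 'b" where
  "matrix9 a b c d e f g h i = (\<lambda>(r, s).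
     if r = 0 then (if s = 0 then a else if s = 1 then b else c)
     else if r = 1 then (if s = 0 then d else if s = 1 then e else f)
     else (if s = 0 then g else if s = 1 then h else i))"

lemma matrix9_simps [simp]:
  "matrix9 a b c d e f g h i (0, 0) = a" "matrix9 a b c d e f g h i (0, 1) = b" "matrix9 a b c d e f g h i (0, 2) = c"
  "matrix9 a b c d e f g h i (1, 0) = d" "matrix9 a b c d e f g h i (1, 1) = e" "matrix9 a b c d e f g h i (1, 2) = f"
  "matrix9 a b c d e f g h i (2, 0) = g" "matrix9 a b c d e f g h i (2, 1) = h" "matrix9 a b c d e f g h i (2, 2) = i"
  by (simp_all add: matrix9_def num3_neq)

text \<open>
  Rational functions are shown to be nonzero by evaluating them at a point with small integer
  coordinates.
\<close>

lemma nonzero_by_value: "psubst coeff_poly y f \<noteq> 0 \<Longrightarrow> to_fract f \<noteq> 0"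
  using coeff.psubst_0 to_fract_eq_0_iff by metis

lemma coordinate_nonzero [simp]: "coordinate v \<noteq> (0 :: 'k :: field rational_function)"
  unfolding coordinate_def by (rule nonzero_by_value [where y = "\<lambda>_. 1"]) (simp only: coeff.psubst_var, simp)

subsection \<open>Lower triangular times diagonal times upper triangular\<close>

text \<open>
  Besides \<open>x 0 0\<close> and \<open>[0 1|0 1]\<close>, the entries of the first column and of the first row and the minors
  \<open>[0 2|0 1]\<close> and \<open>[0 1|0 2]\<close>: up to powers of the first two, these are the entries of the three
  factors. A coordinate is dropped if it lies in \<open>I\<close> or is determined by the others. The latter
  happens for \<open>x 2 0\<close> if \<open>[1 2|0 1] \<in> I\<close>, as \<open>[0 1|0 1] * x 2 0 = x 1 0 * [0 2|0 1] - x 0 0 * [1 2|0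
  1]\<close>, and symmetrically for \<open>x 0 2\<close>.
\<close>

definition gauss_vars :: "nat \<Rightarrow> 'k :: comm_ring_1 mat3_poly" where
  "gauss_vars v = [mvar 0 0, minor 0 1 0 1, mvar 1 0, minor 0 2 0 1, mvar 2 0, mvar 0 1, minor 0 1 0 2, mvar 0 2] ! v"

definition gauss_free :: "'k :: comm_ring_1 mat3_poly set \<Rightarrow> nat set" where
  "gauss_free I = {v. v < 8 \<and> (v = 2 \<longrightarrow> mvar 1 0 \<notin> I) \<and> (v = 3 \<longrightarrow> mvar 2 1 \<notin> I) \<and>
     (v = 4 \<longrightarrow> mvar 2 0 \<notin> I \<and> minor 1 2 0 1 \<notin> I) \<and> (v = 5 \<longrightarrow> mvar 0 1 \<notin> I) \<and>
     (v = 6 \<longrightarrow> mvar 1 2 \<notin> I) \<and> (v = 7 \<longrightarrow> mvar 0 2 \<notin> I \<and> minor 0 1 1 2 \<notin> I)}"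

text \<open>
  The matrix of determinant \<open>1\<close> with given coordinates: the remaining entries are found from the
  minors \<open>[0 1|0 1]\<close>, \<open>[0 2|0 1]\<close>, \<open>[0 1|0 2]\<close> and from \<open>Det = 1\<close>.
\<close>

definition gauss_point :: "'k :: field mat3_poly set \<Rightarrow> 3 \<times> 3 \<Rightarrow> 'k rational_function" where
  "gauss_point I = (let
     x = coordinate 0; d = coordinate 1;
     p = (if mvar 1 0 \<in> I then 0 else coordinate 2); q = (if mvar 2 1 \<in> I then 0 else coordinate 3);
     s = (if minor 1 2 0 1 \<in> I then p * q / d else if mvar 2 0 \<in> I then 0 else coordinate 4);
     p' = (if mvar 0 1 \<in> I then 0 else coordinate 5); q' = (if mvar 1 2 \<in> I then 0 else coordinate 6);
     s' = (if minor 0 1 1 2 \<in> I then p' * q' / d else if mvar 0 2 \<in> I then 0 else coordinate 7)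
   in matrix9 x p' s' p ((d + p * p') / x) ((q' + p * s') / x) s ((q + p' * s) / x) (((x + q * q') / d + s * s') / x))"

lemma Det_at: "psubst const_fraction (matrix9 a b c d e f g h i) Det =
    a * e * i + b * f * g + c * d * h - a * f * h - b * d * i - c * e * g"
  by (simp add: Det_expand rat.psubst_hom)

lemma minor_at: "psubst const_fraction z (minor i l j m) = z (i, j) * z (l, m) - z (i, m) * z (l, j)"
  by (simp add: minor_def rat.psubst_hom)

lemma gauss_Det:
  fixes x d p q s p' q' s' :: "'a :: field"
  assumes "x \<noteq> 0" "d \<noteq> 0"
  defines "a \<equiv> (d + p * p') / x" and "b \<equiv> (q' + p * s') / x" and "c \<equiv> (q + p' * s) / x"
    and "e \<equiv> ((x + q * q') / d + s * s') / x"
  shows "x * a * e + p' * b * s + s' * p * c - x * b * c - p' * p * e - s' * a * s = 1"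
proof -
  define r where "r = (x + q * q') / d"
  have 1: "x * a = d + p * p'" "x * b = q' + p * s'" "x * c = q + p' * s" "x * e = r + s * s'"
    using assms(1) by (simp_all add: a_def b_def c_def e_def r_def)
  have 2: "d * r = x + q * q'" unfolding r_def using assms(2) by simp
  have "x * (x * a * e + p' * b * s + s' * p * c - x * b * c - p' * p * e - s' * a * s) =
      (x * a) * (x * e) + p' * (x * b) * s + s' * p * (x * c) - (x * b) * (x * c) - p' * p * (x * e) - s' * (x * a) * s"
    by (simp add: algebra_simps)
  also have "\<dots> = d * r - q * q'" unfolding 1 by (simp add: algebra_simps)
  also have "\<dots> = x * 1" unfolding 2 by simp
  finally show ?thesis using mult_left_cancel [OF assms(1)] by blast
qed

lemma gauss_minor:
  fixes x :: "'a :: field"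
  assumes "x \<noteq> 0"
  shows "x * ((d + p * p') / x) - p' * p = d" "x * ((q + p' * s) / x) - p' * s = q"
    "p * ((q + p' * s) / x) - (d + p * p') / x * s = (p * q - d * s) / x"
    "p' * ((q + p * s) / x) - s * ((d + p * p') / x) = (p' * q - d * s) / x"
    "x * ((q + p * s) / x) - s * p = q"
  using assms by (simp_all add: field_simps)

lemma gauss_chart:
  fixes I :: "'k :: field_char_0 mat3_poly set"
  assumes I: "hprime I"
  shows "chart I (mvar 0 0 * minor 0 1 0 1) gauss_vars (gauss_free I) (gauss_point I)"
proof -
  let ?e = "mvar 0 0 * minor 0 1 0 1 :: 'k mat3_poly"
  let ?S = "psubst const_poly gauss_vars ` polys_in (gauss_free I)"
  note i = hprimeD(2) [OF I]
  have varS: "gauss_vars v \<in> ?S" if "v \<in> gauss_free I" for v using that by (rule psubst_image_mem)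
  have s: "mvar 0 0 \<in> ?S" "minor 0 1 0 1 \<in> ?S"
    using varS [of 0] varS [of 1] by (simp_all add: gauss_vars_def gauss_free_def)
  then have eS: "?e \<in> ?S" by (intro subring_setD(4) [OF psubst_image_subring])
  interpret chart_data I ?e gauss_vars "gauss_free I"
  proof
    show "\<exists>s\<in>?S. ?e - s \<in> I" using eS ideal_setD(1) [OF i] by (intro bexI [of _ ?e]) simp_all
  qed (rule I)
  have free: "clearable (gauss_vars v)" if "v \<in> gauss_free I" for v by (rule clearable_mem [OF varS [OF that]])
  note m00 = clearable_mem [OF s(1)] and D = clearable_mem [OF s(2)]
  have m10: "clearable (mvar 1 0)"
    using free [of 2] clearable_ideal by (cases "mvar 1 0 \<in> I") (auto simp: gauss_vars_def gauss_free_def)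
  have m01: "clearable (mvar 0 1)"
    using free [of 5] clearable_ideal by (cases "mvar 0 1 \<in> I") (auto simp: gauss_vars_def gauss_free_def)
  have N: "clearable (minor 0 2 0 1)"
  proof (cases "mvar 2 1 \<in> I")
    case True
    then have "minor 0 2 0 1 \<in> I"
      unfolding minor_def using subdiagonal_mem(2) [OF I True] by (intro ideal_setD(6) [OF i] ideal_setD(3) [OF i])
    then show ?thesis by (rule clearable_ideal)
  next
    case False
    then show ?thesis using free [of 3] by (simp add: gauss_vars_def gauss_free_def)
  qed
  have N': "clearable (minor 0 1 0 2)"
  proof (cases "mvar 1 2 \<in> I")
    case True
    then have "minor 0 1 0 2 \<in> I"
      unfolding minor_def using subdiagonal_mem(4) [OF I True]
      by (intro ideal_setD(6) [OF i]) (auto intro: ideal_setD(3,4) [OF i])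
    then show ?thesis by (rule clearable_ideal)
  next
    case False
    then show ?thesis using free [of 6] by (simp add: gauss_vars_def gauss_free_def)
  qed
  have m20: "clearable (mvar 2 0)"
  proof (cases "minor 1 2 0 1 \<in> I")
    case True
    have "minor 0 1 0 1 * mvar 2 0 = mvar 1 0 * minor 0 2 0 1 - mvar 0 0 * (minor 1 2 0 1 :: 'k mat3_poly)"
      by (simp add: minor_def algebra_simps)
    then have "clearable (minor 0 1 0 1 * mvar 2 0)"
      using m10 N m00 clearable_ideal [OF True] by (simp add: clearable_ring)
    then show ?thesis by (rule clearable_divide [OF _ m00]) (rule mult.commute)
  next
    case False
    then show ?thesis using free [of 4] clearable_ideal
      by (cases "mvar 2 0 \<in> I") (auto simp: gauss_vars_def gauss_free_def)
  qed
  have m02: "clearable (mvar 0 2)"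
  proof (cases "minor 0 1 1 2 \<in> I")
    case True
    have "minor 0 1 0 1 * mvar 0 2 = mvar 0 1 * minor 0 1 0 2 - mvar 0 0 * (minor 0 1 1 2 :: 'k mat3_poly)"
      by (simp add: minor_def algebra_simps)
    then have "clearable (minor 0 1 0 1 * mvar 0 2)"
      using m01 N' m00 clearable_ideal [OF True] by (simp add: clearable_ring)
    then show ?thesis by (rule clearable_divide [OF _ m00]) (rule mult.commute)
  next
    case False
    then show ?thesis using free [of 7] clearable_ideal
      by (cases "mvar 0 2 \<in> I") (auto simp: gauss_vars_def gauss_free_def)
  qed
  have div: "clearable x" if "clearable (mvar 0 0 * x)" for x by (rule clearable_divide [OF that D]) (rule refl)
  have "clearable (mvar 0 0 * mvar 1 1)" using clearable_add [OF D clearable_mult [OF m01 m10]] by (simp add: minor_def)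
  then have m11: "clearable (mvar 1 1)" by (rule div)
  have "clearable (mvar 0 0 * mvar 2 1)" using clearable_add [OF N clearable_mult [OF m01 m20]] by (simp add: minor_def)
  then have m21: "clearable (mvar 2 1)" by (rule div)
  have "clearable (mvar 0 0 * mvar 1 2)" using clearable_add [OF N' clearable_mult [OF m02 m10]] by (simp add: minor_def)
  then have m12: "clearable (mvar 1 2)" by (rule div)
  have m22: "clearable (mvar 2 2)"
  proof (rule clearable_divide [OF _ m00])
    have eq: "minor 0 1 0 1 * mvar 2 2 = (Det - 1) + 1 - (mvar 0 1 * mvar 1 2 * mvar 2 0 + mvar 0 2 * mvar 1 0 * mvar 2 1
        - mvar 0 0 * mvar 1 2 * mvar 2 1 - (mvar 0 2 * mvar 1 1 * mvar 2 0 :: 'k mat3_poly))"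
      by (simp add: minor_def Det_expand algebra_simps)
    show "clearable (minor 0 1 0 1 * mvar 2 2)"
      unfolding eq using poisson_stableD(2) [OF hprimeD(1) [OF I]]
      by (intro clearable_ring clearable_ideal m00 m01 m02 m10 m11 m12 m20 m21)
  qed (rule mult.commute)
  have all: "clearable (mvar i j)" for i j
    using num3_cases [of i] num3_cases [of j] m00 m01 m02 m10 m11 m12 m20 m21 m22 by auto
  note point = gauss_point_def Let_def rat.psubst_hom minor_at gauss_minor
  show ?thesis
  proof
    show "finite (gauss_free I)" by (simp add: gauss_free_def)
    show "\<exists>w. weight w ?e" using weight_mult [OF weight_mvar weight_minor] by blast
    show "?e \<notin> I" using hprime_mvar_mult [OF I] corner_notin [OF I] leading_minor_notin [OF I] by blast
    show "psubst const_fraction (gauss_point I) Det = 1"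
      unfolding gauss_point_def Let_def Det_at by (rule gauss_Det) simp_all
    show "psubst const_fraction (gauss_point I) (chart_denominator I) \<noteq> 0"
      by (simp add: chart_denominator_def point)
    show "psubst const_fraction (gauss_point I) (gauss_vars v) = coordinate v" if "v \<in> gauss_free I" for v
    proof -
      have "v < 8" using that by (simp add: gauss_free_def)
      from less_8_cases [OF this] that show ?thesis
        by (elim disjE) (simp_all add: gauss_vars_def gauss_free_def point)
    qed
    show "psubst const_fraction (gauss_point I) g = 0" if "g \<in> corner_elements" "g \<in> I" for g
      using that subdiagonal_mem [OF I] corner_minor_mem [OF I] unfolding corner_elements_def
      by (elim insertE; simp add: point; simp add: field_simps)
    show "clearable (mvar i j)" for i j by (rule all)
  qed
qed

subsection \<open>Pivot in the first column\<close>

text \<open>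
  A chart in which only \<open>x 1 0\<close> is inverted. With \<open>Det = 1\<close>, one has \<open>x 1 0 = [0 1|0 1] * [1 2|0 2] -
  [0 1|0 2] * [1 2|0 1]\<close>, so \<open>x 1 0\<close> is polynomial in the coordinates; given \<open>x 0 0\<close>, \<open>x 2 0\<close>, \<open>x 1 1\<close>,
  \<open>x 1 2\<close> and these four minors, the other entries are obtained by dividing by \<open>x 1 0\<close>.

  If \<open>[0 1|1 2] \<in> I\<close>, then modulo \<open>I\<close> the pair \<open>(x 1 1, x 1 2)\<close> is proportional to
  \<open>([0 1|0 1], [0 1|0 2])\<close>, and the element \<open>t = x 1 1 * [1 2|0 2] - x 1 2 * [1 2|0 1]\<close>, for which
  \<open>x 1 0 * x 1 1 = t * [0 1|0 1]\<close> and \<open>x 1 0 * x 1 2 = t * [0 1|0 2]\<close>, replaces both. If \<open>x 0 2 \<in> I\<close>,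
  then \<open>[0 1|0 2] = x 0 0 * x 1 2\<close>; in this case \<open>[0 1|1 2] \<in> I\<close> means that \<open>x 1 2 \<in> I\<close>, because
  \<open>x 0 1 \<notin> I\<close>.
\<close>

definition pivot_vars :: "'k :: comm_ring_1 mat3_poly set \<Rightarrow> nat \<Rightarrow> 'k mat3_poly" where
  "pivot_vars I v = [mvar 0 0, minor 0 1 0 1, minor 0 1 0 2, minor 1 2 0 1, minor 1 2 0 2, mvar 2 0,
     if mvar 0 2 \<notin> I \<and> minor 0 1 1 2 \<in> I then mvar 1 1 * minor 1 2 0 2 - mvar 1 2 * minor 1 2 0 1 else mvar 1 1,
     mvar 1 2] ! v"

definition pivot_free :: "'k :: comm_ring_1 mat3_poly set \<Rightarrow> nat set" where
  "pivot_free I = {v. v < 8 \<and> (v = 2 \<longrightarrow> mvar 0 2 \<notin> I) \<and> (v = 3 \<longrightarrow> minor 1 2 0 1 \<notin> I) \<and>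
     (v = 5 \<longrightarrow> mvar 2 0 \<notin> I) \<and> (v = 7 \<longrightarrow> minor 0 1 1 2 \<notin> I)}"

text \<open>
  The matrix with \<open>x 0 0 = x\<close>, second row \<open>(b, a, c)\<close> and \<open>x 2 0 = r\<close> whose minors are \<open>[0 1|0 1] = d\<close>,
  \<open>[0 1|0 2] = n\<close>, \<open>[1 2|0 1] = m\<close> and \<open>[1 2|0 2] = w\<close>. The choice of \<open>b\<close> makes the determinant equal to
  \<open>1\<close>.
\<close>

definition pivot_matrix :: "'a :: field \<Rightarrow> 'a \<Rightarrow> 'a \<Rightarrow> 'a \<Rightarrow> 'a \<Rightarrow> 'a \<Rightarrow> 'a \<Rightarrow> 'a \<Rightarrow> 3 \<times> 3 \<Rightarrow> 'a" where
  "pivot_matrix x d n m w r a c = (let b = d * w - n * m in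
     matrix9 x ((x * a - d) / b) ((x * c - n) / b) b a c r ((m + a * r) / b) ((w + c * r) / b))"

definition pivot_point :: "'k :: field mat3_poly set \<Rightarrow> 3 \<times> 3 \<Rightarrow> 'k rational_function" where
  "pivot_point I = (let
     x = coordinate 0; d = coordinate 1; w = coordinate 4;
     m = (if minor 1 2 0 1 \<in> I then 0 else coordinate 3); r = (if mvar 2 0 \<in> I then 0 else coordinate 5)
   in if mvar 0 2 \<in> I then
        let c = (if minor 0 1 1 2 \<in> I then 0 else coordinate 7) in pivot_matrix x d (x * c) m w r (coordinate 6) c
      else if minor 0 1 1 2 \<in> I then
        let n = coordinate 2; t = coordinate 6 / (d * w - n * m) in pivot_matrix x d n m w r (t * d) (t * n)
      else pivot_matrix x d (coordinate 2) m w r (coordinate 6) (coordinate 7))"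

lemma pivot_at:
  fixes x d n m w r a c :: "'k :: field rational_function"
  assumes "d * w - n * m \<noteq> 0"
  shows "psubst const_fraction (pivot_matrix x d n m w r a c) Det = 1"
    "psubst const_fraction (pivot_matrix x d n m w r a c) (minor 0 1 0 1) = d"
    "psubst const_fraction (pivot_matrix x d n m w r a c) (minor 0 1 0 2) = n"
    "psubst const_fraction (pivot_matrix x d n m w r a c) (minor 1 2 0 1) = m"
    "psubst const_fraction (pivot_matrix x d n m w r a c) (minor 1 2 0 2) = w"
    "psubst const_fraction (pivot_matrix x d n m w r a c) (minor 0 1 1 2) = (n * a - d * c) / (d * w - n * m)"
    "psubst const_fraction (pivot_matrix x d n m w r a c) (mvar 0 0) = x"
    "psubst const_fraction (pivot_matrix x d n m w r a c) (mvar 0 1) = (x * a - d) / (d * w - n * m)"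
    "psubst const_fraction (pivot_matrix x d n m w r a c) (mvar 0 2) = (x * c - n) / (d * w - n * m)"
    "psubst const_fraction (pivot_matrix x d n m w r a c) (mvar 1 0) = d * w - n * m"
    "psubst const_fraction (pivot_matrix x d n m w r a c) (mvar 1 1) = a"
    "psubst const_fraction (pivot_matrix x d n m w r a c) (mvar 1 2) = c"
    "psubst const_fraction (pivot_matrix x d n m w r a c) (mvar 2 0) = r"
    "psubst const_fraction (pivot_matrix x d n m w r a c) (mvar 2 1) = (m + a * r) / (d * w - n * m)"
proof -
  define b where "b = d * w - n * m"
  have b: "b \<noteq> 0" using assms by (simp add: b_def)
  have P: "pivot_matrix x d n m w r a c =
      matrix9 x ((x * a - d) / b) ((x * c - n) / b) b a c r ((m + a * r) / b) ((w + c * r) / b)"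
    by (simp add: pivot_matrix_def b_def Let_def)
  define p q s t where "p = (x * a - d) / b" and "q = (x * c - n) / b" and "s = (m + a * r) / b" and "t = (w + c * r) / b"
  have 1: "b * p = x * a - d" "b * q = x * c - n" "b * s = m + a * r" "b * t = w + c * r"
    using b by (simp_all add: p_def q_def s_def t_def)
  have "b * (x * a * t + p * c * r + q * b * s - x * c * s - p * b * t - q * a * r)
    = x * a * (b * t) + (b * p) * c * r + (b * q) * (b * s) - x * c * (b * s) - (b * p) * (b * t) - (b * q) * a * r"
    by (simp add: algebra_simps)
  also have "\<dots> = d * w - n * m" unfolding 1 by (simp add: algebra_simps)
  also have "\<dots> = b * 1" by (simp add: b_def)
  finally have "x * a * t + p * c * r + q * b * s - x * c * s - p * b * t - q * a * r = 1"
    using mult_left_cancel [OF b] by blast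
  then show "psubst const_fraction (pivot_matrix x d n m w r a c) Det = 1"
    unfolding P Det_at p_def q_def s_def t_def .
  show "psubst const_fraction (pivot_matrix x d n m w r a c) (minor 0 1 1 2) = (n * a - d * c) / (d * w - n * m)"
    unfolding b_def [symmetric] P using b by (simp add: minor_at field_simps)
qed (use assms in \<open>simp_all add: pivot_matrix_def Let_def minor_at rat.psubst_hom\<close>)

text \<open>
  At the point with \<open>[0 1|0 1] = [1 2|0 2] = 1\<close> and all other coordinates \<open>0\<close>, the three functions
  take the values \<open>1\<close>, \<open>- 1\<close> and \<open>- 1\<close>.
\<close>

lemma pivot_nonzero:
  fixes m n a :: "'k :: field rational_function"
  assumes "m = 0 \<or> m = coordinate 3" "n = coordinate 2 \<or> n = coordinate 0 * c" "c = 0 \<or> c = coordinate 7"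
  shows "coordinate 1 * coordinate 4 - n * m \<noteq> 0" "coordinate 0 * coordinate 6 - coordinate 1 \<noteq> (0 :: 'k rational_function)"
    "coordinate 0 * coordinate 6 - (coordinate 1 * coordinate 4 - n * m) \<noteq> 0"
proof -
  let ?y = "\<lambda>v. if v = Suc 0 \<or> v = 4 then 1 else 0 :: (nat \<Rightarrow>\<^sub>0 nat) \<Rightarrow>\<^sub>0 'k"
  note h = coordinate_def to_fract_mult [symmetric] to_fract_diff [symmetric]
  have "\<exists>M. m = to_fract M \<and> psubst coeff_poly ?y M = 0"
    using assms(1)
  proof
    assume "m = 0"
    then show ?thesis by (intro exI [of _ 0]) simp
  next
    assume "m = coordinate 3"
    then show ?thesis by (intro exI [of _ "var_poly 3"]) (simp add: coordinate_def)
  qed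
  then obtain M where M: "m = to_fract M" "psubst coeff_poly ?y M = 0" by blast
  have "\<exists>C. c = to_fract C" using assms(3) to_fract_0 coordinate_def by metis
  then obtain C where "c = to_fract C" by blast
  then have "n = to_fract (var_poly 2) \<or> n = to_fract (var_poly 0 * C)"
    using assms(2) by (simp add: coordinate_def)
  then obtain N where N: "n = to_fract N" by blast
  show "coordinate 1 * coordinate 4 - n * m \<noteq> 0"
    unfolding M(1) N h by (rule nonzero_by_value [where y = ?y]) (simp add: coeff.psubst_diff coeff.psubst_mult M(2))
  show "coordinate 0 * coordinate 6 - coordinate 1 \<noteq> (0 :: 'k rational_function)"
    unfolding h by (rule nonzero_by_value [where y = ?y]) (simp add: coeff.psubst_diff coeff.psubst_mult)
  show "coordinate 0 * coordinate 6 - (coordinate 1 * coordinate 4 - n * m) \<noteq> 0"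
    unfolding M(1) N h by (rule nonzero_by_value [where y = ?y]) (simp add: coeff.psubst_diff coeff.psubst_mult M(2))
qed

lemma pivot_chart:
  fixes I :: "'k :: field_char_0 mat3_poly set"
  assumes I: "hprime I" and out: "mvar 1 0 \<notin> I" "mvar 0 1 \<notin> I"
  shows "chart I (mvar 1 0) (pivot_vars I) (pivot_free I) (pivot_point I)"
proof -
  let ?e = "mvar 1 0 :: 'k mat3_poly"
  define S where "S = psubst const_poly (pivot_vars I) ` polys_in (pivot_free I)"
  note i = hprimeD(2) [OF I] and det = poisson_stableD(2) [OF hprimeD(1) [OF I]]
  have varS: "pivot_vars I v \<in> S" if "v \<in> pivot_free I" for v
    unfolding S_def using that by (rule psubst_image_mem)
  have S: "subring_set S" unfolding S_def by (rule psubst_image_subring)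
  have s00: "mvar 0 0 \<in> S" and sD: "minor 0 1 0 1 \<in> S" and sW: "minor 1 2 0 2 \<in> S"
    using varS [of 0] varS [of 1] varS [of 4] by (simp_all add: pivot_vars_def pivot_free_def)
  have corner12: "mvar 1 2 \<in> I" if "mvar 0 2 \<in> I" "minor 0 1 1 2 \<in> I"
    using corner_minor_mem(2) [OF I that(1)] that(2) out(2) by blast
  define n where "n = (if mvar 0 2 \<in> I then mvar 0 0 * (if minor 0 1 1 2 \<in> I then 0 else mvar 1 2) else minor 0 1 0 2 :: 'k mat3_poly)"
  define m where "m = (if minor 1 2 0 1 \<in> I then 0 else minor 1 2 0 1 :: 'k mat3_poly)"
  have mS: "m \<in> S" using varS [of 3] subring_setD(2) [OF S] by (simp add: m_def pivot_vars_def pivot_free_def)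
  have nS: "n \<in> S"
    using varS [of 2] varS [of 7] s00 subring_setD(2,4) [OF S] by (simp add: n_def pivot_vars_def pivot_free_def)
  have mI: "minor 1 2 0 1 - m \<in> I" using ideal_setD(1) [OF i] by (simp add: m_def)
  have nI: "minor 0 1 0 2 - n \<in> I"
  proof (cases "mvar 0 2 \<in> I")
    case True
    then have 1: "mvar 0 2 * mvar 1 0 \<in> I" by (rule ideal_setD(4) [OF i])
    have 2: "mvar 0 0 * mvar 1 2 \<in> I" if "minor 0 1 1 2 \<in> I" using corner12 [OF True that] by (rule ideal_setD(3) [OF i])
    show ?thesis using ideal_setD(5) [OF i 1] ideal_setD(6) [OF i 2 1] True by (simp add: n_def minor_def)
  next
    case False
    then show ?thesis using ideal_setD(1) [OF i] by (simp add: n_def)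
  qed
  have pivot_eq: "?e - (minor 0 1 0 1 * minor 1 2 0 2 - n * m) \<in> I"
  proof -
    have "?e - (minor 0 1 0 1 * minor 1 2 0 2 - n * m) =
        - (mvar 1 0 * (Det - 1)) - ((minor 0 1 0 2 - n) * minor 1 2 0 1 + n * (minor 1 2 0 1 - m))"
      by (simp add: minor_def Det_expand algebra_simps)
    moreover have "- (mvar 1 0 * (Det - 1)) - ((minor 0 1 0 2 - n) * minor 1 2 0 1 + n * (minor 1 2 0 1 - m)) \<in> I"
      using det nI mI ideal_setD(2-6) [OF i] by presburger
    ultimately show ?thesis by simp
  qed
  interpret chart_data I ?e "pivot_vars I" "pivot_free I"
  proof
    have "minor 0 1 0 1 * minor 1 2 0 2 - n * m \<in> S" using sD sW nS mS subring_setD(3,4) [OF S] by simp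
    with pivot_eq show "\<exists>s\<in>psubst const_poly (pivot_vars I) ` polys_in (pivot_free I). ?e - s \<in> I"
      unfolding S_def [symmetric] by blast
  qed (rule I)
  have mem: "clearable s" if "s \<in> S" for s using that unfolding S_def by (rule clearable_mem)
  have free: "clearable (pivot_vars I v)" if "v \<in> pivot_free I" for v by (rule mem [OF varS [OF that]])
  note m00 = mem [OF s00] and D = mem [OF sD] and W = mem [OF sW]
  have M: "clearable (minor 1 2 0 1)" by (rule clearable_cong [OF mI mem [OF mS]])
  have N: "clearable (minor 0 1 0 2)" by (rule clearable_cong [OF nI mem [OF nS]])
  have m10: "clearable ?e"
    using clearable_cong [OF pivot_eq] clearable_ring(2,3) D W mem [OF nS] mem [OF mS] by blast
  have m20: "clearable (mvar 2 0)"
    using free [of 5] clearable_ideal by (cases "mvar 2 0 \<in> I") (auto simp: pivot_vars_def pivot_free_def)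
  have div: "clearable x" if "clearable (mvar 1 0 * x)" for x by (rule clearable_divide [OF that clearable_1]) simp
  have m1: "clearable (mvar 1 1) \<and> clearable (mvar 1 2)"
  proof (cases "minor 0 1 1 2 \<in> I")
    case False
    then show ?thesis using free [of 6] free [of 7] by (simp add: pivot_vars_def pivot_free_def)
  next
    case M': True
    show ?thesis
    proof (cases "mvar 0 2 \<in> I")
      case True
      then show ?thesis using free [of 6] clearable_ideal [OF corner12 [OF True M']]
        by (simp add: pivot_vars_def pivot_free_def)
    next
      case False
      define t where "t = mvar 1 1 * minor 1 2 0 2 - mvar 1 2 * (minor 1 2 0 1 :: 'k mat3_poly)"
      have t: "clearable t" using free [of 6] False M' by (simp add: pivot_vars_def pivot_free_def t_def)
      have eq: "mvar 1 0 * mvar 1 1 - t * minor 0 1 0 1 =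
          - (mvar 1 0 * mvar 1 1) * (Det - 1) - minor 1 2 0 1 * mvar 1 0 * (minor 0 1 1 2 :: 'k mat3_poly)"
        by (simp add: t_def minor_def Det_expand algebra_simps)
      have "mvar 1 0 * mvar 1 1 - t * minor 0 1 0 1 \<in> I"
        unfolding eq by (rule ideal_setD(6) [OF i ideal_setD(3) [OF i det] ideal_setD(3) [OF i M']])
      then have 1: "clearable (mvar 1 0 * mvar 1 1)" using clearable_mult [OF t D] by (rule clearable_cong)
      have eq: "mvar 1 0 * mvar 1 2 - t * minor 0 1 0 2 =
          - (mvar 1 0 * mvar 1 2) * (Det - 1) - minor 1 2 0 2 * mvar 1 0 * (minor 0 1 1 2 :: 'k mat3_poly)"
        by (simp add: t_def minor_def Det_expand algebra_simps)
      have "mvar 1 0 * mvar 1 2 - t * minor 0 1 0 2 \<in> I"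
        unfolding eq by (rule ideal_setD(6) [OF i ideal_setD(3) [OF i det] ideal_setD(3) [OF i M']])
      then have 2: "clearable (mvar 1 0 * mvar 1 2)" using clearable_mult [OF t N] by (rule clearable_cong)
      from div [OF 1] div [OF 2] show ?thesis ..
    qed
  qed
  then have m11: "clearable (mvar 1 1)" and m12: "clearable (mvar 1 2)" by blast+
  have "clearable (mvar 1 0 * mvar 0 1)"
    using clearable_diff [OF clearable_mult [OF m00 m11] D] by (simp add: minor_def mult.commute)
  then have m01: "clearable (mvar 0 1)" by (rule div)
  have "clearable (mvar 1 0 * mvar 0 2)"
    using clearable_diff [OF clearable_mult [OF m00 m12] N] by (simp add: minor_def mult.commute)
  then have m02: "clearable (mvar 0 2)" by (rule div)
  have "clearable (mvar 1 0 * mvar 2 1)"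
    using clearable_add [OF M clearable_mult [OF m11 m20]] by (simp add: minor_def)
  then have m21: "clearable (mvar 2 1)" by (rule div)
  have "clearable (mvar 1 0 * mvar 2 2)"
    using clearable_add [OF W clearable_mult [OF m12 m20]] by (simp add: minor_def)
  then have m22: "clearable (mvar 2 2)" by (rule div)
  have all: "clearable (mvar i j)" for i j
    using num3_cases [of i] num3_cases [of j] m00 m01 m02 m10 m11 m12 m20 m21 m22 by auto
  define M where "M = (if minor 1 2 0 1 \<in> I then 0 else coordinate 3 :: 'k rational_function)"
  define r where "r = (if mvar 2 0 \<in> I then 0 else coordinate 5 :: 'k rational_function)"
  define c where "c = (if minor 0 1 1 2 \<in> I then 0 else coordinate 7 :: 'k rational_function)"
  define n where "n = (if mvar 0 2 \<in> I then coordinate 0 * c else coordinate 2)"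
  define b where "b = coordinate 1 * coordinate 4 - n * M"
  define t where "t = (mvar 0 2 \<notin> I \<and> minor 0 1 1 2 \<in> I)"
  define a where "a = (if t then coordinate 6 / b * coordinate 1 else coordinate 6)"
  define c' where "c' = (if t then coordinate 6 / b * n else c)"
  have P: "pivot_point I = pivot_matrix (coordinate 0) (coordinate 1) n M (coordinate 4) r a c'"
    by (simp add: pivot_point_def Let_def M_def r_def c_def n_def b_def t_def a_def c'_def)
  have nz: "b \<noteq> 0" "coordinate 0 * coordinate 6 - coordinate 1 \<noteq> (0 :: 'k rational_function)"
    "coordinate 0 * coordinate 6 - b \<noteq> 0"
    using pivot_nonzero [of M n c] by (auto simp: b_def M_def n_def c_def)
  note at = pivot_at [OF nz(1) [unfolded b_def], where x = "coordinate 0" and r = r and a = a and c = c', folded P b_def]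
  have m01_nz: "coordinate 0 * a - coordinate 1 \<noteq> 0"
  proof (cases t)
    case True
    have "b * (coordinate 0 * a - coordinate 1) = coordinate 1 * (coordinate 0 * coordinate 6 - b)"
      using True nz(1) by (simp add: a_def field_simps)
    moreover have "coordinate 1 * (coordinate 0 * coordinate 6 - b) \<noteq> 0" using nz(3) by simp
    ultimately show ?thesis by auto
  qed (use nz(2) in \<open>simp add: a_def\<close>)
  show ?thesis
  proof
    show "finite (pivot_free I)" by (simp add: pivot_free_def)
    show "\<exists>w. weight w ?e" using weight_mvar by blast
    show "?e \<notin> I" by (rule out)
    show "psubst const_fraction (pivot_point I) Det = 1" by (rule at)
    show "psubst const_fraction (pivot_point I) (chart_denominator I) \<noteq> 0"
      using nz m01_nz by (simp add: chart_denominator_def out rat.psubst_mult at)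
    show "psubst const_fraction (pivot_point I) (pivot_vars I v) = coordinate v" if "v \<in> pivot_free I" for v
    proof -
      have "v < 8" using that by (simp add: pivot_free_def)
      have 6: "coordinate 6 / b * coordinate 1 * coordinate 4 - coordinate 6 / b * n * M = (coordinate 6 :: 'k rational_function)"
      proof -
        have "coordinate 6 / b * coordinate 1 * coordinate 4 - coordinate 6 / b * n * M = coordinate 6 / b * b"
          by (simp add: b_def right_diff_distrib mult.assoc)
        then show ?thesis using nz(1) by simp
      qed
      from less_8_cases [OF \<open>v < 8\<close>] that 6 show ?thesis
        by (elim disjE)
          (simp_all add: pivot_vars_def pivot_free_def at rat.psubst_diff rat.psubst_mult a_def c'_def t_def n_def M_def r_def c_def
            split: if_splits)
    qed
    show "psubst const_fraction (pivot_point I) g = 0" if g: "g \<in> corner_elements" "g \<in> I" for g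
    proof -
      have t0: "n * a - coordinate 1 * c' = 0" if "minor 0 1 1 2 \<in> I"
        using that by (cases t) (auto simp: a_def c'_def t_def n_def c_def)
      show ?thesis
        using g t0 out subdiagonal_mem [OF I] corner_minor_mem [OF I] unfolding corner_elements_def
        by (elim insertE; simp add: at M_def r_def) (auto simp: c'_def t_def n_def c_def)
    qed
    show "clearable (mvar i j)" for i j by (rule all)
  qed
qed

subsection \<open>Pivot in the lower left corner\<close>

text \<open>
  A chart in which only \<open>x 2 0\<close> is inverted, for the case that \<open>I\<close> contains none of the corner
  elements. With \<open>Det = 1\<close>, one has \<open>x 2 0 = [0 2|0 1] * [1 2|0 2] - [0 2|0 2] * [1 2|0 1]\<close>. The first
  column and the last row are given, and the other entries are obtained by dividing by \<open>x 2 0\<close>.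
\<close>

definition generic_vars :: "nat \<Rightarrow> 'k :: comm_ring_1 mat3_poly" where
  "generic_vars v = [mvar 0 0, mvar 1 0, mvar 2 1, mvar 2 2, minor 0 2 0 1, minor 0 2 0 2, minor 1 2 0 1, minor 1 2 0 2] ! v"

definition generic_pivot :: "'k :: field rational_function" where
  "generic_pivot = coordinate 4 * coordinate 7 - coordinate 5 * coordinate 6"

definition generic_point :: "3 \<times> 3 \<Rightarrow> 'k :: field rational_function" where
  "generic_point = (let b = generic_pivot; x = coordinate 0; y = coordinate 1; s = coordinate 2; t = coordinate 3 in
     matrix9 x ((x * s - coordinate 4) / b) ((x * t - coordinate 5) / b)
       y ((y * s - coordinate 6) / b) ((y * t - coordinate 7) / b) b s t)"

lemma generic_nonzero:
  "generic_pivot \<noteq> (0 :: 'k :: field rational_function)"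
  "coordinate 0 * coordinate 2 - coordinate 4 \<noteq> (0 :: 'k rational_function)"
  "coordinate 1 * coordinate 4 - coordinate 0 * coordinate 6 \<noteq> (0 :: 'k rational_function)"
proof -
  let ?y = "\<lambda>v. if v = Suc 0 \<or> v = 4 \<or> v = 7 then 1 else 0 :: (nat \<Rightarrow>\<^sub>0 nat) \<Rightarrow>\<^sub>0 'k"
  note h = coordinate_def to_fract_mult [symmetric] to_fract_diff [symmetric]
  show "generic_pivot \<noteq> (0 :: 'k rational_function)"
    unfolding generic_pivot_def h by (rule nonzero_by_value [where y = ?y]) (simp add: coeff.psubst_diff coeff.psubst_mult)
  show "coordinate 0 * coordinate 2 - coordinate 4 \<noteq> (0 :: 'k rational_function)"
    unfolding h by (rule nonzero_by_value [where y = ?y]) (simp add: coeff.psubst_diff coeff.psubst_mult)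
  show "coordinate 1 * coordinate 4 - coordinate 0 * coordinate 6 \<noteq> (0 :: 'k rational_function)"
    unfolding h by (rule nonzero_by_value [where y = ?y]) (simp add: coeff.psubst_diff coeff.psubst_mult)
qed

lemma generic_Det: "psubst const_fraction generic_point Det = (1 :: 'k :: field rational_function)"
proof -
  define b x y s t k l m n where "b = (generic_pivot :: 'k rational_function)" and "x = (coordinate 0 :: 'k rational_function)"
    and "y = (coordinate 1 :: 'k rational_function)" and "s = (coordinate 2 :: 'k rational_function)"
    and "t = (coordinate 3 :: 'k rational_function)" and "k = (coordinate 4 :: 'k rational_function)"
    and "l = (coordinate 5 :: 'k rational_function)" and "m = (coordinate 6 :: 'k rational_function)"
    and "n = (coordinate 7 :: 'k rational_function)"
  note vars = b_def x_def y_def s_def t_def k_def l_def m_def n_def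
  have b: "b \<noteq> 0" using generic_nonzero(1) by (simp add: b_def)
  have bb: "b = k * n - l * m" by (simp add: vars generic_pivot_def)
  define p q u v where "p = (x * s - k) / b" and "q = (x * t - l) / b" and "u = (y * s - m) / b" and "v = (y * t - n) / b"
  have 1: "b * p = x * s - k" "b * q = x * t - l" "b * u = y * s - m" "b * v = y * t - n"
    using b by (simp_all add: p_def q_def u_def v_def)
  have "b * (x * u * t + p * v * b + q * y * s - x * v * s - p * y * t - q * u * b)
    = x * (b * u) * t + (b * p) * (b * v) + (b * q) * y * s - x * (b * v) * s - (b * p) * y * t - (b * q) * (b * u)"
    by (simp add: algebra_simps)
  also have "\<dots> = k * n - l * m" unfolding 1 by (simp add: algebra_simps)
  also have "\<dots> = b * 1" by (simp add: bb)
  finally have "x * u * t + p * v * b + q * y * s - x * v * s - p * y * t - q * u * b = 1"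
    using mult_left_cancel [OF b] by blast
  then show ?thesis
    unfolding generic_point_def Let_def Det_at unfolding p_def q_def u_def v_def unfolding vars .
qed

lemma generic_chart:
  fixes I :: "'k :: field_char_0 mat3_poly set"
  assumes I: "hprime I" and out: "mvar 2 0 \<notin> I" "minor 1 2 0 1 \<notin> I" "mvar 0 2 \<notin> I" "minor 0 1 1 2 \<notin> I"
  shows "chart I (mvar 2 0) generic_vars {..<8} generic_point"
proof -
  let ?e = "mvar 2 0 :: 'k mat3_poly"
  define S :: "'k mat3_poly set" where "S = psubst const_poly generic_vars ` polys_in {..<8}"
  note i = hprimeD(2) [OF I] and det = poisson_stableD(2) [OF hprimeD(1) [OF I]]
  have varS: "generic_vars v \<in> S" if "v < 8" for v
    unfolding S_def using that psubst_image_mem(1) [of v "{..<8}" generic_vars] by simp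
  have S: "subring_set S" unfolding S_def using psubst_image_subring by simp
  have s: "mvar 0 0 \<in> S" "mvar 1 0 \<in> S" "mvar 2 1 \<in> S" "mvar 2 2 \<in> S" "minor 0 2 0 1 \<in> S" "minor 0 2 0 2 \<in> S"
    "minor 1 2 0 1 \<in> S" "minor 1 2 0 2 \<in> S"
    using varS [of 0] varS [of 1] varS [of 2] varS [of 3] varS [of 4] varS [of 5] varS [of 6] varS [of 7]
    by (simp_all add: generic_vars_def)
  have pivot_eq: "?e - (minor 0 2 0 1 * minor 1 2 0 2 - minor 0 2 0 2 * minor 1 2 0 1) \<in> I"
  proof -
    have "?e - (minor 0 2 0 1 * minor 1 2 0 2 - minor 0 2 0 2 * minor 1 2 0 1) = - (mvar 2 0) * (Det - 1)"
      by (simp add: minor_def Det_expand algebra_simps)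
    then show ?thesis using ideal_setD(3) [OF i det] by metis
  qed
  interpret chart_data I ?e generic_vars "{..<8}"
  proof
    have "minor 0 2 0 1 * minor 1 2 0 2 - minor 0 2 0 2 * minor 1 2 0 1 \<in> S" using s subring_setD(3,4) [OF S] by simp
    with pivot_eq show "\<exists>s\<in>psubst const_poly generic_vars ` polys_in {..<8}. ?e - s \<in> I"
      unfolding S_def by blast
  qed (rule I)
  have mem: "clearable s" if "s \<in> S" for s using that unfolding S_def by (intro clearable_mem) simp
  note c = s [THEN mem]
  have m20: "clearable ?e"
    by (rule clearable_cong [OF pivot_eq]) (intro clearable_ring c)
  have div: "clearable x" if "clearable (mvar 2 0 * x)" for x by (rule clearable_divide [OF that clearable_1]) simp
  have "clearable (mvar 2 0 * mvar 0 1)" "clearable (mvar 2 0 * mvar 0 2)" "clearable (mvar 2 0 * mvar 1 1)"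
    "clearable (mvar 2 0 * mvar 1 2)"
    using clearable_diff [OF clearable_mult [OF c(1,3)] c(5)] clearable_diff [OF clearable_mult [OF c(1,4)] c(6)]
      clearable_diff [OF clearable_mult [OF c(2,3)] c(7)] clearable_diff [OF clearable_mult [OF c(2,4)] c(8)]
    by (simp_all add: minor_def mult.commute)
  note d = this [THEN div]
  have all: "clearable (mvar i j)" for i j
    using num3_cases [of i] num3_cases [of j] c d m20 by auto
  have corner_out: "g \<notin> I" if "g \<in> corner_elements" for g
    using that out subdiagonal_mem [OF I] unfolding corner_elements_def by auto
  note nz = generic_nonzero [where 'k = 'k]
  show ?thesis
  proof
    show "\<exists>w. weight w ?e" using weight_mvar by blast
    show "?e \<notin> I" by (rule out)
    show "psubst const_fraction generic_point Det = (1 :: 'k rational_function)" by (rule generic_Det)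
    have D: "psubst const_fraction generic_point (minor 0 1 0 1) = (coordinate 1 * coordinate 4 - coordinate 0 * coordinate 6) / (generic_pivot :: 'k rational_function)"
      using nz(1) by (simp add: generic_point_def Let_def minor_at field_simps)
    have "psubst const_fraction generic_point (mvar 0 0) = (coordinate 0 :: 'k rational_function)"
      "psubst const_fraction generic_point (mvar 1 0) = (coordinate 1 :: 'k rational_function)"
      "psubst const_fraction generic_point (mvar 0 1) = (coordinate 0 * coordinate 2 - coordinate 4) / (generic_pivot :: 'k rational_function)"
      by (simp_all add: generic_point_def Let_def rat.psubst_mvar)
    with D nz show "psubst const_fraction generic_point (chart_denominator I) \<noteq> 0"
      by (simp add: chart_denominator_def rat.psubst_mult)
    show "psubst const_fraction generic_point (generic_vars v) = (coordinate v :: 'k rational_function)" if v: "v \<in> {..<8}" for v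
    proof -
      have "v < 8" using v by simp
      from less_8_cases [OF this] show ?thesis
        using nz(1) by (elim disjE) (simp_all add: generic_vars_def generic_point_def Let_def minor_at rat.psubst_mvar)
    qed
    show "psubst const_fraction generic_point g = 0" if "g \<in> corner_elements" "g \<in> I" for g using corner_out that by blast
    show "clearable (mvar i j)" for i j by (rule all)
  qed simp
qed


section \<open>The upper left entry is prime or a unit\<close>

context poisson_involution
begin

text \<open>
  \<open>\<theta>\<close> induces an automorphism of the quotient by \<open>Det - 1\<close>, and this carries the preimage of \<open>I\<close> to \<open>I\<close>.
\<close>

lemma prime_or_unit_mod_vimage:
  assumes I: "poisson_stable I" and p: "prime_or_unit_mod {f. \<theta> f \<in> I} p"
  shows "prime_or_unit_mod I (\<theta> p)"
  unfolding prime_or_unit_mod_def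
proof (intro allI impI)
  have descend: "\<exists>s. g - \<theta> p * s \<in> I" if "\<theta> g - p * s \<in> {f. \<theta> f \<in> I}" for g s
  proof -
    have 1: "\<theta> (\<theta> g) - \<theta> p * \<theta> s \<in> I" using that by (simp add: const.psubst_hom)
    obtain r where "\<theta> (\<theta> g) - g = r * (Det - 1)" using theta_theta by blast
    then have 2: "\<theta> (\<theta> g) - g \<in> I" using poisson_stableD(1,2) [OF I] by (simp add: ideal_setD(3))
    from ideal_setD(6) [OF poisson_stableD(1) [OF I] 1 2] have "g - \<theta> p * \<theta> s \<in> I" by simp
    then show ?thesis by blast
  qed
  fix g h r assume gh: "g * h - \<theta> p * r \<in> I"
  have "\<theta> (\<theta> (g * h - \<theta> p * r)) \<in> I" using gh theta_theta_iff [OF I] by blast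
  then have 1: "\<theta> (\<theta> (g * h) - p * \<theta> r) - \<theta> ((\<theta> (\<theta> p) - p) * \<theta> r) \<in> I"
    by (simp add: const.psubst_hom algebra_simps)
  obtain q where q: "\<theta> (\<theta> p) - p = q * (Det - 1)" using theta_theta by blast
  have "Det - 1 \<in> {f. \<theta> f \<in> I}" by (rule poisson_stableD(2) [OF poisson_stable_vimage [OF I]])
  then have "\<theta> (q * (Det - 1) * \<theta> r) \<in> I"
    using ideal_setD(3,4) [OF poisson_stableD(1) [OF poisson_stable_vimage [OF I]]] by blast
  then have 2: "\<theta> ((\<theta> (\<theta> p) - p) * \<theta> r) \<in> I" unfolding q .
  from ideal_setD(2) [OF poisson_stableD(1) [OF I] 1 2]
  have "\<theta> (\<theta> (g * h) - p * \<theta> r) \<in> I" by simp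
  then have "\<theta> g * \<theta> h - p * \<theta> r \<in> {f. \<theta> f \<in> I}" by (simp add: const.psubst_mult)
  then obtain s where "\<theta> g - p * s \<in> {f. \<theta> f \<in> I} \<or> \<theta> h - p * s \<in> {f. \<theta> f \<in> I}"
    using p unfolding prime_or_unit_mod_def by blast
  then show "\<exists>s. g - \<theta> p * s \<in> I \<or> h - \<theta> p * s \<in> I" using descend by blast
qed

end

lemma Det_first_column: "Det = mvar 0 0 * (mvar 1 1 * mvar 2 2 - mvar 1 2 * mvar 2 1)
    + mvar 1 0 * (mvar 0 2 * mvar 2 1 - mvar 0 1 * mvar 2 2) + mvar 2 0 * (minor 0 1 1 2 :: 'k :: comm_ring_1 mat3_poly)"
  by (simp add: Det_expand minor_def algebra_simps)

text \<open>
  In the chart with coordinate \<open>x 0 0\<close>, a power product of \<open>x 1 0\<close> and \<open>x 2 0\<close> is nonzero at a point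
  where \<open>x 0 0\<close> vanishes.
\<close>

lemma generic_pivot_not_divisible:
  fixes I :: "'k :: field_char_0 mat3_poly set"
  assumes "chart I (mvar 2 0) generic_vars {..<8} generic_point"
  shows "mvar 2 0 ^ m * mvar 1 0 ^ n - mvar 0 0 * r \<notin> I"
proof
  interpret chart I "mvar 2 0" generic_vars "{..<8}" generic_point by fact
  assume "mvar 2 0 ^ m * mvar 1 0 ^ n - mvar 0 0 * r \<in> I"
  from Phi_cong [OF this] have eq: "generic_pivot ^ m * coordinate 1 ^ n = coordinate 0 * \<Phi> r"
    by (simp add: rat.psubst_hom generic_point_def Let_def)
  obtain l G where G: "\<Phi> (mvar 2 0) ^ l * \<Phi> r = to_fract G" using cleared [of r] by blast
  have "\<Phi> (mvar 2 0) = generic_pivot" by (simp add: rat.psubst_hom generic_point_def Let_def)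
  then have "generic_pivot ^ l * (generic_pivot ^ m * coordinate 1 ^ n) = coordinate 0 * to_fract G"
    unfolding eq using G by (simp add: ac_simps)
  then have "to_fract ((var_poly 4 * var_poly 7 - var_poly 5 * var_poly 6) ^ l *
      ((var_poly 4 * var_poly 7 - var_poly 5 * var_poly 6) ^ m * var_poly 1 ^ n)) = to_fract (var_poly 0 * G)"
    by (simp add: generic_pivot_def coordinate_def to_fract_power)
  then have "(var_poly 4 * var_poly 7 - var_poly 5 * var_poly 6) ^ l *
      ((var_poly 4 * var_poly 7 - var_poly 5 * var_poly 6) ^ m * var_poly 1 ^ n) = var_poly 0 * G"
    by (simp only: to_fract_eq_iff)
  from arg_cong [OF this, of "psubst coeff_poly (\<lambda>v. if v = Suc 0 \<or> v = 4 \<or> v = 7 then 1 else 0 :: (nat \<Rightarrow>\<^sub>0 nat) \<Rightarrow>\<^sub>0 'k)"]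
  show False by (simp add: coeff.psubst_hom)
qed

text \<open>
  Modulo \<open>x 0 0\<close>, the expansion of \<open>Det = 1\<close> along the first column reads
  \<open>x 1 0 * c + x 2 0 * [0 1|1 2] = 1\<close> for some \<open>c\<close>.

  If \<open>x 1 0 \<in> I\<close>, then also \<open>x 2 0 \<in> I\<close>, and the full expansion shows that \<open>x 0 0\<close> is invertible; the
  case \<open>x 0 1 \<in> I\<close> is its transpose. Otherwise \<open>x 0 0\<close> is a prime coordinate on the chart where \<open>x 1 0\<close>
  is inverted. If \<open>x 2 0\<close> or \<open>[0 1|1 2]\<close> lies in \<open>I\<close>, then \<open>x 1 0\<close> is invertible modulo \<open>x 0 0\<close>, so that
  passing to the chart does not affect divisibility by \<open>x 0 0\<close>; again there is the transposed case.
  In the remaining case the second chart, where \<open>x 2 0\<close> is inverted, is available too: if \<open>x 0 0\<close>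
  divides a power of \<open>x 1 0\<close> times \<open>g\<close>, it divides a power of \<open>x 2 0\<close> times \<open>g\<close>, because it is prime in
  that chart and does not divide \<open>x 1 0\<close> there; and then \<open>x 0 0\<close> divides \<open>g\<close>, as \<open>x 1 0\<close> and \<open>x 2 0\<close> are
  comaximal modulo \<open>x 0 0\<close>.
\<close>

theorem corner_prime_or_unit:
  fixes I :: "'k :: field_char_0 mat3_poly set"
  assumes I: "hprime I"
  shows "prime_or_unit_mod I (mvar 0 0)"
proof -
  have unit: "prime_or_unit_mod J (mvar 0 0)" if J: "hprime J" and u: "mvar 0 0 * u - 1 \<in> J" for J :: "'k mat3_poly set" and u
    unfolding prime_or_unit_mod_def
  proof (intro allI impI)
    fix g h r
    have "- g * (mvar 0 0 * u - 1) \<in> J" using u by (rule ideal_setD(3) [OF hprimeD(2) [OF J]])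
    then have "g - mvar 0 0 * (u * g) \<in> J" by (simp add: algebra_simps)
    then show "\<exists>s. g - mvar 0 0 * s \<in> J \<or> h - mvar 0 0 * s \<in> J" by blast
  qed
  have unit_col: "prime_or_unit_mod J (mvar 0 0)" if J: "hprime J" and m: "mvar 1 0 \<in> J" for J :: "'k mat3_poly set"
  proof (rule unit [OF J])
    note j = hprimeD(2) [OF J]
    have "(Det - 1) - (mvar 1 0 * (mvar 0 2 * mvar 2 1 - mvar 0 1 * mvar 2 2) + mvar 2 0 * minor 0 1 1 2) \<in> J"
      using ideal_setD(6) [OF j poisson_stableD(2) [OF hprimeD(1) [OF J]]
          ideal_setD(2) [OF j ideal_setD(4) [OF j m] ideal_setD(4) [OF j subdiagonal_mem(1) [OF J m]]]] .
    then show "mvar 0 0 * (mvar 1 1 * mvar 2 2 - mvar 1 2 * mvar 2 1) - 1 \<in> J"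
      unfolding Det_first_column by (simp add: algebra_simps)
  qed
  have prime_col: "prime_or_unit_mod J (mvar 0 0)"
    if J: "hprime J" and out: "mvar 1 0 \<notin> J" "mvar 0 1 \<notin> J" and c: "mvar 2 0 \<in> J \<or> minor 0 1 1 2 \<in> J" for J :: "'k mat3_poly set"
    unfolding prime_or_unit_mod_def
  proof (intro allI impI)
    note j = hprimeD(2) [OF J]
    interpret chart J "mvar 1 0" "pivot_vars J" "pivot_free J" "pivot_point J" by (rule pivot_chart [OF J out])
    fix g h r assume gh: "g * h - mvar 0 0 * r \<in> J"
    have v0: "(0::nat) \<in> pivot_free J" "pivot_vars J 0 = mvar 0 0" by (simp_all add: pivot_free_def pivot_vars_def)
    define Q where "Q = {g. \<exists>s. g - mvar 0 0 * s \<in> J}"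
    have Q: "ideal_set Q" unfolding Q_def by (rule ideal_set_add_principal [OF j])
    have "\<exists>n. mvar 1 0 ^ n * g \<in> Q \<or> mvar 1 0 ^ n * h \<in> Q"
      using coordinate_prime [OF v0(1), unfolded v0(2), OF gh] unfolding Q_def by blast
    moreover have "1 - mvar 1 0 * (mvar 0 2 * mvar 2 1 - mvar 0 1 * mvar 2 2) \<in> Q"
    proof -
      have "mvar 2 0 * minor 0 1 1 2 \<in> J" using c ideal_setD(3,4) [OF j] by blast
      then have "mvar 2 0 * minor 0 1 1 2 - (Det - 1) \<in> J"
        using poisson_stableD(2) [OF hprimeD(1) [OF J]] by (rule ideal_setD(6) [OF j])
      then have "1 - mvar 1 0 * (mvar 0 2 * mvar 2 1 - mvar 0 1 * mvar 2 2)
          - mvar 0 0 * (mvar 1 1 * mvar 2 2 - mvar 1 2 * mvar 2 1) \<in> J"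
        unfolding Det_first_column by (simp add: algebra_simps)
      then show ?thesis unfolding Q_def by blast
    qed
    ultimately have "g \<in> Q \<or> h \<in> Q" using comaximal_cancel [OF Q] by blast
    then show "\<exists>s. g - mvar 0 0 * s \<in> J \<or> h - mvar 0 0 * s \<in> J" unfolding Q_def by blast
  qed
  have flip: "prime_or_unit_mod I (mvar 0 0)"
    if p: "prime_or_unit_mod {f. psubst const_poly (\<lambda>v. mvar (snd v) (fst v)) f \<in> I} (mvar 0 0)"
    using transpose.prime_or_unit_mod_vimage [OF hprimeD(1) [OF I] p] by (simp add: const.psubst_mvar)
  let ?J = "{f. psubst const_poly (\<lambda>v. mvar (snd v) (fst v)) f \<in> I}"
  have J: "hprime ?J" by (rule transpose.hprime_vimage [OF I])
  have mem: "mvar a b \<in> ?J \<longleftrightarrow> mvar b a \<in> I" for a b by (simp add: const.psubst_mvar)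
  have mem': "minor 0 1 1 2 \<in> ?J \<longleftrightarrow> minor 1 2 0 1 \<in> I"
    by (simp add: minor_def const.psubst_hom mult.commute)
  consider "mvar 1 0 \<in> I" | "mvar 0 1 \<in> I" | "mvar 1 0 \<notin> I" "mvar 0 1 \<notin> I" "mvar 2 0 \<in> I \<or> minor 0 1 1 2 \<in> I"
    | "mvar 1 0 \<notin> I" "mvar 0 1 \<notin> I" "mvar 0 2 \<in> I \<or> minor 1 2 0 1 \<in> I"
    | "mvar 1 0 \<notin> I" "mvar 0 1 \<notin> I" "mvar 2 0 \<notin> I" "minor 1 2 0 1 \<notin> I" "mvar 0 2 \<notin> I" "minor 0 1 1 2 \<notin> I" by blast
  then show ?thesis
  proof cases
    case 1
    then show ?thesis by (rule unit_col [OF I])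
  next
    case 2
    then show ?thesis by (intro flip unit_col [OF J]) (simp only: mem)
  next
    case 3
    then show ?thesis by (rule prime_col [OF I])
  next
    case 4
    then show ?thesis by (intro flip prime_col [OF J]) (simp_all only: mem mem' not_False_eq_True)
  next
    case 5
    note i = hprimeD(2) [OF I]
    have P: "chart I (mvar 1 0) (pivot_vars I) (pivot_free I) (pivot_point I)" by (rule pivot_chart [OF I 5(1,2)])
    have G: "chart I (mvar 2 0) generic_vars {..<8} generic_point" by (rule generic_chart [OF I 5(3-6)])
    have v0: "(0::nat) \<in> pivot_free I" "pivot_vars I 0 = mvar 0 0" "(0::nat) \<in> {..<8}" "generic_vars 0 = (mvar 0 0 :: 'k mat3_poly)"
      by (simp_all add: pivot_free_def pivot_vars_def generic_vars_def)
    define Q where "Q = {g. \<exists>s. g - mvar 0 0 * s \<in> I}"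
    have Q: "ideal_set Q" unfolding Q_def by (rule ideal_set_add_principal [OF i])
    have descend: "g \<in> Q" if g: "mvar 1 0 ^ n * g \<in> Q" for n g
    proof -
      obtain s where "mvar 1 0 ^ n * g - mvar 0 0 * s \<in> I" using g unfolding Q_def by blast
      from chart.coordinate_prime [OF G v0(3), unfolded v0(4), OF this]
      obtain m s where "mvar 2 0 ^ m * mvar 1 0 ^ n - mvar 0 0 * s \<in> I \<or> mvar 2 0 ^ m * g - mvar 0 0 * s \<in> I" by blast
      then have m: "mvar 2 0 ^ m * g \<in> Q" using generic_pivot_not_divisible [OF G] unfolding Q_def by blast
      \<comment> \<open>The elements with a power that carries \<open>g\<close> into \<open>Q\<close> form an ideal, which contains \<open>x 1 0\<close> and \<open>x 2 0\<close>.\<close>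
      define R where "R = {a. \<exists>n. a ^ n \<in> {a. a * g \<in> Q}}"
      have R: "ideal_set R" unfolding R_def
        using ideal_set_quotient [OF Q, of "{g}"] by (intro ideal_set_radical) simp
      have "mvar 1 0 \<in> R" "mvar 2 0 \<in> R" using g m by (auto simp: R_def)
      then have "mvar 1 0 * (mvar 0 2 * mvar 2 1 - mvar 0 1 * mvar 2 2) + mvar 2 0 * minor 0 1 1 2 \<in> R" (is "?a \<in> R")
        by (intro ideal_setD(2) [OF R] ideal_setD(4) [OF R])
      then obtain k where k: "?a ^ k * g \<in> Q" by (auto simp: R_def)
      have "- (Det - 1) \<in> I" using poisson_stableD(2) [OF hprimeD(1) [OF I]] by (rule ideal_setD(5) [OF i])
      then have "1 - ?a * 1 - mvar 0 0 * (mvar 1 1 * mvar 2 2 - mvar 1 2 * mvar 2 1) \<in> I"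
        unfolding Det_first_column by (simp add: algebra_simps)
      then have "1 - ?a * 1 \<in> Q" unfolding Q_def by blast
      then show ?thesis using k by (rule comaximal_cancel [OF Q])
    qed
    show ?thesis
      unfolding prime_or_unit_mod_def
    proof (intro allI impI)
      fix g h r assume "g * h - mvar 0 0 * r \<in> I"
      from chart.coordinate_prime [OF P v0(1), unfolded v0(2), OF this]
      have "\<exists>n. mvar 1 0 ^ n * g \<in> Q \<or> mvar 1 0 ^ n * h \<in> Q" unfolding Q_def by blast
      then have "g \<in> Q \<or> h \<in> Q" using descend by blast
      then show "\<exists>s. g - mvar 0 0 * s \<in> I \<or> h - mvar 0 0 * s \<in> I" unfolding Q_def by blast
    qed
  qed
qed


section \<open>Factorisation modulo a Poisson \<open>H\<close>-prime\<close>

lemma leading_minor_prime_or_unit: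
  fixes I :: "'k :: field_char_0 mat3_poly set"
  assumes I: "hprime I"
  shows "prime_or_unit_mod I (minor 0 1 0 1)"
  using cofactor.prime_or_unit_mod_vimage [OF hprimeD(1) [OF I] corner_prime_or_unit [OF cofactor.hprime_vimage [OF I]]]
  by (simp add: const.psubst_mvar cofactor_simps)

context chart
begin

lemma prime_or_unit_iff: "prime_or_unit (range \<Phi>) (\<Phi> p) \<longleftrightarrow> prime_or_unit_mod I p"
proof -
  have d: "divides_in (range \<Phi>) (\<Phi> p) (\<Phi> g) \<longleftrightarrow> (\<exists>s. g - p * s \<in> I)" for g
    unfolding divides_in_def using Phi_eq_iff by (auto simp: rat.psubst_mult simp flip: rat.psubst_mult)
  have "prime_or_unit (range \<Phi>) (\<Phi> p) \<longleftrightarrow>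
      (\<forall>g h. divides_in (range \<Phi>) (\<Phi> p) (\<Phi> (g * h)) \<longrightarrow>
         divides_in (range \<Phi>) (\<Phi> p) (\<Phi> g) \<or> divides_in (range \<Phi>) (\<Phi> p) (\<Phi> h))"
    unfolding prime_or_unit_def by (auto simp: rat.psubst_mult)
  also have "\<dots> \<longleftrightarrow> prime_or_unit_mod I p" unfolding d prime_or_unit_mod_def by blast
  finally show ?thesis .
qed

text \<open>
  An infinite sequence of proper divisions gives a strictly ascending chain of principal ideals in
  the range of \<open>\<Phi>\<close>. Their preimages under \<open>\<Phi>\<close> are ideals of \<open>R\<close>, and the union of these is
  finitely generated.
\<close>

lemma no_infinite_division:
  assumes b: "\<And>n. b n \<in> range \<Phi>" "\<And>n. b n \<noteq> 0" and p: "\<And>n. b n = p n * b (Suc n)"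
    and out: "\<And>n. \<not> divides_in (range \<Phi>) (p n) 1" and pA: "\<And>n. p n \<in> range \<Phi>"
  shows False
proof -
  let ?A = "range \<Phi>"
  note A = subring_setD [OF Phi_range_subring]
  define T where "T n = {r. divides_in ?A (b n) (\<Phi> r)}" for n
  have T: "ideal_set (T n)" for n
    unfolding ideal_set_def T_def
  proof (intro conjI ballI allI)
    show "0 \<in> {r. divides_in ?A (b n) (\<Phi> r)}" using A(2) by (auto intro!: divides_inI [of 0])
    fix r assume r: "r \<in> {r. divides_in ?A (b n) (\<Phi> r)}"
    show "s * r \<in> {r. divides_in ?A (b n) (\<Phi> r)}" for s
      using r divides_in_mult [OF Phi_range_subring, of "b n" "\<Phi> r" "\<Phi> s"] by (simp add: rat.psubst_mult mult.commute)
    fix s assume "s \<in> {r. divides_in ?A (b n) (\<Phi> r)}"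
    with r show "r + s \<in> {r. divides_in ?A (b n) (\<Phi> r)}"
      by (simp add: rat.psubst_add divides_in_add [OF Phi_range_subring])
  qed
  have step: "T n \<subseteq> T (Suc n)" for n
  proof
    fix r assume "r \<in> T n"
    then obtain c where c: "c \<in> ?A" "\<Phi> r = b n * c" by (auto simp: T_def divides_in_def)
    then have "\<Phi> r = b (Suc n) * (p n * c)" by (simp add: p [of n] ac_simps)
    then show "r \<in> T (Suc n)" unfolding T_def using A(4) [OF pA c(1)] by (intro CollectI divides_inI)
  qed
  have mono: "m \<le> n \<Longrightarrow> T m \<subseteq> T n" for m n using step by (rule lift_Suc_mono_le)
  have "ideal_set (\<Union>n. T n)"
    unfolding ideal_set_def
  proof (intro conjI ballI allI)
    show "0 \<in> (\<Union>n. T n)" using ideal_setD(1) [OF T] by blast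
    fix r assume "r \<in> (\<Union>n. T n)"
    then obtain m where r: "r \<in> T m" by blast
    show "s * r \<in> (\<Union>n. T n)" for s using ideal_setD(3) [OF T r] by blast
    fix s assume "s \<in> (\<Union>n. T n)"
    then obtain n where s: "s \<in> T n" by blast
    have "r \<in> T (max m n)" "s \<in> T (max m n)" using r s mono [of m "max m n"] mono [of n "max m n"] by auto
    then show "r + s \<in> (\<Union>n. T n)" using ideal_setD(2) [OF T] by blast
  qed
  then obtain B where B: "finite B" "B \<subseteq> (\<Union>n. T n)" "(\<Union>n. T n) = ideal_gen B"
    using polynomial_ideal_finitely_generated by blast
  have "\<exists>N. B \<subseteq> T N"
    using B(1,2)
  proof induct
    case (insert r B)
    then obtain M N where "B \<subseteq> T M" "r \<in> T N" by blast
    then have "insert r B \<subseteq> T (max M N)" using mono [of M "max M N"] mono [of N "max M N"] by auto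
    then show ?case ..
  qed simp
  then obtain N where "B \<subseteq> T N" ..
  then have "T (Suc N) \<subseteq> T N" using B(3) ideal_gen_least [OF T] by blast
  moreover obtain g where g: "b (Suc N) = \<Phi> g" using b(1) by blast
  moreover have "g \<in> T (Suc N)" unfolding T_def using A(1) g by (intro CollectI divides_inI [of 1]) auto
  ultimately have "g \<in> T N" by blast
  then have "divides_in ?A (b N) (b (Suc N))" unfolding T_def g by blast
  then obtain c where c: "c \<in> ?A" "b (Suc N) = b N * c" unfolding divides_in_def by blast
  have "b (Suc N) * 1 = b (Suc N) * (p N * c)" using c(2) p [of N] by (simp add: ac_simps)
  then have "1 = p N * c" using mult_left_cancel [OF b(2) [of "Suc N"]] by blast
  then show False using out [of N] c(1) by (auto simp: divides_in_def)
qed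

text \<open>Otherwise, elements of \<open>P\<close> could be split off for ever.\<close>

lemma reduced_decomposition:
  assumes P: "P \<subseteq> range \<Phi>" "0 \<notin> P" and a: "a \<in> range \<Phi>" "a \<noteq> 0"
  shows "\<exists>ms q. set ms \<subseteq> P \<and> q \<in> range \<Phi> \<and>
    (\<forall>p\<in>P. divides_in (range \<Phi>) p q \<longrightarrow> divides_in (range \<Phi>) p 1) \<and> a = prod_list ms * q"
proof (rule ccontr)
  define bad where "bad a \<longleftrightarrow> a \<in> range \<Phi> \<and> a \<noteq> 0 \<and> \<not> (\<exists>ms q. set ms \<subseteq> P \<and> q \<in> range \<Phi> \<and>
    (\<forall>p\<in>P. divides_in (range \<Phi>) p q \<longrightarrow> divides_in (range \<Phi>) p 1) \<and> a = prod_list ms * q)" for a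
  assume "\<not> ?thesis"
  then have bad0: "bad a" using a by (simp add: bad_def)
  have next_bad: "\<exists>c. bad c \<and> (\<exists>p\<in>P. \<not> divides_in (range \<Phi>) p 1 \<and> b = p * c)" if b: "bad b" for b
  proof -
    have "\<exists>p\<in>P. divides_in (range \<Phi>) p b \<and> \<not> divides_in (range \<Phi>) p 1"
    proof (rule ccontr)
      assume "\<not> ?thesis"
      then have "set [] \<subseteq> P \<and> b \<in> range \<Phi> \<and>
          (\<forall>p\<in>P. divides_in (range \<Phi>) p b \<longrightarrow> divides_in (range \<Phi>) p 1) \<and> b = prod_list [] * b"
        using b by (auto simp: bad_def)
      with b show False unfolding bad_def by blast
    qed
    then obtain p c where p: "p \<in> P" "\<not> divides_in (range \<Phi>) p 1" "c \<in> range \<Phi>" "b = p * c"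
      by (auto simp: divides_in_def)
    have "\<not> (\<exists>ms q. set ms \<subseteq> P \<and> q \<in> range \<Phi> \<and>
        (\<forall>p\<in>P. divides_in (range \<Phi>) p q \<longrightarrow> divides_in (range \<Phi>) p 1) \<and> c = prod_list ms * q)"
    proof
      assume "\<exists>ms q. set ms \<subseteq> P \<and> q \<in> range \<Phi> \<and>
        (\<forall>p\<in>P. divides_in (range \<Phi>) p q \<longrightarrow> divides_in (range \<Phi>) p 1) \<and> c = prod_list ms * q"
      then obtain ms q where m: "set ms \<subseteq> P" "q \<in> range \<Phi>"
        "\<forall>p\<in>P. divides_in (range \<Phi>) p q \<longrightarrow> divides_in (range \<Phi>) p 1" "c = prod_list ms * q" by blast
      have "set (p # ms) \<subseteq> P" "b = prod_list (p # ms) * q" using p(1,4) m(1,4) by (simp_all add: mult.assoc)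
      with b m(2,3) show False unfolding bad_def by blast
    qed
    moreover have "c \<noteq> 0" using b p(4) by (auto simp: bad_def)
    ultimately have "bad c" using p(3) by (simp add: bad_def)
    with p show ?thesis by blast
  qed
  have "\<exists>f. \<forall>n. bad (f n) \<and> (\<exists>p\<in>P. \<not> divides_in (range \<Phi>) p 1 \<and> f n = p * f (Suc n))"
    using dependent_nat_choice [of "\<lambda>_. bad" "\<lambda>_ b c. \<exists>p\<in>P. \<not> divides_in (range \<Phi>) p 1 \<and> b = p * c"]
      bad0 next_bad by blast
  then obtain b where b: "\<And>n. bad (b n)" and "\<And>n. \<exists>p\<in>P. \<not> divides_in (range \<Phi>) p 1 \<and> b n = p * b (Suc n)" by blast
  then obtain p where p: "\<And>n. p n \<in> P" "\<And>n. \<not> divides_in (range \<Phi>) (p n) 1" "\<And>n. b n = p n * b (Suc n)" by metis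
  show False
  proof (rule no_infinite_division [of b p])
    show "b n \<in> range \<Phi>" "b n \<noteq> 0" for n using b unfolding bad_def by blast+
    show "p n \<in> range \<Phi>" for n using p(1) P(1) by blast
  qed (fact p)+
qed

end

text \<open>
  Nagata's theorem for the chart with denominator \<open>x 0 0 * [0 1|0 1]\<close>, whose localisation inverts
  exactly the two elements that are known to be prime or invertible.
\<close>

theorem hprime_ufd:
  fixes I :: "'k :: field_char_0 mat3_poly set"
  assumes I: "hprime I"
  shows "\<exists>z. ufd_set (range (psubst const_fraction z)) \<and> (\<forall>g. psubst const_fraction z g = 0 \<longleftrightarrow> g \<in> I) \<and>
    (\<forall>p. prime_or_unit (range (psubst const_fraction z)) (psubst const_fraction z p) \<longleftrightarrow> prime_or_unit_mod I p)"
proof -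
  interpret chart I "mvar 0 0 * minor 0 1 0 1" gauss_vars "gauss_free I" "gauss_point I" by (rule gauss_chart [OF I])
  let ?A = "range \<Phi>" and ?e = "mvar 0 0 * minor 0 1 0 1 :: 'k mat3_poly"
  let ?L = "localisation ?A (\<Phi> ?e)"
  define P where "P = {\<Phi> (mvar 0 0), \<Phi> (minor 0 1 0 1)}"
  have nz: "\<Phi> (mvar 0 0) \<noteq> 0" "\<Phi> (minor 0 1 0 1) \<noteq> 0"
    using corner_notin [OF I] leading_minor_notin [OF I] by (simp_all add: Phi_kernel)
  have e: "\<Phi> ?e = \<Phi> (mvar 0 0) * \<Phi> (minor 0 1 0 1)" by (rule rat.psubst_mult)
  have "ufd_set ?A"
  proof (rule nagata [of ?A ?L P])
    show "subring_set ?A" by (rule Phi_range_subring)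
    show "ufd_set ?L" by (rule localisation_ufd)
    show "?A \<subseteq> ?L" by (rule subset_localisation)
    show "P \<subseteq> {p \<in> ?A. p \<noteq> 0 \<and> prime_or_unit ?A p}"
      using nz corner_prime_or_unit [OF I] leading_minor_prime_or_unit [OF I] by (auto simp: P_def prime_or_unit_iff)
    show "\<exists>c\<in>?L. p * c = 1" if "p \<in> P" for p
    proof
      show "p * (1 / p) = 1" using that nz by (auto simp: P_def)
      have "1 / p * \<Phi> ?e ^ 1 \<in> ?A" using that nz unfolding e by (auto simp: P_def)
      then show "1 / p \<in> ?L" unfolding localisation_def by blast
    qed
    show "\<exists>ms. set ms \<subseteq> P \<and> prod_list ms * b \<in> ?A" if b: "b \<in> ?L" for b
    proof -
      obtain n where "b * \<Phi> ?e ^ n \<in> ?A" using b by (auto simp: localisation_def)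
      moreover have "prod_list (replicate n (\<Phi> (mvar 0 0)) @ replicate n (\<Phi> (minor 0 1 0 1))) = \<Phi> ?e ^ n"
        unfolding e by (simp add: power_mult_distrib)
      ultimately show ?thesis
        by (intro exI [of _ "replicate n (\<Phi> (mvar 0 0)) @ replicate n (\<Phi> (minor 0 1 0 1))"])
          (auto simp: P_def mult.commute)
    qed
    show "\<exists>ms q. set ms \<subseteq> P \<and> q \<in> ?A \<and> (\<forall>p\<in>P. divides_in ?A p q \<longrightarrow> divides_in ?A p 1) \<and> a = prod_list ms * q"
      if "a \<in> ?A" "a \<noteq> 0" for a
      using that nz by (intro reduced_decomposition) (auto simp: P_def)
  qed
  then show ?thesis using Phi_kernel prime_or_unit_iff by blast
qed

theorem hprime_factorisation:
  fixes I :: "'k :: field_char_0 mat3_poly set"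
  assumes I: "hprime I"
  shows "a * b \<in> I \<Longrightarrow> a \<in> I \<or> b \<in> I"
    and "a \<notin> I \<Longrightarrow> \<exists>ps. set ps \<subseteq> {p. p \<notin> I \<and> prime_or_unit_mod I p} \<and> a - prod_list ps \<in> I"
proof -
  obtain z where z: "ufd_set (range (psubst const_fraction z))" "\<And>g. psubst const_fraction z g = 0 \<longleftrightarrow> g \<in> I"
    "\<And>p. prime_or_unit (range (psubst const_fraction z)) (psubst const_fraction z p) \<longleftrightarrow> prime_or_unit_mod I p"
    using hprime_ufd [OF I] by blast
  let ?f = "psubst const_fraction z"
  show "a * b \<in> I \<Longrightarrow> a \<in> I \<or> b \<in> I" by (simp add: z(2) [symmetric] rat.psubst_mult)
  assume a: "a \<notin> I"
  then have "?f a \<noteq> 0" by (simp add: z(2))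
  then obtain qs where qs: "set qs \<subseteq> {p \<in> range ?f. p \<noteq> 0 \<and> prime_or_unit (range ?f) p}" "?f a = prod_list qs"
    using z(1) unfolding ufd_set_def by blast
  have "\<exists>ps. qs = map ?f ps" using qs(1) by (induct qs) (auto simp: Cons_eq_map_conv)
  then obtain ps where ps: "qs = map ?f ps" ..
  have "?f (prod_list ps) = prod_list qs" unfolding ps by (induct ps) (simp_all add: rat.psubst_mult)
  then have "a - prod_list ps \<in> I" using qs(2) by (simp add: z(2) [symmetric] rat.psubst_diff)
  moreover have "set ps \<subseteq> {p. p \<notin> I \<and> prime_or_unit_mod I p}"
  proof
    fix p assume "p \<in> set ps"
    then have "?f p \<in> set qs" by (simp add: ps)
    then have "?f p \<noteq> 0 \<and> prime_or_unit (range ?f) (?f p)" using qs(1) by blast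
    then show "p \<in> {p. p \<notin> I \<and> prime_or_unit_mod I p}" by (simp add: z(2,3))
  qed
  ultimately show "\<exists>ps. set ps \<subseteq> {p. p \<notin> I \<and> prime_or_unit_mod I p} \<and> a - prod_list ps \<in> I" by blast
qed


section \<open>From residues to the quotient ring\<close>

text \<open>
  Factorisation into elements that are prime or invertible, stated for representatives, is
  transported to the multiplicative monoid of the quotient \<open>Q\<close>. Dropping the invertible factors
  gives the existence of factorisations; uniqueness follows since an irreducible element, being a
  product of such factors, is associated to one of them and hence prime.
\<close>

lemma factorial_domain_presentation:
  fixes Q (structure) and \<pi> :: "'a :: comm_ring_1 \<Rightarrow> 'q" and I :: "'a set"
  assumes Q: "cring Q" and I: "ideal_set I"
    and surj: "range \<pi> = carrier Q" and hom: "\<pi> 1 = \<one>" "\<pi> 0 = \<zero>" "\<And>f g. \<pi> (f * g) = \<pi> f \<otimes> \<pi> g"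
    and eq: "\<And>f g. \<pi> f = \<pi> g \<longleftrightarrow> f - g \<in> I"
    and one: "1 \<notin> I" and prime: "\<And>a b. a * b \<in> I \<Longrightarrow> a \<in> I \<or> b \<in> I"
    and fact: "\<And>a. a \<notin> I \<Longrightarrow> \<exists>ps. set ps \<subseteq> {p. p \<notin> I \<and> prime_or_unit_mod I p} \<and> a - prod_list ps \<in> I"
  shows "factorial_domain Q"
proof -
  have zero: "\<pi> f = \<zero> \<longleftrightarrow> f \<in> I" for f using eq [of f 0] by (simp add: hom)
  have dom: "domain Q"
  proof (intro domain.intro Q domain_axioms.intro)
    show "\<one> \<noteq> \<zero>" using zero [of 1] one by (simp add: hom)
    fix x y assume xy: "x \<otimes> y = \<zero>" "x \<in> carrier Q" "y \<in> carrier Q"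
    then obtain f g where "x = \<pi> f" "y = \<pi> g" using surj by (metis rangeE)
    with xy(1) show "x = \<zero> \<or> y = \<zero>" using prime by (simp add: hom(3) [symmetric] zero)
  qed
  let ?G = "mult_of Q"
  have "comm_monoid_cancel ?G"
  proof -
    interpret domain Q by (rule dom)
    show ?thesis by unfold_locales
  qed
  then interpret G: comm_monoid_cancel ?G .
  have carr: "x \<in> carrier ?G \<longleftrightarrow> (\<exists>f. f \<notin> I \<and> x = \<pi> f)" for x
    unfolding carrier_mult_of surj [symmetric] using zero by auto
  have pi_carr: "\<pi> f \<in> carrier ?G \<longleftrightarrow> f \<notin> I" for f using surj zero by auto
  have mult: "\<pi> f \<otimes>\<^bsub>?G\<^esub> \<pi> g = \<pi> (f * g)" for f g by (simp add: hom)
  have dvd: "\<pi> f divides\<^bsub>?G\<^esub> \<pi> g \<longleftrightarrow> (\<exists>s. g - f * s \<in> I)" if "g \<notin> I" for f g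
  proof
    assume "\<pi> f divides\<^bsub>?G\<^esub> \<pi> g"
    then obtain c where "c \<in> carrier ?G" "\<pi> g = \<pi> f \<otimes>\<^bsub>?G\<^esub> c" by (auto simp: factor_def)
    then show "\<exists>s. g - f * s \<in> I" using carr eq mult by metis
  next
    assume "\<exists>s. g - f * s \<in> I"
    then obtain s where s: "g - f * s \<in> I" ..
    then have "s \<notin> I" using that ideal_set_cong [OF I s] ideal_setD(3) [OF I] by blast
    with s show "\<pi> f divides\<^bsub>?G\<^esub> \<pi> g" unfolding factor_def using pi_carr eq mult by metis
  qed
  have pr: "Divisibility.prime ?G (\<pi> p)" if p: "p \<notin> I" "prime_or_unit_mod I p" "\<pi> p \<notin> Units ?G" for p
  proof (rule primeI [OF p(3)])
    fix a b assume "a \<in> carrier ?G" "b \<in> carrier ?G" and d: "\<pi> p divides\<^bsub>?G\<^esub> a \<otimes>\<^bsub>?G\<^esub> b"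
    then obtain f g where fg: "f \<notin> I" "a = \<pi> f" "g \<notin> I" "b = \<pi> g" using carr by blast
    have "f * g \<notin> I" using fg prime by blast
    then obtain s where "f * g - p * s \<in> I" using d dvd fg mult by metis
    then show "\<pi> p divides\<^bsub>?G\<^esub> a \<or> \<pi> p divides\<^bsub>?G\<^esub> b"
      using p(2) fg dvd unfolding prime_or_unit_mod_def by blast
  qed
  let ?good = "\<lambda>ps. set ps \<subseteq> {p. p \<notin> I \<and> prime_or_unit_mod I p}"
  have prod_out: "prod_list ps \<notin> I" if "?good ps" for ps using that one prime by (induct ps) auto
  have factors: "\<exists>fs. set fs \<subseteq> carrier ?G \<and> wfactors ?G fs (\<pi> (prod_list ps))" if "?good ps" for ps
    using that
  proof (induct ps)
    case Nil
    have "wfactors ?G [] (\<pi> (prod_list []))" using G.unit_wfactors [OF G.Units_one_closed] by (simp add: hom)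
    then show ?case by (intro exI [of _ "[]"]) simp
  next
    case (Cons p ps)
    then obtain fs where fs: "set fs \<subseteq> carrier ?G" "wfactors ?G fs (\<pi> (prod_list ps))" by auto
    have c: "\<pi> p \<in> carrier ?G" "\<pi> (prod_list ps) \<in> carrier ?G" using Cons.prems prod_out [of ps] pi_carr by auto
    have m: "\<pi> (prod_list (p # ps)) = \<pi> p \<otimes>\<^bsub>?G\<^esub> \<pi> (prod_list ps)" by (simp add: hom)
    show ?case
    proof (cases "\<pi> p \<in> Units ?G")
      case True
      have "wfactors ?G ([] @ fs) (\<pi> p \<otimes>\<^bsub>?G\<^esub> \<pi> (prod_list ps))"
        using G.unit_wfactors [OF True] fs c by (intro G.wfactors_mult) simp_all
      then show ?thesis unfolding m using fs(1) by auto
    next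
      case False
      then have "Divisibility.prime ?G (\<pi> p)" using pr Cons.prems by simp
      then have "wfactors ?G (\<pi> p # fs) (\<pi> p \<otimes>\<^bsub>?G\<^esub> \<pi> (prod_list ps))"
        using G.prime_irreducible fs c by (intro G.wfactors_mult_single)
      then show ?thesis unfolding m using fs(1) c(1) by (intro exI [of _ "\<pi> p # fs"]) auto
    qed
  qed
  have irr: "Divisibility.prime ?G (\<pi> (prod_list ps))" if "?good ps" "irreducible ?G (\<pi> (prod_list ps))" for ps
    using that
  proof (induct ps)
    case Nil
    then show ?case using G.Units_one_closed by (simp add: hom irreducible_def)
  next
    case (Cons p ps)
    let ?a = "\<pi> p" and ?b = "\<pi> (prod_list ps)"
    have c: "?a \<in> carrier ?G" "?b \<in> carrier ?G" using Cons.prems(1) prod_out [of ps] pi_carr by auto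
    have m: "\<pi> (prod_list (p # ps)) = ?a \<otimes>\<^bsub>?G\<^esub> ?b" by (simp add: hom)
    have ab: "?a \<otimes>\<^bsub>?G\<^esub> ?b \<in> carrier ?G" using c by (rule G.m_closed)
    show ?case
      using Cons.prems(2) unfolding m
    proof (rule G.irreducible_prodE [OF _ c])
      assume u: "irreducible ?G ?a" "?b \<in> Units ?G"
      then have "?a \<notin> Units ?G" by (simp add: irreducible_def)
      then have p: "Divisibility.prime ?G ?a" using pr Cons.prems(1) by simp
      have "?a \<otimes>\<^bsub>?G\<^esub> ?b \<sim>\<^bsub>?G\<^esub> ?a" by (rule G.associatedI2' [OF refl u(2) c(1)])
      then show "Divisibility.prime ?G (?a \<otimes>\<^bsub>?G\<^esub> ?b)"
        using G.prime_cong [OF p G.associated_sym c(1) ab] by blast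
    next
      assume u: "?a \<in> Units ?G" "irreducible ?G ?b"
      then have p: "Divisibility.prime ?G ?b" using Cons by simp
      have "?a \<otimes>\<^bsub>?G\<^esub> ?b \<sim>\<^bsub>?G\<^esub> ?b" by (rule G.associatedI2' [OF G.m_comm [OF c] u(1) c(2)])
      then show "Divisibility.prime ?G (?a \<otimes>\<^bsub>?G\<^esub> ?b)"
        using G.prime_cong [OF p G.associated_sym c(2) ab] by blast
    qed
  qed
  have rep: "\<exists>ps. ?good ps \<and> x = \<pi> (prod_list ps)" if x: "x \<in> carrier ?G" for x
  proof -
    obtain f where f: "f \<notin> I" "x = \<pi> f" using x carr by blast
    then show ?thesis using fact [OF f(1)] eq by metis
  qed
  have pc: "primeness_condition_monoid ?G"
  proof (intro primeness_condition_monoid.intro primeness_condition_monoid_axioms.intro G.comm_monoid_cancel_axioms)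
    fix x assume "x \<in> carrier ?G" "irreducible ?G x"
    then show "Divisibility.prime ?G x" using rep irr by metis
  qed
  have "factorial_monoid ?G"
  proof (rule G.factorial_monoidI)
    show "\<exists>fs. set fs \<subseteq> carrier ?G \<and> wfactors ?G fs x" if "x \<in> carrier ?G" for x
      using rep [OF that] factors by metis
    show "essentially_equal ?G fs fs'"
      if "x \<in> carrier ?G" "set fs \<subseteq> carrier ?G" "set fs' \<subseteq> carrier ?G" "wfactors ?G fs x" "wfactors ?G fs' x" for x fs fs'
      using primeness_condition_monoid.wfactors_unique [OF pc] that by blast
  qed
  then show ?thesis using dom by (simp add: factorial_domain_def)
qed

lemma coset_presentation:
  fixes R (structure)
  assumes R: "cring R" and J: "ideal J R"
  shows "cring (R Quot J)" "carrier (R Quot J) = (\<lambda>a. J +> a) ` carrier R"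
    "(\<lambda>a. J +> a) \<in> ring_hom R (R Quot J)" "J +> \<zero> = \<zero>\<^bsub>R Quot J\<^esub>"
    "a \<in> carrier R \<Longrightarrow> b \<in> carrier R \<Longrightarrow> J +> a = J +> b \<longleftrightarrow> a \<ominus> b \<in> J"
proof -
  interpret R: cring R by (rule R)
  show Q: "cring (R Quot J)" by (rule ideal.quotient_is_cring [OF J R])
  show "carrier (R Quot J) = (\<lambda>a. J +> a) ` carrier R" by (auto simp: FactRing_def A_RCOSETS_def')
  show h: "(\<lambda>a. J +> a) \<in> ring_hom R (R Quot J)" by (rule ideal.rcos_ring_hom [OF J])
  show "J +> \<zero> = \<zero>\<^bsub>R Quot J\<^esub>" by (rule ring_hom_zero [OF h R.ring_axioms cring.axioms(1) [OF Q]])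
  show "a \<in> carrier R \<Longrightarrow> b \<in> carrier R \<Longrightarrow> J +> a = J +> b \<longleftrightarrow> a \<ominus> b \<in> J"
    using R.quotient_eq_iff_same_a_r_cos [OF J] by blast
qed

abbreviation SL3_class :: "'k :: comm_ring_1 mat3_poly \<Rightarrow> 'k mat3_poly set" where
  "SL3_class f \<equiv> Det_ideal +>\<^bsub>O_M3\<^esub> f"

lemma O_M3_simps: "carrier O_M3 = UNIV" "a \<otimes>\<^bsub>O_M3\<^esub> b = a * b" "a \<oplus>\<^bsub>O_M3\<^esub> b = a + b"
  "\<one>\<^bsub>O_M3\<^esub> = 1" "\<zero>\<^bsub>O_M3\<^esub> = 0"
  by (simp_all add: O_M3_def cring_class_ops_def)

lemma O_M3_minus: "a \<ominus>\<^bsub>O_M3\<^esub> b = a - b"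
  unfolding O_M3_def by (rule minus_class)

lemma Det_ideal_ideal: "ideal (Det_ideal :: 'k :: comm_ring_1 mat3_poly set) O_M3"
  unfolding Det_ideal_def O_M3_def
  by (rule ring.genideal_ideal [OF cring.axioms(1) [OF cring_class]]) (simp add: carrier_class)

lemma O_M3_cring: "cring (O_M3 :: 'k :: comm_ring_1 mat3_poly ring)"
  unfolding O_M3_def by (rule cring_class)

lemma O_SL3_presentation:
  "cring (O_SL3 :: 'k :: comm_ring_1 mat3_poly set ring)"
  "carrier (O_SL3 :: 'k mat3_poly set ring) = range SL3_class"
  "SL3_class f \<otimes>\<^bsub>O_SL3\<^esub> SL3_class g = (SL3_class (f * g) :: 'k mat3_poly set)"
  "SL3_class f \<oplus>\<^bsub>O_SL3\<^esub> SL3_class g = (SL3_class (f + g) :: 'k mat3_poly set)"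
  "\<one>\<^bsub>O_SL3\<^esub> = (SL3_class 1 :: 'k mat3_poly set)" "\<zero>\<^bsub>O_SL3\<^esub> = (SL3_class 0 :: 'k mat3_poly set)"
  "(SL3_class f :: 'k mat3_poly set) = SL3_class g \<longleftrightarrow> f - g \<in> Det_ideal"
proof -
  note p = coset_presentation [OF O_M3_cring [where 'k = 'k] Det_ideal_ideal [where 'k = 'k], folded O_SL3_def, unfolded O_M3_simps O_M3_minus]
  show "cring (O_SL3 :: 'k mat3_poly set ring)" by (rule p)
  show "carrier (O_SL3 :: 'k mat3_poly set ring) = range SL3_class" by (rule p)
  show "SL3_class f \<otimes>\<^bsub>O_SL3\<^esub> SL3_class g = (SL3_class (f * g) :: 'k mat3_poly set)"
    using ring_hom_mult [OF p(3), of f g] by (simp add: O_M3_simps)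
  show "SL3_class f \<oplus>\<^bsub>O_SL3\<^esub> SL3_class g = (SL3_class (f + g) :: 'k mat3_poly set)"
    using ring_hom_add [OF p(3), of f g] by (simp add: O_M3_simps)
  show "\<one>\<^bsub>O_SL3\<^esub> = (SL3_class 1 :: 'k mat3_poly set)"
    using ring_hom_one [OF p(3)] by (simp add: O_M3_simps)
  show "\<zero>\<^bsub>O_SL3\<^esub> = (SL3_class 0 :: 'k mat3_poly set)" using p(4) by simp
  show "(SL3_class f :: 'k mat3_poly set) = SL3_class g \<longleftrightarrow> f - g \<in> Det_ideal" by (rule p) simp_all
qed

text \<open>
  Needed to test primality of the preimage of \<open>I\<close>: its definition quantifies over stable ideals of
  \<open>R\<close>, that of a Poisson \<open>H\<close>-prime over those of the quotient.
\<close>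

lemma poisson_stable_image:
  assumes J: "poisson_stable (J :: 'k :: field mat3_poly set)"
  shows "poisson_ideal O_SL3 SL3_bracket (SL3_class ` J)" "stable_under torus SL3_torus_act (SL3_class ` J)"
proof -
  note j = poisson_stableD [OF J]
  note p = O_SL3_presentation [where 'k = 'k]
  interpret S: cring "O_SL3 :: 'k mat3_poly set ring" by (rule p(1))
  have "ideal (SL3_class ` J) O_SL3"
  proof (rule idealI [OF S.ring_axioms])
    show "subgroup (SL3_class ` J) (add_monoid O_SL3)"
    proof (rule S.add.subgroupI)
      show "SL3_class ` J \<subseteq> carrier O_SL3" by (auto simp: p(2))
      show "SL3_class ` J \<noteq> {}" using ideal_setD(1) [OF j(1)] by blast
      fix a assume "a \<in> SL3_class ` J"
      then obtain f where f: "f \<in> J" "a = SL3_class f" by blast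
      have "a \<oplus>\<^bsub>O_SL3\<^esub> SL3_class (- f) = \<zero>\<^bsub>O_SL3\<^esub>" by (simp add: f(2) p(4,6))
      then have "\<ominus>\<^bsub>O_SL3\<^esub> a = SL3_class (- f)"
        using S.minus_equality [of "SL3_class (- f)" a] f(2) S.a_comm [of a "SL3_class (- f)"] by (simp add: p(2))
      then show "\<ominus>\<^bsub>O_SL3\<^esub> a \<in> SL3_class ` J" using ideal_setD(5) [OF j(1) f(1)] by blast
      fix b assume "b \<in> SL3_class ` J"
      then obtain g where g: "g \<in> J" "b = SL3_class g" by blast
      show "a \<oplus>\<^bsub>O_SL3\<^esub> b \<in> SL3_class ` J" using ideal_setD(2) [OF j(1) f(1) g(1)] by (simp add: f(2) g(2) p(4))
    qed
    fix a x assume "a \<in> SL3_class ` J" "x \<in> carrier (O_SL3 :: 'k mat3_poly set ring)"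
    then obtain f r where f: "f \<in> J" "a = SL3_class f" "x = SL3_class r" by (auto simp: p(2))
    show "x \<otimes>\<^bsub>O_SL3\<^esub> a \<in> SL3_class ` J" using ideal_setD(3) [OF j(1) f(1), of r] by (simp add: f(2,3) p(3))
    show "a \<otimes>\<^bsub>O_SL3\<^esub> x \<in> SL3_class ` J" using ideal_setD(4) [OF j(1) f(1), of r] by (simp add: f(2,3) p(3))
  qed
  moreover have "SL3_bracket a b \<in> SL3_class ` J" if "a \<in> SL3_class ` J" "b \<in> carrier O_SL3" for a b
    using that j(3) by (auto simp: p(2) SL3_bracket_coset)
  ultimately show "poisson_ideal O_SL3 SL3_bracket (SL3_class ` J)" by (simp add: poisson_ideal_def)
  show "stable_under torus SL3_torus_act (SL3_class ` J)"
    unfolding stable_under_def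
  proof (intro ballI)
    fix h :: "(3 \<Rightarrow> 'k) \<times> (3 \<Rightarrow> 'k)" and a assume h: "h \<in> torus" and "a \<in> SL3_class ` J"
    then obtain f where f: "f \<in> J" "a = SL3_class f" by blast
    show "SL3_torus_act h a \<in> SL3_class ` J"
      unfolding f(2) SL3_torus_act_coset [OF h] using j(5) [OF h f(1)] by (rule imageI)
  qed
qed

lemma hprime_vimage_SL3_class:
  fixes I :: "'k :: field mat3_poly set set"
  assumes I: "poisson_H_prime O_SL3 SL3_bracket torus SL3_torus_act I"
  shows "hprime {f. SL3_class f \<in> I}"
proof -
  note p = O_SL3_presentation [where 'k = 'k]
  have pI: "poisson_ideal O_SL3 SL3_bracket I" and stable: "stable_under torus SL3_torus_act I"
    and proper: "I \<noteq> carrier O_SL3"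
    and prime: "\<And>J K. poisson_ideal O_SL3 SL3_bracket J \<Longrightarrow> stable_under torus SL3_torus_act J \<Longrightarrow>
      poisson_ideal O_SL3 SL3_bracket K \<Longrightarrow> stable_under torus SL3_torus_act K \<Longrightarrow>
      J \<cdot>\<^bsub>O_SL3\<^esub> K \<subseteq> I \<Longrightarrow> J \<subseteq> I \<or> K \<subseteq> I"
    using I unfolding poisson_H_prime_def by blast+
  interpret ideal I "O_SL3 :: 'k mat3_poly set ring" using pI by (simp add: poisson_ideal_def)
  have br: "\<And>a b. a \<in> I \<Longrightarrow> b \<in> carrier O_SL3 \<Longrightarrow> SL3_bracket a b \<in> I" using pI by (auto simp: poisson_ideal_def)
  let ?I = "{f. SL3_class f \<in> I}"
  show ?thesis
    unfolding hprime_def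
  proof (intro conjI allI impI)
    show "poisson_stable ?I"
      unfolding poisson_stable_def ideal_set_def
    proof (intro conjI ballI allI)
      show "0 \<in> ?I" using additive_subgroup.zero_closed [OF ideal.axioms(1) [OF ideal_axioms]] by (simp add: p(6))
      have "SL3_class (Det - 1) = (SL3_class 0 :: 'k mat3_poly set)"
        unfolding p(7) unfolding Det_ideal_eq by (rule range_eqI [of _ _ 1]) simp
      then show "Det - 1 \<in> ?I" using \<open>0 \<in> ?I\<close> by simp
      fix a assume a: "a \<in> ?I"
      show "b \<in> ?I \<Longrightarrow> a + b \<in> ?I" for b using a a_closed by (simp add: p(4) [symmetric])
      show "r * a \<in> ?I" for r using a I_l_closed [of "SL3_class a" "SL3_class r"] by (simp add: p(2,3))
      show "M3_bracket a b \<in> ?I" for b using a br [of "SL3_class a" "SL3_class b"] by (simp add: p(2) SL3_bracket_coset)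
      show "torus_act h a \<in> ?I" if h: "h \<in> torus" for h
        using stable h a unfolding stable_under_def by (simp add: SL3_torus_act_coset [OF h, symmetric])
    qed
    show "1 \<notin> ?I" using one_imp_carrier proper by (auto simp: p(5))
    fix J K :: "'k mat3_poly set"
    assume J: "poisson_stable J" and K: "poisson_stable K" and JK: "\<forall>a\<in>J. \<forall>b\<in>K. a * b \<in> ?I"
    have "SL3_class ` J \<cdot>\<^bsub>O_SL3\<^esub> SL3_class ` K \<subseteq> I"
    proof
      fix x assume "x \<in> SL3_class ` J \<cdot>\<^bsub>O_SL3\<^esub> SL3_class ` K"
      then show "x \<in> I"
        by (induct rule: ideal_prod.induct) (use JK in \<open>auto simp: p(3) intro: a_closed\<close>)
    qed
    then have "SL3_class ` J \<subseteq> I \<or> SL3_class ` K \<subseteq> I"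
      using poisson_stable_image [OF J] poisson_stable_image [OF K] by (intro prime)
    then show "J \<subseteq> ?I \<or> K \<subseteq> ?I" by blast
  qed
qed

theorem proposition1p4p2:
  fixes I :: "'k :: {alg_closed_field, field_char_0} mat3_poly set set"
  assumes "poisson_H_prime O_SL3 SL3_bracket torus SL3_torus_act I"
  shows "factorial_domain (O_SL3 Quot I)"
proof -
  let ?I = "{f. SL3_class f \<in> I}"
  have I: "hprime ?I" by (rule hprime_vimage_SL3_class [OF assms])
  note p = O_SL3_presentation [where 'k = 'k]
  have ideal: "ideal I O_SL3" using assms by (simp add: poisson_H_prime_def poisson_ideal_def)
  note q = coset_presentation [OF p(1) ideal]
  interpret S: cring "O_SL3 :: 'k mat3_poly set ring" by (rule p(1))
  let ?\<pi> = "\<lambda>f. I +>\<^bsub>O_SL3\<^esub> SL3_class f"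
  have carrier: "SL3_class f \<in> carrier O_SL3" for f :: "'k mat3_poly" by (simp add: p(2))
  show ?thesis
  proof (rule factorial_domain_presentation [of _ ?I ?\<pi>])
    show "cring (O_SL3 Quot I)" by (rule q)
    show "ideal_set ?I" by (rule hprimeD [OF I])
    show "range ?\<pi> = carrier (O_SL3 Quot I)" unfolding q(2) p(2) by blast
    show "?\<pi> 1 = \<one>\<^bsub>O_SL3 Quot I\<^esub>" using ring_hom_one [OF q(3)] by (simp add: p(5))
    show "?\<pi> 0 = \<zero>\<^bsub>O_SL3 Quot I\<^esub>" using q(4) by (simp add: p(6))
    show "?\<pi> (f * g) = ?\<pi> f \<otimes>\<^bsub>O_SL3 Quot I\<^esub> ?\<pi> g" for f g
      using ring_hom_mult [OF q(3) carrier carrier, of f g] by (simp add: p(3))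
    show "?\<pi> f = ?\<pi> g \<longleftrightarrow> f - g \<in> ?I" for f g
    proof -
      have "SL3_class (f - g) \<oplus>\<^bsub>O_SL3\<^esub> SL3_class g = SL3_class f" by (simp add: p(4))
      then have "SL3_class f \<ominus>\<^bsub>O_SL3\<^esub> SL3_class g = SL3_class (f - g)"
        using S.add.inv_solve_right [OF carrier carrier carrier] by (metis a_minus_def)
      then show ?thesis using q(5) [OF carrier carrier, of f g] by simp
    qed
    show "1 \<notin> ?I" by (rule hprimeD [OF I])
    show "a * b \<in> ?I \<Longrightarrow> a \<in> ?I \<or> b \<in> ?I" for a b by (rule hprime_factorisation(1) [OF I])
    show "a \<notin> ?I \<Longrightarrow> \<exists>ps. set ps \<subseteq> {p. p \<notin> ?I \<and> prime_or_unit_mod ?I p} \<and> a - prod_list ps \<in> ?I" for a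
      by (rule hprime_factorisation(2) [OF I])
  qed
qed

end
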